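(* Let $\mathcal{A}=\sum_{i=1}^N A^{(i)}\frac{\partial}{\partial x_i}$, with $A^{(i)}\in\mathbb{R}^{m\times d}$, be a first order linear differential operator satisfying $\mathrm{rank}\left(\sum_{i=1}^N A^{(i)}w_i\right)=m$ for every $w\in\mathbb{R}^N\setminus\{0\}$. Let $\Omega\subset\mathbb{R}^N$ be a bounded open set, let $F_i:\mathbb{R}^d\to\mathbb{R}$ be continuous and $\mathcal{A}$-quasiconvex, $i=1,\ldots,I$, and let $$E=\{\xi\in\mathbb{R}^d: F_i(\xi)=0,\ i=1,\ldots,I\}.$$ Assume that $\Lambda\mathrm{co}E$ is compact and strongly star shaped with respect to a fixed $\xi_0\in\mathrm{int}\,\Lambda\mathrm{co}E$, i.e. for every $\xi\in\Lambda\mathrm{co}E$ and every $t\in(0,1]$ we have $t\xi_0+(1-t)\xi\in\mathrm{int}\,\Lambda\mathrm{co}E$. If $0\in E\cup\mathrm{int}\,\Lambda\mathrm{co}E$, then there exists $u\in L^\infty(\mathbb{R}^N;\mathbb{R}^d)$ with $\mathcal{A}u=0$ in $\mathcal{D}'(\mathbb{R}^N;\mathbb{R}^m)$ such that $$F_i(u(x))=0\ \text{ for a.e. }x\in\Omega,\ i=1,\ldots,I,\qquad u=0\ \text{ in }\mathbb{R}^N\setminus\Omega.$$ Moreover there is a dense set of such $u$: the set of such functions $u$ belonging to $\overline{V}$ is dense in $\overline{V}$ for the weak* topology of $L^\infty(\mathbb{R}^N;\mathbb{R}^d)$, where $\overline{V}$ is the weak* closure in $L^\infty(\mathbb{R}^N;\mathbb{R}^d)$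 of $$V=\{u\in L^\infty_{\rm piec}(\mathbb{R}^N;\mathbb{R}^d):\ \mathcal{A}u=0\text{ in }\mathcal{D}'(\mathbb{R}^N;\mathbb{R}^m),\ u=0\text{ in }\mathbb{R}^N\setminus\Omega,\ u(x)\in E\cup\mathrm{int}\,\Lambda\mathrm{co}E\text{ for a.e. }x\in\Omega\}.$$
   Context: $\mathcal{A}$-quasiconvexity: a Borel measurable function $F:\mathbb{R}^d\to\mathbb{R}$ is $\mathcal{A}$-quasiconvex if $F(\xi)\le\int_Q F(\xi+w(x))\,dx$ for every $\xi\in\mathbb{R}^d$ and every $Q$-periodic $w\in C^\infty(\mathbb{R}^N;\mathbb{R}^d)$ with $\mathcal{A}w=0$ in $\mathbb{R}^N$ and $\int_Q w\,dx=0$, where $Q=(0,1)^N$. The characteristic cone of $\mathcal{A}$ is $\Lambda=\{v\in\mathbb{R}^d:\exists w\in\mathbb{R}^N\setminus\{0\},\ (\sum_{i=1}^N A^{(i)}w_i)v=0\}$. A function $G:\mathbb{R}^d\to\mathbb{R}\cup\{+\infty\}$ is $\Lambda$-convex if it is convex along the directions of $\Lambda$, i.e. $G(ta+(1-t)b)\le tG(a)+(1-t)G(b)$ for all $t\in[0,1]$ and all $a,b\in\mathbb{R}^d$ with $b-a\in\Lambda$. For $E\subset\mathbb{R}^d$, $$\Lambda\mathrm{co}E=\{\xi\in\mathbb{R}^d: G(\xi)\le0\text{ for every }\Lambda\text{-convex } G:\mathbb{R}^d\to\mathbb{R}\cup\{+\infty\}\text{ with }G=0\text{ on }E\}.$$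 $\mathrm{int}$ denotes the interior. $L^\infty_{\rm piec}(\mathbb{R}^N;\mathbb{R}^d)$ is the set of bounded piecewise constant functions, i.e. bounded functions for which there are at most countably many pairwise disjoint open sets, covering $\mathbb{R}^N$ up to a null set, on each of which the function is constant. *)

theory Defs
  imports "HOL-Analysis.Analysis"
begin

section \<open>Smooth functions and the first order operator\<close>

primrec C_k :: "nat \<Rightarrow> ('a::real_normed_vector \<Rightarrow> 'b::real_normed_vector) \<Rightarrow> bool" where
  "C_k 0 f \<longleftrightarrow> continuous_on UNIV f"
| "C_k (Suc k) f \<longleftrightarrow>
     f differentiable_on UNIV \<and> (\<forall>v. C_k k (\<lambda>x. frechet_derivative f (at x) v))"

definition smooth :: "('a::real_normed_vector \<Rightarrow> 'b::real_normed_vector) \<Rightarrow> bool" where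
  "smooth f \<longleftrightarrow> (\<forall>k. C_k k f)"

definition partial_deriv ::
    "'n::finite \<Rightarrow> (real^'n \<Rightarrow> 'b::real_normed_vector) \<Rightarrow> real^'n \<Rightarrow> 'b" where
  "partial_deriv i f x = frechet_derivative f (at x) (axis i 1)"

text \<open>The operator is given by its coefficient matrices, indexed by the coordinates of
  \<open>real^'n\<close>.\<close>

definition op_symbol :: "('n::finite \<Rightarrow> real^'d^'m) \<Rightarrow> real^'n \<Rightarrow> real^'d^'m" where
  "op_symbol A w = (\<Sum>i\<in>UNIV. (w $ i) *\<^sub>R A i)"

definition diff_op ::
    "('n::finite \<Rightarrow> real^'d^'m) \<Rightarrow> (real^'n \<Rightarrow> real^'d) \<Rightarrow> real^'n \<Rightarrow> real^'m" where
  "diff_op A w x = (\<Sum>i\<in>UNIV. A i *v partial_deriv i w x)"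

definition test_function :: "(real^'n \<Rightarrow> real) \<Rightarrow> bool" where
  "test_function \<phi> \<longleftrightarrow> smooth \<phi> \<and> compact (closure {x. \<phi> x \<noteq> 0})"

text \<open>\<open>\<A>u = 0\<close> as an \<open>real^'m\<close>-valued distribution; the sign coming from integration by parts
  is irrelevant and omitted. Used only for essentially bounded \<open>u\<close>, so the integrals exist.\<close>

definition distr_A_free :: "('n::finite \<Rightarrow> real^'d^'m) \<Rightarrow> (real^'n \<Rightarrow> real^'d) \<Rightarrow> bool" where
  "distr_A_free A u \<longleftrightarrow>
     (\<forall>\<phi>. test_function \<phi> \<longrightarrow>
        (LINT x|lebesgue. (\<Sum>i\<in>UNIV. partial_deriv i \<phi> x *\<^sub>R (A i *v u x))) = 0)"

section \<open>Quasiconvexity and the convex hull along the characteristic cone\<close>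

definition unit_cube :: "(real^'n) set" where
  "unit_cube = {x. \<forall>i. 0 < x $ i \<and> x $ i < 1}"

definition Q_periodic :: "(real^'n \<Rightarrow> 'b) \<Rightarrow> bool" where
  "Q_periodic w \<longleftrightarrow> (\<forall>x i. w (x + axis i 1) = w x)"

text \<open>The Bochner integral of a non-integrable function is 0, so the inequality has its
  intended meaning when \<open>F\<close> is locally bounded, in particular when \<open>F\<close> is continuous.\<close>

definition A_quasiconvex :: "('n::finite \<Rightarrow> real^'d^'m) \<Rightarrow> (real^'d \<Rightarrow> real) \<Rightarrow> bool" where
  "A_quasiconvex A F \<longleftrightarrow>
     F \<in> borel_measurable borel \<and>
     (\<forall>\<xi> w. smooth w \<longrightarrow> Q_periodic w \<longrightarrow> (\<forall>x. diff_op A w x = 0) \<longrightarrow>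
        set_lebesgue_integral lebesgue unit_cube w = 0 \<longrightarrow>
        F \<xi> \<le> set_lebesgue_integral lebesgue unit_cube (\<lambda>x. F (\<xi> + w x)))"

definition char_cone :: "('n::finite \<Rightarrow> real^'d^'m) \<Rightarrow> (real^'d) set" where
  "char_cone A = {v. \<exists>w. w \<noteq> 0 \<and> op_symbol A w *v v = 0}"

text \<open>The functions take values in \<open>\<real> \<union> {+\<infinity>}\<close>, whence the exclusion of \<open>-\<infinity>\<close>. In \<open>ereal\<close>
  we have \<open>0 * \<infinity> = 0\<close>, so the inequality is trivial for \<open>t = 0\<close> and \<open>t = 1\<close>.\<close>

definition cone_convex :: "(real^'d) set \<Rightarrow> (real^'d \<Rightarrow> ereal) \<Rightarrow> bool" where
  "cone_convex \<Lambda> G \<longleftrightarrow>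
     (\<forall>x. G x \<noteq> -\<infinity>) \<and>
     (\<forall>a b. \<forall>t\<in>{0..1}. b - a \<in> \<Lambda> \<longrightarrow>
        G (t *\<^sub>R a + (1 - t) *\<^sub>R b) \<le> ereal t * G a + ereal (1 - t) * G b)"

definition cone_hull :: "(real^'d) set \<Rightarrow> (real^'d) set \<Rightarrow> (real^'d) set" where
  "cone_hull \<Lambda> E = {\<xi>. \<forall>G. cone_convex \<Lambda> G \<longrightarrow> (\<forall>\<eta>\<in>E. G \<eta> = 0) \<longrightarrow> G \<xi> \<le> 0}"

definition strongly_star_shaped :: "'a::real_normed_vector set \<Rightarrow> 'a \<Rightarrow> bool" where
  "strongly_star_shaped K \<xi>0 \<longleftrightarrow>
     (\<forall>\<xi>\<in>K. \<forall>t\<in>{0<..1}. t *\<^sub>R \<xi>0 + (1 - t) *\<^sub>R \<xi> \<in> interior K)"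

section \<open>Essentially bounded functions and the weak* topology\<close>

text \<open>Elements of \<open>L\<^sup>\<infinity>\<close> are represented by functions, not by classes modulo equality almost
  everywhere. Accordingly the weak* topology below, the initial topology for the pairings with
  integrable functions, does not separate functions that agree almost everywhere.\<close>

definition L_infty :: "('a::euclidean_space \<Rightarrow> 'b::euclidean_space) set" where
  "L_infty = {u \<in> borel_measurable lebesgue. \<exists>C. AE x in lebesgue. norm (u x) \<le> C}"

definition weak_star :: "('a::euclidean_space \<Rightarrow> 'b::euclidean_space) topology" where
  "weak_star = topology_generated_by
     {{u \<in> L_infty. (LINT x|lebesgue. u x \<bullet> g x) \<in> T} | g T. integrable lebesgue g \<and> open T}"

lemma topspace_weak_star:
  "topspace (weak_star :: ('a::euclidean_space \<Rightarrow> 'b::euclidean_space) topology) = L_infty"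
proof -
  let ?B = "{{u \<in> L_infty. (LINT x|lebesgue. u x \<bullet> g x) \<in> T} | (g :: 'a \<Rightarrow> 'b) T.
      integrable lebesgue g \<and> open T}"
  have "L_infty = {u \<in> L_infty. (LINT x|lebesgue. u x \<bullet> (0::'b)) \<in> (UNIV::real set)}"
    by simp
  moreover have "integrable lebesgue (\<lambda>x::'a. 0::'b)" "open (UNIV::real set)"
    by simp_all
  ultimately have "L_infty \<in> ?B"
    by blast
  moreover have "\<Union>?B \<subseteq> L_infty"
    by blast
  ultimately have "\<Union>?B = L_infty"
    by blast
  then show ?thesis
    unfolding weak_star_def topology_generated_by_topspace .
qed

definition L_piec :: "('a::euclidean_space \<Rightarrow> 'b::euclidean_space) set" where
  "L_piec = {u. bounded (range u) \<and>
     (\<exists>\<U>. countable \<U> \<and> disjoint \<U> \<and> (\<forall>U\<in>\<U>. open U \<and> u constant_on U) \<and>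
          negligible (UNIV - \<Union>\<U>))}"

definition V_set ::
    "('n::finite \<Rightarrow> real^'d^'m) \<Rightarrow> (real^'n) set \<Rightarrow> (real^'d) set \<Rightarrow> (real^'n \<Rightarrow> real^'d) set" where
  "V_set A \<Omega> E = {u \<in> L_piec. distr_A_free A u \<and>
     (AE x in lebesgue. x \<notin> \<Omega> \<longrightarrow> u x = 0) \<and>
     (AE x in lebesgue. x \<in> \<Omega> \<longrightarrow> u x \<in> E \<union> interior (cone_hull (char_cone A) E))}"

definition solutions ::
    "('n::finite \<Rightarrow> real^'d^'m) \<Rightarrow> (real^'n) set \<Rightarrow> nat \<Rightarrow> (nat \<Rightarrow> real^'d \<Rightarrow> real)
       \<Rightarrow> (real^'n \<Rightarrow> real^'d) set" where
  "solutions A \<Omega> I F = {u \<in> L_infty. distr_A_free A u \<and>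
     (AE x in lebesgue. x \<in> \<Omega> \<longrightarrow> (\<forall>i\<in>{1..I}. F i (u x) = 0)) \<and>
     (AE x in lebesgue. x \<notin> \<Omega> \<longrightarrow> u x = 0)}"

end

theory Submission
  imports Defs
begin

text \<open>The proof is convex integration. By the rank condition, for every \<open>v\<close> in the characteristic cone
  the operator admits compactly supported, piecewise constant \<open>\<A>\<close>-free perturbations that take
  values near a segment in direction \<open>v\<close>: differential potentials are obtained by elimination, and applied to box
  splines that are stretched along the frequency hyperplane they have locally constant densities.
  Rescaled Vitali copies of such a cell can be inserted in the pieces of a field without leaving
  the class \<open>V\<close> and with an arbitrarily small change in the weak* topology. The infimum of the mean
  of \<open>dist(\<cdot>, E)\<close> over all cells with a given value is upper semicontinuous and convex along
  the cone, so it vanishes on the hull. Hence every field in \<open>V\<close> can be modified, weakly little, to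
  have small distance to \<open>E\<close>. Choosing each modification nearly orthogonal to the earlier fields
  makes the sequence converge in \<open>L\<^sup>1\<close>, and the limit has its values in the closed set \<open>E\<close>.\<close>

definition dird :: "'a::euclidean_space \<Rightarrow> ('a \<Rightarrow> real) \<Rightarrow> 'a \<Rightarrow> real" where
  "dird v f x = frechet_derivative f (at x) v"

lemma smooth_differentiable: "smooth f \<Longrightarrow> f differentiable (at x)"
proof -
  assume "smooth f"
  then have "C_k (Suc 0) f" unfolding smooth_def by blast
  then show ?thesis by (simp add: differentiable_on_def)
qed

lemma smooth_has_derivative:
  fixes f :: "'a::euclidean_space \<Rightarrow> real"
  shows "smooth f \<Longrightarrow> (f has_derivative (\<lambda>v. dird v f x)) (at x)"
  unfolding dird_def using smooth_differentiable frechet_derivative_works by auto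

lemma smooth_dird: "smooth f \<Longrightarrow> smooth (dird v f)"
proof -
  assume "smooth f"
  then have "C_k (Suc k) f" for k by (simp add: smooth_def)
  then show ?thesis by (auto simp: smooth_def dird_def[abs_def])
qed

lemma smooth_continuous_on: "smooth f \<Longrightarrow> continuous_on S f"
  unfolding smooth_def by (metis C_k.simps(1) continuous_on_subset subset_UNIV)

lemma smooth_coinduct:
  fixes f :: "'a::euclidean_space \<Rightarrow> real"
  assumes "f \<in> \<C>"
    and "\<And>f. f \<in> \<C> \<Longrightarrow> \<exists>f'. (\<forall>x. (f has_derivative (\<lambda>v. f' v x)) (at x)) \<and> (\<forall>v. f' v \<in> \<C>)"
  shows "smooth f"
proof -
  have "C_k k f" if "f \<in> \<C>" for k f
    using that
  proof (induction k arbitrary: f)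
    case 0
    then obtain f' where "\<And>x. (f has_derivative (\<lambda>v. f' v x)) (at x)"
      using assms(2) by blast
    then show ?case
      by (auto intro!: continuous_at_imp_continuous_on has_derivative_continuous)
  next
    case (Suc k)
    then obtain f' where f': "\<And>x. (f has_derivative (\<lambda>v. f' v x)) (at x)" "\<And>v. f' v \<in> \<C>"
      using assms(2) by blast
    have "frechet_derivative f (at x) = (\<lambda>v. f' v x)" for x
      using frechet_derivative_at[OF f'(1)] by simp
    moreover have "f differentiable_on UNIV"
      using f'(1) by (auto simp: differentiable_on_def differentiable_def)
    ultimately show ?case
      using Suc.IH f'(2) by simp
  qed
  with assms(1) show ?thesis by (simp add: smooth_def)
qed

lemma dird_eq: "(f has_derivative (\<lambda>v. f' v)) (at x) \<Longrightarrow> dird v f x = f' v"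
  unfolding dird_def by (metis frechet_derivative_at)

lemma linear_dird: "smooth f \<Longrightarrow> linear (\<lambda>v. dird v f x)"
  using smooth_has_derivative has_derivative_linear by blast

lemma dird_lincomb_dir:
  "smooth f \<Longrightarrow> dird (\<Sum>i\<in>I. c i *\<^sub>R z i) f = (\<lambda>x. \<Sum>i\<in>I. c i * dird (z i) f x)"
  using linear_sum[OF linear_dird, of f "\<lambda>i. c i *\<^sub>R z i" I]
    linear_scale[OF linear_dird, of f] by (auto simp: fun_eq_iff)

lemma dird_add_dir: "smooth f \<Longrightarrow> dird (u + v) f = (\<lambda>x. dird u f x + dird v f x)"
  using linear_add[OF linear_dird, of f] by (auto simp: fun_eq_iff)

lemma dird_scale_dir: "smooth f \<Longrightarrow> dird (c *\<^sub>R v) f = (\<lambda>x. c * dird v f x)"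
  using linear_scale[OF linear_dird, of f] by (auto simp: fun_eq_iff)

lemma dird_add:
  assumes "smooth f" "smooth g"
  shows "dird v (\<lambda>x. f x + g x) = (\<lambda>x. dird v f x + dird v g x)"
  using assms by (intro ext dird_eq) (auto intro!: derivative_eq_intros smooth_has_derivative)

lemma dird_cmult:
  assumes "smooth f"
  shows "dird v (\<lambda>x. c * f x) = (\<lambda>x. c * dird v f x)"
  using assms by (intro ext dird_eq) (auto intro!: derivative_eq_intros smooth_has_derivative)

lemma smooth_add:
  fixes f g :: "'a::euclidean_space \<Rightarrow> real"
  assumes "smooth f" "smooth g" shows "smooth (\<lambda>x. f x + g x :: real)"
proof (rule smooth_coinduct)
  show "(\<lambda>x. f x + g x) \<in> {\<lambda>x. f x + g x |f g. smooth f \<and> smooth g}"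
    using assms by blast
  fix h :: "'a \<Rightarrow> real"
  assume "h \<in> {\<lambda>x. f x + g x |f g. smooth f \<and> smooth g}"
  then obtain f g where *: "h = (\<lambda>x. f x + g x)" "smooth f" "smooth g" by blast
  show "\<exists>f'. (\<forall>x. (h has_derivative (\<lambda>v. f' v x)) (at x)) \<and> (\<forall>v. f' v \<in> {\<lambda>x. f x + g x |f g. smooth f \<and> smooth g})"
    by (rule exI[of _ "\<lambda>v x. dird v f x + dird v g x"])
      (use * in \<open>auto intro!: derivative_eq_intros smooth_has_derivative smooth_dird\<close>)
qed

lemma smooth_const: "smooth (\<lambda>x::'a::euclidean_space. c :: real)"
proof (rule smooth_coinduct)
  show "(\<lambda>x. c) \<in> {\<lambda>x. c |c. True}"
    by blast
  fix h :: "'a \<Rightarrow> real"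
  assume "h \<in> {\<lambda>x. c |c. True}"
  then obtain c where *: "h = (\<lambda>x. c)" by blast
  show "\<exists>f'. (\<forall>x. (h has_derivative (\<lambda>v. f' v x)) (at x)) \<and> (\<forall>v. f' v \<in> {\<lambda>x. c |c. True})"
    by (rule exI[of _ "\<lambda>v x. 0"]) (use * in auto)
qed

lemma dird_const: "dird v (\<lambda>x. c) = (\<lambda>x. 0)"
  by (intro ext dird_eq) auto

lemma smooth_cmult:
  fixes f :: "'a::euclidean_space \<Rightarrow> real"
  assumes "smooth f" shows "smooth (\<lambda>x. c * f x :: real)"
proof (rule smooth_coinduct)
  show "(\<lambda>x. c * f x) \<in> {\<lambda>x. c * f x |f. smooth f}"
    using assms by blast
  fix h :: "'a \<Rightarrow> real"
  assume "h \<in> {\<lambda>x. c * f x |f. smooth f}"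
  then obtain f where *: "h = (\<lambda>x. c * f x)" "smooth f" by blast
  show "\<exists>f'. (\<forall>x. (h has_derivative (\<lambda>v. f' v x)) (at x)) \<and> (\<forall>v. f' v \<in> {\<lambda>x. c * f x |f. smooth f})"
    by (rule exI[of _ "\<lambda>v x. c * dird v f x"])
      (use * in \<open>auto intro!: derivative_eq_intros smooth_has_derivative smooth_dird\<close>)
qed

lemma smooth_diff:
  fixes f g :: "'a::euclidean_space \<Rightarrow> real"
  assumes "smooth f" "smooth g" shows "smooth (\<lambda>x. f x - g x :: real)"
  using smooth_add[OF assms(1) smooth_cmult[OF assms(2), of "-1"]] by simp

lemma dird_diff:
  assumes "smooth f" "smooth g"
  shows "dird v (\<lambda>x. f x - g x) = (\<lambda>x. dird v f x - dird v g x)"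
  using assms by (intro ext dird_eq) (auto intro!: derivative_eq_intros smooth_has_derivative)

lemma smooth_sum:
  fixes f :: "'i \<Rightarrow> 'a::euclidean_space \<Rightarrow> real"
  assumes "\<And>i. i \<in> I \<Longrightarrow> smooth (f i)" shows "smooth (\<lambda>x. \<Sum>i\<in>I. f i x :: real)"
  using assms
proof (induction I rule: infinite_finite_induct)
  case (insert i I)
  then show ?case using smooth_add[of "f i" "\<lambda>x. \<Sum>i\<in>I. f i x"] by simp
qed (auto intro: smooth_const)

lemma dird_sum:
  assumes "\<And>i. i \<in> I \<Longrightarrow> smooth (f i)"
  shows "dird v (\<lambda>x. \<Sum>i\<in>I. f i x) = (\<lambda>x. \<Sum>i\<in>I. dird v (f i) x)"
  using assms by (intro ext dird_eq) (auto intro!: derivative_eq_intros smooth_has_derivative)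

lemma has_derivative_affine:
  fixes T :: "'a::euclidean_space \<Rightarrow> 'b::euclidean_space"
  assumes "smooth f" "linear T"
  shows "((\<lambda>x. f (T x + a)) has_derivative (\<lambda>v. dird (T v) f (T x + a))) (at x)"
proof -
  have "((\<lambda>x. T x + a) has_derivative T) (at x)"
    using linear_imp_has_derivative[OF assms(2)] by (auto intro!: derivative_eq_intros)
  then show ?thesis
    by (rule has_derivative_compose) (rule smooth_has_derivative[OF assms(1)])
qed

lemma dird_affine:
  fixes T :: "'a::euclidean_space \<Rightarrow> 'b::euclidean_space"
  assumes "smooth f" "linear T"
  shows "dird v (\<lambda>x. f (T x + a)) = (\<lambda>x. dird (T v) f (T x + a))"
  by (intro ext dird_eq has_derivative_affine assms)

lemma smooth_affine:
  fixes T :: "'a::euclidean_space \<Rightarrow> 'b::euclidean_space"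
  assumes "smooth f" "linear T" shows "smooth (\<lambda>x. f (T x + a) :: real)"
proof (rule smooth_coinduct)
  show "(\<lambda>x. f (T x + a)) \<in> {\<lambda>x. f (T x + a) |f. smooth f}"
    using assms by blast
  fix h :: "'a \<Rightarrow> real"
  assume "h \<in> {\<lambda>x. f (T x + a) |f. smooth f}"
  then obtain f where *: "h = (\<lambda>x. f (T x + a))" "smooth f" by blast
  show "\<exists>f'. (\<forall>x. (h has_derivative (\<lambda>v. f' v x)) (at x)) \<and> (\<forall>v. f' v \<in> {\<lambda>x. f (T x + a) |f. smooth f})"
    by (rule exI[of _ "\<lambda>v x. dird (T v) f (T x + a)"])
      (use * has_derivative_affine[OF _ assms(2)] in \<open>auto intro!: smooth_dird\<close>)
qed

lemma smooth_translate:
  fixes f :: "'a::euclidean_space \<Rightarrow> real"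
  shows "smooth f \<Longrightarrow> smooth (\<lambda>x. f (x + a))"
  using smooth_affine[of f "\<lambda>x. x" a] by (simp add: linear_iff)

lemma dird_translate: "smooth f \<Longrightarrow> dird v (\<lambda>x. f (x + a)) = (\<lambda>x. dird v f (x + a))"
  using dird_affine[of f "\<lambda>x. x" v a] by (simp add: linear_iff)

lemma dird_exp: "dird v (\<lambda>x. exp (w \<bullet> x)) = (\<lambda>x. (w \<bullet> v) * exp (w \<bullet> x))"
  by (intro ext dird_eq) (auto intro!: derivative_eq_intros)

lemma smooth_exp: "smooth (\<lambda>x::'a::euclidean_space. exp (w \<bullet> x))"
proof (rule smooth_coinduct)
  show "(\<lambda>x. exp (w \<bullet> x)) \<in> {\<lambda>x. c * exp (w \<bullet> x) |c. True}"
    by (intro CollectI exI[of _ 1]) auto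
  fix h :: "'a \<Rightarrow> real" assume "h \<in> {\<lambda>x. c * exp (w \<bullet> x) |c. True}"
  then obtain c where *: "h = (\<lambda>x. c * exp (w \<bullet> x))" by blast
  show "\<exists>f'. (\<forall>x. (h has_derivative (\<lambda>v. f' v x)) (at x)) \<and> (\<forall>v. f' v \<in> {\<lambda>x. c * exp (w \<bullet> x) |c. True})"
    by (rule exI[of _ "\<lambda>v x. (c * (w \<bullet> v)) * exp (w \<bullet> x)"])
      (use * in \<open>auto intro!: derivative_eq_intros\<close>)
qed

lemma smooth_continuous_on_compose:
  fixes f :: "'a::euclidean_space \<Rightarrow> real"
  assumes "smooth f" "continuous_on S g" shows "continuous_on S (\<lambda>x. f (g x))"
  by (rule continuous_on_compose2[OF smooth_continuous_on[OF assms(1), of UNIV] assms(2)]) simp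

subsection \<open>Averages along segments\<close>

definition seg_avg :: "'a::euclidean_space \<Rightarrow> ('a \<Rightarrow> real) \<Rightarrow> 'a \<Rightarrow> real" where
  "seg_avg z f x = integral {0..1} (\<lambda>s. f (x + s *\<^sub>R z))"

lemma seg_avg_has_derivative:
  fixes f :: "'a::euclidean_space \<Rightarrow> real"
  assumes f: "smooth f"
  shows "(seg_avg z f has_derivative (\<lambda>v. seg_avg z (dird v f) x)) (at x)"
proof -
  define g where "g x t = Blinfun (\<lambda>v. dird v f (x + t *\<^sub>R z))" for x t
  have ap: "blinfun_apply (g x t) v = dird v f (x + t *\<^sub>R z)" for x t v
    unfolding g_def using linear_dird[OF f]
    by (subst bounded_linear_Blinfun_apply) (auto simp: linear_conv_bounded_linear)
  have cg: "continuous_on (UNIV \<times> cbox 0 1) (\<lambda>(x, t). g x t)"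
    unfolding case_prod_beta
    by (rule continuous_on_blinfun_componentwise)
      (unfold ap, rule smooth_continuous_on_compose[OF smooth_dird[OF f]], intro continuous_intros)
  have cg': "continuous_on (cbox 0 1) (g x)"
    by (rule continuous_on_blinfun_componentwise)
      (unfold ap, rule smooth_continuous_on_compose[OF smooth_dird[OF f]], intro continuous_intros)
  have "((\<lambda>x. integral (cbox 0 1) (\<lambda>t. f (x + t *\<^sub>R z))) has_derivative
      blinfun_apply (integral (cbox 0 1) (g x))) (at x within UNIV)"
  proof (rule leibniz_rule[OF _ _ cg])
    fix x t
    have "((\<lambda>x. f (x + t *\<^sub>R z)) has_derivative blinfun_apply (g x t)) (at x)"
      unfolding ap using has_derivative_affine[OF f, of "\<lambda>x. x" "t *\<^sub>R z"]
      by (simp add: linear_iff)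
    then show "((\<lambda>x. f (x + t *\<^sub>R z)) has_derivative blinfun_apply (g x t)) (at x within UNIV)" by simp
    show "(\<lambda>t. f (x + t *\<^sub>R z)) integrable_on cbox 0 1"
      by (rule integrable_continuous, rule smooth_continuous_on_compose[OF f]) (intro continuous_intros)
  qed auto
  moreover
  have "blinfun_apply (integral (cbox 0 1) (g x)) v = seg_avg z (dird v f) x" for v
    unfolding seg_avg_def
    using blinfun_apply_integral[OF integrable_continuous[OF cg'], of v] by (simp add: ap)
  then have "blinfun_apply (integral (cbox 0 1) (g x)) = (\<lambda>v. seg_avg z (dird v f) x)"
    by blast
  ultimately show ?thesis by (simp add: seg_avg_def[abs_def])
qed

lemma smooth_seg_avg:
  assumes "smooth f" shows "smooth (seg_avg z f)"
proof (rule smooth_coinduct)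
  show "seg_avg z f \<in> {seg_avg z f |f. smooth f}" using assms by blast
  fix h assume "h \<in> {seg_avg z f |f. smooth f}"
  then obtain f where *: "h = seg_avg z f" "smooth f" by blast
  show "\<exists>f'. (\<forall>x. (h has_derivative (\<lambda>v. f' v x)) (at x)) \<and> (\<forall>v. f' v \<in> {seg_avg z f |f. smooth f})"
    by (rule exI[of _ "\<lambda>v x. seg_avg z (dird v f) x"])
      (use * in \<open>auto intro!: seg_avg_has_derivative smooth_dird\<close>)
qed

lemma dird_seg_avg: "smooth f \<Longrightarrow> dird v (seg_avg z f) = seg_avg z (dird v f)"
  by (intro ext dird_eq seg_avg_has_derivative)

lemma seg_avg_integrable:
  fixes f :: "'a::euclidean_space \<Rightarrow> real"
  assumes "smooth f" shows "(\<lambda>s. f (x + s *\<^sub>R z)) integrable_on {0..1::real}"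
  by (rule integrable_continuous_real, rule smooth_continuous_on_compose[OF assms]) (intro continuous_intros)

lemma seg_avg_dird:
  assumes "smooth f"
  shows "seg_avg z (dird z f) = (\<lambda>x. f (x + z) - f x)"
proof
  fix x
  have "((\<lambda>s. dird z f (x + s *\<^sub>R z)) has_integral f (x + 1 *\<^sub>R z) - f (x + 0 *\<^sub>R z)) {0..1}"
  proof (rule fundamental_theorem_of_calculus)
    fix s :: real
    have "((\<lambda>s. x + s *\<^sub>R z) has_derivative (\<lambda>h. h *\<^sub>R z)) (at s within {0..1})"
      by (auto intro!: derivative_eq_intros)
    from has_derivative_compose[OF this smooth_has_derivative[OF assms]]
    show "((\<lambda>s. f (x + s *\<^sub>R z)) has_vector_derivative dird z f (x + s *\<^sub>R z)) (at s within {0..1})"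
      using linear_scale[OF linear_dird[OF assms]] by (simp add: has_vector_derivative_def)
  qed simp
  then show "seg_avg z (dird z f) x = f (x + z) - f x"
    unfolding seg_avg_def by (auto dest: integral_unique)
qed

lemma seg_avg_add:
  assumes "smooth f" "smooth g"
  shows "seg_avg z (\<lambda>x. f x + g x) = (\<lambda>x. seg_avg z f x + seg_avg z g x)"
  unfolding seg_avg_def using seg_avg_integrable assms by (intro ext integral_add) auto

lemma seg_avg_cmult:
  assumes "smooth f"
  shows "seg_avg z (\<lambda>x. c * f x) = (\<lambda>x. c * seg_avg z f x)"
  unfolding seg_avg_def by (intro ext) simp

lemma seg_avg_diff:
  assumes "smooth f" "smooth g"
  shows "seg_avg z (\<lambda>x. f x - g x) = (\<lambda>x. seg_avg z f x - seg_avg z g x)"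
  unfolding seg_avg_def using seg_avg_integrable assms by (intro ext integral_diff) auto

lemma seg_avg_translate: "seg_avg z (\<lambda>x. f (x + a)) = (\<lambda>x. seg_avg z f (x + a))"
  unfolding seg_avg_def by (simp add: algebra_simps)

lemma seg_avg_pos:
  fixes f :: "'a::euclidean_space \<Rightarrow> real"
  assumes "smooth f" "\<And>x. f x > 0" shows "seg_avg z f x > 0"
proof -
  have "(\<integral>s. 0 \<partial>lborel) < seg_avg z f x"
  proof -
    obtain m where m: "m \<in> {0..1}" "\<And>s. s \<in> {0..1} \<Longrightarrow> f (x + m *\<^sub>R z) \<le> f (x + s *\<^sub>R z)"
    proof -
      have "continuous_on {0..1} (\<lambda>s. f (x + s *\<^sub>R z))"
        by (rule smooth_continuous_on_compose[OF assms(1)]) (intro continuous_intros)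
      from continuous_attains_inf[OF _ _ this] show ?thesis using that by auto
    qed
    have "integral {0..1} (\<lambda>s::real. f (x + m *\<^sub>R z)) \<le> seg_avg z f x"
      unfolding seg_avg_def using seg_avg_integrable[OF assms(1), of x z] m(2)
      by (intro integral_le) auto
    then show ?thesis using assms(2)[of "x + m *\<^sub>R z"] by simp
  qed
  then show ?thesis by simp
qed

text \<open>Commuting with \<open>seg_avg\<close> forces the mixed derivatives to have equal means over all short
  segments, so equality of mixed partial derivatives follows from continuity.\<close>

lemma dird_commute:
  assumes f: "smooth f"
  shows "dird u (dird v f) = dird v (dird u f)"
proof
  fix x
  define c where "c = (\<lambda>x. dird u (dird v f) x - dird v (dird u f) x)"
  have c: "smooth c" unfolding c_def using f by (intro smooth_diff smooth_dird)
  have avg0: "seg_avg (r *\<^sub>R v) c = (\<lambda>x. 0)" if "r \<noteq> 0" for r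
  proof -
    let ?z = "r *\<^sub>R v"
    have "seg_avg ?z (dird u (dird ?z f)) = dird u (seg_avg ?z (dird ?z f))"
      using f by (simp only: dird_seg_avg smooth_dird)
    also have "\<dots> = (\<lambda>x. dird u f (x + ?z) - dird u f x)"
      using f by (simp only: seg_avg_dird dird_diff smooth_translate dird_translate)
    also have "\<dots> = seg_avg ?z (dird ?z (dird u f))"
      using f by (simp only: seg_avg_dird smooth_dird)
    finally have "seg_avg ?z (\<lambda>x. dird u (dird ?z f) x - dird ?z (dird u f) x) = (\<lambda>x. 0)"
      using f by (simp add: seg_avg_diff smooth_dird)
    also have "(\<lambda>x. dird u (dird ?z f) x - dird ?z (dird u f) x) = (\<lambda>x. r * c x)"
      using f by (simp add: c_def dird_scale_dir smooth_dird dird_cmult right_diff_distrib)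
    finally show ?thesis
      using c that by (simp add: seg_avg_cmult fun_eq_iff)
  qed
  have "c x = 0"
  proof (rule ccontr)
    assume "c x \<noteq> 0"
    define e where "e = \<bar>c x\<bar> / 2"
    have "e > 0" using \<open>c x \<noteq> 0\<close> by (simp add: e_def)
    then obtain d where d: "d > 0" "\<And>y. dist y x < d \<Longrightarrow> dist (c y) (c x) < e"
      using smooth_continuous_on[OF c, of UNIV] unfolding continuous_on_iff by fastforce
    define r where "r = d / (2 * (norm v + 1))"
    have nz: "norm v + 1 \<noteq> 0" using norm_ge_zero[of v] by linarith
    have r: "r > 0" using d by (simp add: r_def add_nonneg_pos)
    have near: "\<bar>c (x + s *\<^sub>R r *\<^sub>R v) - c x\<bar> \<le> e" if "s \<in> {0..1}" for s
    proof -
      have "norm (s *\<^sub>R r *\<^sub>R v) = s * (r * norm v)" using that r by simp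
      also have "\<dots> \<le> r * norm v" using that r by (simp add: mult_left_le_one_le)
      also have "\<dots> < r * (2 * (norm v + 1))" using r
        by (intro mult_strict_left_mono) (simp_all add: add_nonneg_pos)
      also have "\<dots> = d" using nz by (simp add: r_def)
      finally show ?thesis using d(2)[of "x + s *\<^sub>R r *\<^sub>R v"] by (simp add: dist_norm)
    qed
    have int: "(\<lambda>s. c (x + s *\<^sub>R r *\<^sub>R v)) integrable_on {0..1}"
      by (rule seg_avg_integrable[OF c])
    have "integral {0..1} (\<lambda>s. c (x + s *\<^sub>R r *\<^sub>R v) - c x) = - c x"
      using fun_cong[OF avg0[of r], of x] r int by (subst integral_diff) (auto simp: seg_avg_def)
    moreover have "norm (integral {0..1} (\<lambda>s. c (x + s *\<^sub>R r *\<^sub>R v) - c x)) \<le> integral {0..1} (\<lambda>s::real. e)"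
      using near int by (intro integral_norm_bound_integral integrable_diff) auto
    ultimately show False using \<open>e > 0\<close> by (simp add: e_def)
  qed
  then show "dird u (dird v f) x = dird v (dird u f) x" by (simp add: c_def)
qed

subsection \<open>Spline functionals\<close>

text \<open>\<open>spline L\<close> is the box spline with direction list \<open>L\<close>, regarded as a distribution.\<close>

primrec spline :: "'a::euclidean_space list \<Rightarrow> ('a \<Rightarrow> real) \<Rightarrow> real" where
  "spline [] f = f 0"
| "spline (z # L) f = spline L (seg_avg z f)"

lemma spline_add:
  "smooth f \<Longrightarrow> smooth g \<Longrightarrow> spline L (\<lambda>x. f x + g x) = spline L f + spline L g"
  by (induction L arbitrary: f g) (simp_all add: seg_avg_add smooth_seg_avg)

lemma spline_cmult: "smooth f \<Longrightarrow> spline L (\<lambda>x. c * f x) = c * spline L f"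
  by (induction L arbitrary: f) (simp_all add: seg_avg_cmult smooth_seg_avg)

lemma spline_zero: "spline L (\<lambda>x. 0) = 0"
  using spline_cmult[OF smooth_const[of 0], of L 0] by simp

lemma spline_diff:
  "smooth f \<Longrightarrow> smooth g \<Longrightarrow> spline L (\<lambda>x. f x - g x) = spline L f - spline L g"
  by (induction L arbitrary: f g) (simp_all add: seg_avg_diff smooth_seg_avg)

lemma spline_sum:
  assumes "\<And>i. i \<in> I \<Longrightarrow> smooth (f i)"
  shows "spline L (\<lambda>x. \<Sum>i\<in>I. f i x) = (\<Sum>i\<in>I. spline L (f i))"
  using assms
  by (induction I rule: infinite_finite_induct)
    (simp_all add: spline_zero spline_add smooth_sum)

lemma spline_pos: "smooth f \<Longrightarrow> (\<And>x. f x > 0) \<Longrightarrow> spline L f > 0"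
  by (induction L arbitrary: f) (simp_all add: smooth_seg_avg seg_avg_pos)

lemma spline_dird:
  assumes "smooth f"
  shows "spline (L1 @ z # L2) (dird z f) = spline (L1 @ L2) (\<lambda>x. f (x + z)) - spline (L1 @ L2) f"
  using assms
proof (induction L1 arbitrary: f)
  case Nil
  then show ?case by (simp add: seg_avg_dird spline_diff smooth_translate)
next
  case (Cons y L1)
  then show ?case
    using Cons.IH[OF smooth_seg_avg[OF Cons.prems, of y]]
    by (simp add: dird_seg_avg[symmetric] seg_avg_translate)
qed

lemma spline_linear_image:
  assumes "linear T"
  shows "spline (map T L) f = spline L (\<lambda>x. f (T x))"
proof (induction L arbitrary: f)
  case Nil
  then show ?case using linear_0[OF assms] by simp
next
  case (Cons z L)
  have "(\<lambda>x. seg_avg (T z) f (T x)) = seg_avg z (\<lambda>x. f (T x))"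
    using assms by (simp add: seg_avg_def[abs_def] linear_add linear_scale)
  then show ?case by (simp add: Cons)
qed

lemma seg_avg_eq_lborel:
  assumes "smooth f"
  shows "seg_avg z f x = (\<integral>s. indicator {0..1} s * f (x + s *\<^sub>R z) \<partial>lborel)"
proof -
  have "set_integrable lborel {0..1} (\<lambda>s. f (x + s *\<^sub>R z))"
    by (rule borel_integrable_atLeastAtMost')
      (rule smooth_continuous_on_compose[OF assms], intro continuous_intros)
  from set_borel_integral_eq_integral(2)[OF this] show ?thesis
    by (simp add: seg_avg_def set_lebesgue_integral_def)
qed

lemma spline_subbasis:
  fixes f :: "'a::euclidean_space \<Rightarrow> real"
  assumes "distinct L" "set L \<subseteq> Basis" "smooth f"
  shows "spline L f = (\<integral>y. (\<Prod>b\<in>set L. indicator {0..1} (y b)) * f (\<Sum>b\<in>set L. y b *\<^sub>R b)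
    \<partial>(\<Pi>\<^sub>M b\<in>set L. lborel))"
  using assms
proof (induction L arbitrary: f)
  case Nil
  interpret P: product_sigma_finite "\<lambda>b::'a. lborel :: real measure" by standard
  show ?case by (simp add: PiM_empty)
next
  case (Cons b L)
  interpret P: product_sigma_finite "\<lambda>b::'a. lborel :: real measure" by standard
  define g where "g y = (\<Prod>b\<in>insert b (set L). indicator {0..1} (y b)) * f (\<Sum>b\<in>insert b (set L). y b *\<^sub>R b)"
    for y :: "'a \<Rightarrow> real"
  let ?M = "\<Pi>\<^sub>M b\<in>insert b (set L). lborel :: real measure"
  have b: "b \<notin> set L" using Cons.prems by simp
  have fm: "f \<in> borel_measurable borel"
    using smooth_continuous_on[OF Cons.prems(3)] by (rule borel_measurable_continuous_onI)
  obtain B where B: "\<And>z. norm z \<le> real (card (insert b (set L))) \<Longrightarrow> \<bar>f z\<bar> \<le> B"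
  proof -
    have "compact (f ` cball 0 (real (card (insert b (set L)))))"
      by (intro compact_continuous_image smooth_continuous_on[OF Cons.prems(3)]) auto
    then obtain B where *: "\<forall>y\<in>f ` cball 0 (real (card (insert b (set L)))). norm y \<le> B"
      using compact_imp_bounded bounded_iff by blast
    show ?thesis by (rule that[of B]) (use * in auto)
  qed
  have int: "integrable ?M g"
  proof (rule integrableI_bounded_set[where A = "\<Pi>\<^sub>E b\<in>insert b (set L). {0..1}" and B = B])
    show "g \<in> borel_measurable ?M"
      unfolding g_def using fm by measurable
    show "(\<Pi>\<^sub>E b\<in>insert b (set L). {0..1}) \<in> sets ?M"
      by (intro sets_PiM_I_finite) auto
    show "emeasure ?M (\<Pi>\<^sub>E b\<in>insert b (set L). {0..1}) < \<infinity>"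
      by (subst P.emeasure_PiM) auto
    show "AE x in ?M. x \<in> (\<Pi>\<^sub>E b\<in>insert b (set L). {0..1}) \<longrightarrow> norm (g x) \<le> B"
    proof (intro AE_I2 impI)
      fix y assume y: "y \<in> (\<Pi>\<^sub>E b\<in>insert b (set L). {0..1::real})"
      have "norm (\<Sum>b\<in>insert b (set L). y b *\<^sub>R b) \<le> (\<Sum>b\<in>insert b (set L). 1)"
        using y Cons.prems(2) by (intro sum_norm_le) (auto simp: PiE_iff)
      then have "\<bar>f (\<Sum>b\<in>insert b (set L). y b *\<^sub>R b)\<bar> \<le> B"
        by (intro B) simp
      moreover have "g y = f (\<Sum>b\<in>insert b (set L). y b *\<^sub>R b)"
      proof -
        have "(\<Prod>b\<in>insert b (set L). indicator {0..1} (y b) :: real) = 1"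
          by (rule prod.neutral) (use y in \<open>auto simp: PiE_iff\<close>)
        then show ?thesis by (simp only: g_def mult_1)
      qed
      ultimately show "norm (g y) \<le> B" by simp
    qed
    show "AE x in ?M. x \<notin> (\<Pi>\<^sub>E b\<in>insert b (set L). {0..1}) \<longrightarrow> g x = 0"
    proof (intro AE_I2 impI)
      fix y assume "y \<in> space ?M" "y \<notin> (\<Pi>\<^sub>E b\<in>insert b (set L). {0..1::real})"
      then obtain c where "c \<in> insert b (set L)" "y c \<notin> {0..1}"
        by (auto simp: space_PiM PiE_iff)
      then have "(\<Prod>b\<in>insert b (set L). indicator {0..1} (y b) :: real) = 0"
        by (intro prod_zero) (auto intro!: bexI[of _ c])
      then show "g y = 0" by (simp add: g_def)
    qed
  qed
  have "spline (b # L) f = (\<integral>y. (\<Prod>b\<in>set L. indicator {0..1} (y b)) *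
      (\<integral>s. indicator {0..1} s * f ((\<Sum>b\<in>set L. y b *\<^sub>R b) + s *\<^sub>R b) \<partial>lborel) \<partial>(\<Pi>\<^sub>M b\<in>set L. lborel))"
    using Cons by (simp add: smooth_seg_avg seg_avg_eq_lborel)
  also have "\<dots> = (\<integral>y. (\<integral>s. g (y(b := s)) \<partial>lborel) \<partial>(\<Pi>\<^sub>M b\<in>set L. lborel))"
  proof (intro Bochner_Integration.integral_cong refl)
    fix y :: "'a \<Rightarrow> real"
    have p: "(\<Prod>c\<in>set L. indicator {0..1} ((y(b := s)) c)) = (\<Prod>b\<in>set L. indicator {0..1} (y b) :: real)" for s
      using b by (intro prod.cong) auto
    have s: "(\<Sum>c\<in>set L. (y(b := s)) c *\<^sub>R c) = (\<Sum>b\<in>set L. y b *\<^sub>R b)" for s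
      using b by (intro sum.cong) auto
    have "g (y(b := s)) = (\<Prod>b\<in>set L. indicator {0..1} (y b)) * (indicator {0..1} s * f ((\<Sum>b\<in>set L. y b *\<^sub>R b) + s *\<^sub>R b))" for s
      using b p[of s] s[of s] by (simp add: g_def add.commute)
    then show "(\<Prod>b\<in>set L. indicator {0..1} (y b)) *
      (\<integral>s. indicator {0..1} s * f ((\<Sum>b\<in>set L. y b *\<^sub>R b) + s *\<^sub>R b) \<partial>lborel) = (\<integral>s. g (y(b := s)) \<partial>lborel)"
      by simp
  qed
  also have "\<dots> = integral\<^sup>L ?M g"
    using P.product_integral_insert[OF _ b int] by simp
  finally show ?case by (simp only: g_def[abs_def] list.set)
qed

lemma spline_basis:
  fixes f :: "'a::euclidean_space \<Rightarrow> real"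
  assumes "distinct L" "set L = Basis" "smooth f"
  shows "spline L f = (\<integral>x. indicator (cbox 0 One) x * f x \<partial>lborel)"
proof -
  have fm: "f \<in> borel_measurable borel"
    using smooth_continuous_on[OF assms(3)] by (rule borel_measurable_continuous_onI)
  have ind: "indicator (cbox 0 One) (\<Sum>b\<in>Basis. y b *\<^sub>R b :: 'a) = (\<Prod>b\<in>Basis. indicator {0..1} (y b) :: real)"
    for y :: "'a \<Rightarrow> real"
  proof (cases "\<forall>b\<in>Basis. y b \<in> {0..1}")
    case True
    then show ?thesis by (auto simp: mem_box inner_sum_left_Basis)
  next
    case False
    then obtain c where "c \<in> Basis" "y c \<notin> {0..1}" by auto
    moreover from this have "(\<Prod>b\<in>Basis. indicator {0..1} (y b) :: real) = 0"
      by (intro prod_zero) (auto intro!: bexI[of _ c])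
    ultimately show ?thesis by (auto simp: mem_box inner_sum_left_Basis indicator_def)
  qed
  have "(\<integral>x. indicator (cbox 0 One) x * f x \<partial>lborel) =
     (\<integral>y. (\<Prod>b\<in>Basis. indicator {0..1} (y b)) * f (\<Sum>b\<in>Basis. y b *\<^sub>R b) \<partial>(\<Pi>\<^sub>M b\<in>Basis. lborel))"
    by (subst lborel_eq, subst integral_distr) (use fm in \<open>measurable, simp_all add: ind\<close>)
  then show ?thesis using spline_subbasis[of L f] assms by simp
qed

subsection \<open>Linear substitution\<close>

text \<open>Smearing with the indicator of the unit ball and applying Tonelli's theorem identifies
  the push-forward of Lebesgue measure under a linear bijection up to a constant.\<close>

lemma nn_integral_linear_substitution:
  fixes T :: "'a::euclidean_space \<Rightarrow> 'a"
  assumes T: "linear T" "bij T"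
  obtains c where "c > 0" "\<And>g. g \<in> borel_measurable borel \<Longrightarrow>
    (\<integral>\<^sup>+x. g (T x) \<partial>lborel) = ennreal c * (\<integral>\<^sup>+x. g x \<partial>lborel)"
proof -
  let ?B = "ball (0::'a) 1"
  define S where "S = inv T"
  have S: "linear S" "\<And>x. T (S x) = x" "\<And>x. S (T x) = x"
    using T unfolding S_def
    by (simp_all add: inj_linear_imp_inv_linear bij_is_inj bij_is_surj surj_f_inv_f)
  have Tm: "T \<in> borel_measurable borel"
    using T(1) by (intro borel_measurable_continuous_onI linear_continuous_on) (simp add: linear_conv_bounded_linear)
  define \<iota> where "\<iota> = (indicator ?B :: 'a \<Rightarrow> ennreal)"
  have im[measurable]: "\<iota> \<in> borel_measurable borel"
    unfolding \<iota>_def by (intro borel_measurable_indicator borel_open open_ball)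
  have ib: "(\<integral>\<^sup>+x. \<iota> x \<partial>lborel) = emeasure lborel ?B"
    unfolding \<iota>_def by (intro nn_integral_indicator) (simp add: borel_open)
  define \<kappa> where "\<kappa> = (\<integral>\<^sup>+x. \<iota> (T x) \<partial>(lborel::'a measure))"
  have shift: "(\<integral>\<^sup>+x. h (x + a) \<partial>lborel) = (\<integral>\<^sup>+x. h x \<partial>lborel)" if "h \<in> borel_measurable borel" for h and a :: 'a
  proof -
    have "(\<integral>\<^sup>+x. h x \<partial>lborel) = (\<integral>\<^sup>+x. h x \<partial>(distr lborel borel ((+) a)))"
      by (simp add: lborel_distr_plus)
    also have "\<dots> = (\<integral>\<^sup>+x. h (a + x) \<partial>lborel)"
      using that by (subst nn_integral_distr) auto
    finally show ?thesis by (simp add: add.commute)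
  qed
  have main: "emeasure lborel ?B * (\<integral>\<^sup>+x. g (T x) \<partial>lborel) = \<kappa> * (\<integral>\<^sup>+x. g x \<partial>lborel)"
    if g: "g \<in> borel_measurable borel" for g :: "'a \<Rightarrow> ennreal"
  proof -
    note [measurable] = g Tm
    have [measurable]: "(\<lambda>x. g (T x + z)) \<in> borel_measurable borel" for z
      by (rule measurable_compose[OF _ g]) measurable
    have [measurable]: "(\<lambda>p. g (T (fst p) + snd p)) \<in> borel_measurable (lborel \<Otimes>\<^sub>M lborel)"
      by (rule measurable_compose[OF _ g]) measurable
    have [measurable]: "(\<lambda>p. \<iota> (snd p - T (fst p))) \<in> borel_measurable (lborel \<Otimes>\<^sub>M lborel)"
      by (rule measurable_compose[OF _ im]) measurable
    have sh: "(\<integral>\<^sup>+x. g (T x + z) \<partial>lborel) = (\<integral>\<^sup>+x. g (T x) \<partial>lborel)" for z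
      using shift[of "\<lambda>x. g (T x)" "S z"] g Tm S(2) linear_add[OF T(1)] by simp
    have "emeasure lborel ?B * (\<integral>\<^sup>+x. g (T x) \<partial>lborel) = (\<integral>\<^sup>+z. \<iota> z * (\<integral>\<^sup>+x. g (T x) \<partial>lborel) \<partial>lborel)"
      by (subst nn_integral_multc) (simp_all add: ib)
    also have "\<dots> = (\<integral>\<^sup>+z. \<iota> z * (\<integral>\<^sup>+x. g (T x + z) \<partial>lborel) \<partial>lborel)"
      using sh by simp
    also have "\<dots> = (\<integral>\<^sup>+z. (\<integral>\<^sup>+x. \<iota> z * g (T x + z) \<partial>lborel) \<partial>lborel)"
      by (intro nn_integral_cong nn_integral_cmult[symmetric]) simp
    also have "\<dots> = (\<integral>\<^sup>+x. (\<integral>\<^sup>+z. \<iota> z * g (T x + z) \<partial>lborel) \<partial>lborel)"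
      by (intro lborel_pair.Fubini') measurable
    also have "\<dots> = (\<integral>\<^sup>+x. (\<integral>\<^sup>+z. \<iota> (z - T x) * g z \<partial>lborel) \<partial>lborel)"
    proof (rule nn_integral_cong)
      fix x
      show "(\<integral>\<^sup>+z. \<iota> z * g (T x + z) \<partial>lborel) = (\<integral>\<^sup>+z. \<iota> (z - T x) * g z \<partial>lborel)"
        using shift[of "\<lambda>z. \<iota> (z - T x) * g z" "T x"] g by (simp add: add.commute)
    qed
    also have "\<dots> = (\<integral>\<^sup>+z. (\<integral>\<^sup>+x. \<iota> (z - T x) * g z \<partial>lborel) \<partial>lborel)"
      by (intro lborel_pair.Fubini') measurable
    also have "\<dots> = (\<integral>\<^sup>+z. \<kappa> * g z \<partial>lborel)"
    proof (rule nn_integral_cong)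
      fix z
      have zm: "(\<lambda>x. \<iota> (z - T x)) \<in> borel_measurable borel" by measurable
      have "(\<integral>\<^sup>+x. \<iota> (z - T x) \<partial>lborel) = (\<integral>\<^sup>+x. \<iota> (T (x + (- S z))) \<partial>lborel)"
      proof -
        have "\<iota> (z - T x) = \<iota> (T (x + (- S z)))" for x
          using S(2)[of z] linear_diff[OF T(1), of x "S z"]
          by (simp add: \<iota>_def indicator_def norm_minus_commute)
        then show ?thesis by simp
      qed
      also have "\<dots> = \<kappa>"
        unfolding \<kappa>_def using Tm by (intro shift[of "\<lambda>x. \<iota> (T x)"]) measurable
      finally show "(\<integral>\<^sup>+x. \<iota> (z - T x) * g z \<partial>lborel) = \<kappa> * g z"
        by (simp add: nn_integral_multc zm)
    qed
    also have "\<dots> = \<kappa> * (\<integral>\<^sup>+x. g x \<partial>lborel)"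
      using g by (intro nn_integral_cmult) auto
    finally show ?thesis .
  qed
  define m where "m = measure lborel ?B"
  have m: "m > 0" "emeasure lborel ?B = ennreal m"
    unfolding m_def using content_ball_pos[of 1 "0::'a"] emeasure_bounded_finite[of ?B]
    by (auto simp: emeasure_eq_ennreal_measure less_top)
  have k0: "\<kappa> = emeasure lborel (T -` ?B)"
  proof -
    have "\<iota> (T x) = (indicator (T -` ?B) x :: ennreal)" for x by (simp add: \<iota>_def indicator_def)
    then show ?thesis using Tm unfolding \<kappa>_def by (simp add: measurable_sets_borel)
  qed
  have img: "T -` ?B = S ` ?B"
  proof (intro set_eqI iffI)
    fix x assume "x \<in> T -` ?B"
    then show "x \<in> S ` ?B" by (intro image_eqI[of _ _ "T x"]) (simp_all add: S(3))
  next
    fix x assume "x \<in> S ` ?B"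
    then show "x \<in> T -` ?B" by (auto simp: S(2))
  qed
  have op: "open (T -` ?B)"
    using T(1) by (intro open_vimage linear_continuous_on) (simp_all add: linear_conv_bounded_linear)
  have "bounded (T -` ?B)"
    unfolding img using S(1) by (intro bounded_linear_image) (simp_all add: linear_conv_bounded_linear)
  then have kfin: "\<kappa> < \<infinity>" unfolding k0 by (rule emeasure_bounded_finite)
  have "0 \<in> T -` ?B" using linear_0[OF T(1)] by simp
  then obtain r where r: "r > 0" "ball 0 r \<subseteq> T -` ?B"
    using op open_contains_ball by blast
  have "emeasure lborel (ball (0::'a) r) \<noteq> 0"
    using content_ball_pos[OF r(1), of "0::'a"] by (auto simp: measure_def)
  then have "\<kappa> \<noteq> 0"
    using emeasure_mono[OF r(2), of lborel] op by (auto simp: k0)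
  then obtain k where k: "k > 0" "\<kappa> = ennreal k"
    using kfin by (metis ennreal_0 ennreal_enn2real enn2real_positive_iff less_top not_gr_zero infinity_ennreal_def)
  show ?thesis
  proof (rule that[of "k / m"])
    show "k / m > 0" using k m by simp
    fix g :: "'a \<Rightarrow> ennreal" assume "g \<in> borel_measurable borel"
    from main[OF this] have "ennreal m * (\<integral>\<^sup>+x. g (T x) \<partial>lborel) = ennreal k * (\<integral>\<^sup>+x. g x \<partial>lborel)"
      by (simp add: m k)
    then have "ennreal (1 / m) * (ennreal m * (\<integral>\<^sup>+x. g (T x) \<partial>lborel)) = ennreal (1 / m) * (ennreal k * (\<integral>\<^sup>+x. g x \<partial>lborel))"
      by simp
    then show "(\<integral>\<^sup>+x. g (T x) \<partial>lborel) = ennreal (k / m) * (\<integral>\<^sup>+x. g x \<partial>lborel)"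
      using m k by (simp add: mult.assoc[symmetric] ennreal_mult[symmetric])
  qed
qed

lemma lborel_linear_substitution:
  fixes T :: "'a::euclidean_space \<Rightarrow> 'a"
  assumes T: "linear T" "bij T"
  obtains c where "c > 0" "\<And>g :: 'a \<Rightarrow> real. g \<in> borel_measurable borel \<Longrightarrow>
    (\<integral>x. g (T x) \<partial>lborel) = c * (\<integral>x. g x \<partial>lborel)"
proof -
  obtain c where c: "c > 0" "\<And>g. g \<in> borel_measurable borel \<Longrightarrow>
    (\<integral>\<^sup>+x. g (T x) \<partial>lborel) = ennreal c * (\<integral>\<^sup>+x. g x \<partial>lborel)"
    using nn_integral_linear_substitution[OF T] by blast
  have Tm: "T \<in> borel_measurable borel"
    using T(1) by (intro borel_measurable_continuous_onI linear_continuous_on) (simp add: linear_conv_bounded_linear)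
  have d: "distr lborel borel T = density lborel (\<lambda>x. ennreal c)"
  proof (rule measure_eqI)
    fix A assume "A \<in> sets (distr lborel borel T)"
    then have A: "A \<in> sets borel" by simp
    have "emeasure (distr lborel borel T) A = (\<integral>\<^sup>+x. indicator A x \<partial>distr lborel borel T)"
      using A by simp
    also have "\<dots> = (\<integral>\<^sup>+x. indicator A (T x) \<partial>lborel)"
      using A Tm by (subst nn_integral_distr) auto
    also have "\<dots> = emeasure (density lborel (\<lambda>x. ennreal c)) A"
      using A c(2)[of "indicator A"] by (simp add: emeasure_density nn_integral_cmult)
    finally show "emeasure (distr lborel borel T) A = emeasure (density lborel (\<lambda>x. ennreal c)) A" .
  qed simp
  show ?thesis
  proof (rule that[OF c(1)])
    fix g :: "'a \<Rightarrow> real" assume g: "g \<in> borel_measurable borel"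
    have "(\<integral>x. g (T x) \<partial>lborel) = (\<integral>x. g x \<partial>distr lborel borel T)"
      using g Tm by (subst integral_distr) auto
    also have "\<dots> = c * (\<integral>x. g x \<partial>lborel)"
      unfolding d using g c(1) by (subst integral_density) auto
    finally show "(\<integral>x. g (T x) \<partial>lborel) = c * (\<integral>x. g x \<partial>lborel)" .
  qed
qed

subsection \<open>Piecewise constant fields\<close>

definition pw_const :: "('a::euclidean_space \<Rightarrow> 'b::euclidean_space) \<Rightarrow> bool" where
  "pw_const f \<longleftrightarrow> f \<in> L_piec \<and> f \<in> borel_measurable borel \<and> (\<exists>R. \<forall>x. norm x > R \<longrightarrow> f x = 0)"

definition pieces :: "('a::euclidean_space \<Rightarrow> 'b) \<Rightarrow> 'a set set \<Rightarrow> bool" where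
  "pieces u \<U> \<longleftrightarrow> countable \<U> \<and> disjoint \<U> \<and> (\<forall>U\<in>\<U>. open U \<and> u constant_on U) \<and>
     negligible (UNIV - \<Union>\<U>)"

lemma L_piec_pieces: "u \<in> L_piec \<longleftrightarrow> bounded (range u) \<and> (\<exists>\<U>. pieces u \<U>)"
  by (simp add: L_piec_def pieces_def)

lemma pieces_combine:
  assumes u: "pieces u \<U>" and v: "pieces v \<V>"
    and w: "\<And>x y. u x = u y \<Longrightarrow> v x = v y \<Longrightarrow> w x = w y"
  shows "pieces w {U \<inter> V |U V. U \<in> \<U> \<and> V \<in> \<V>}"
proof -
  let ?W = "{U \<inter> V |U V. U \<in> \<U> \<and> V \<in> \<V>}"
  have W: "?W = (\<Union>U\<in>\<U>. (\<lambda>V. U \<inter> V) ` \<V>)" by blast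
  have "countable ?W" unfolding W using u v by (auto simp: pieces_def)
  moreover have "disjoint ?W"
  proof (rule disjointI)
    fix a b assume "a \<in> ?W" "b \<in> ?W" "a \<noteq> b"
    then obtain U V U' V' where *: "a = U \<inter> V" "b = U' \<inter> V'" "U \<in> \<U>" "V \<in> \<V>" "U' \<in> \<U>" "V' \<in> \<V>"
      by blast
    then consider "U \<noteq> U'" | "V \<noteq> V'" using \<open>a \<noteq> b\<close> by blast
    then show "a \<inter> b = {}"
    proof cases
      case 1
      then have "U \<inter> U' = {}" using u * disjointD by (metis pieces_def)
      then show ?thesis using * by blast
    next
      case 2
      then have "V \<inter> V' = {}" using v * disjointD by (metis pieces_def)
      then show ?thesis using * by blast
    qed
  qed
  moreover have "open W \<and> w constant_on W" if "W \<in> ?W" for W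
  proof -
    from that obtain U V where UV: "W = U \<inter> V" "U \<in> \<U>" "V \<in> \<V>" by auto
    have op: "open U" "open V" and "u constant_on U" "v constant_on V"
      using u v UV(2,3) unfolding pieces_def by simp_all
    then obtain c d where c: "\<And>x. x \<in> U \<Longrightarrow> u x = c" and d: "\<And>x. x \<in> V \<Longrightarrow> v x = d"
      unfolding constant_on_def by metis
    have "w x = w y" if "x \<in> W" "y \<in> W" for x y
      by (rule w) (use that UV(1) c d in auto)
    then have "w constant_on W" unfolding constant_on_def by blast
    then show ?thesis using op UV(1) by blast
  qed
  moreover have "negligible (UNIV - \<Union>?W)"
  proof (rule negligible_subset)
    show "negligible ((UNIV - \<Union>\<U>) \<union> (UNIV - \<Union>\<V>))"
      using u v unfolding pieces_def by (intro negligible_Un) simp_all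
    have "\<Union>?W = \<Union>\<U> \<inter> \<Union>\<V>" unfolding W by auto
    then show "UNIV - \<Union>?W \<subseteq> (UNIV - \<Union>\<U>) \<union> (UNIV - \<Union>\<V>)" by simp (use Diff_Int[of UNIV "\<Union>\<U>" "\<Union>\<V>"] in simp)
  qed
  ultimately show ?thesis by (simp add: pieces_def)
qed

lemma L_piec_combine:
  fixes w :: "'a::euclidean_space \<Rightarrow> 'd::euclidean_space"
  assumes "u \<in> L_piec" "v \<in> L_piec" "bounded (range w)"
    and "\<And>x y. u x = u y \<Longrightarrow> v x = v y \<Longrightarrow> w x = w y"
  shows "w \<in> L_piec"
  using assms pieces_combine[of u _ v _ w] unfolding L_piec_pieces by blast

lemma L_piec_add:
  assumes "u \<in> L_piec" "v \<in> L_piec" shows "(\<lambda>x. u x + v x) \<in> L_piec"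
  using assms by (intro L_piec_combine[OF assms]) (auto simp: L_piec_def intro: bounded_plus_comp)

lemma L_piec_map:
  assumes "u \<in> L_piec" "bounded_linear h" shows "(\<lambda>x. h (u x)) \<in> L_piec"
  using assms bounded_linear_image[of "range u" h]
  by (intro L_piec_combine[OF assms(1) assms(1)]) (auto simp: L_piec_def image_image)

lemma L_piec_zero: "(\<lambda>x. 0) \<in> L_piec"
  by (auto simp: L_piec_def constant_on_def intro!: exI[of _ "{UNIV}"])

lemma L_piec_sum:
  assumes "\<And>i. i \<in> I \<Longrightarrow> f i \<in> L_piec" shows "(\<lambda>x. \<Sum>i\<in>I. f i x) \<in> L_piec"
  using assms by (induction I rule: infinite_finite_induct) (auto intro: L_piec_zero L_piec_add)

lemma L_piec_AE_piece:
  assumes "pieces u \<U>" shows "AE x in lebesgue. x \<in> \<Union>\<U>"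
  using assms unfolding pieces_def negligible_iff_null_sets
  by (auto simp: AE_iff_null_sets Compl_eq_Diff_UNIV intro!: AE_I'[of "UNIV - \<Union>\<U>"])

lemma L_piec_measurable:
  assumes "u \<in> L_piec" shows "u \<in> borel_measurable lebesgue"
proof -
  obtain \<U> where U: "pieces u \<U>" using assms L_piec_pieces by blast
  have "u \<in> measurable (lebesgue_on (\<Union>\<U>)) borel"
  proof (rule borel_measurableI)
    fix S :: "'b set"
    have eq: "u -` S \<inter> \<Union>\<U> = \<Union>{U \<in> \<U>. U \<subseteq> u -` S}"
      using U unfolding pieces_def constant_on_def by fastforce
    have "open (u -` S \<inter> \<Union>\<U>)" "open (\<Union>\<U>)"
      unfolding eq using U by (auto simp: pieces_def)
    then show "u -` S \<inter> space (lebesgue_on (\<Union>\<U>)) \<in> sets (lebesgue_on (\<Union>\<U>))"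
      by (subst sets_restrict_space) (auto simp: space_restrict_space intro!: image_eqI[of _ _ "u -` S \<inter> \<Union>\<U>"])
  qed
  then have "u \<in> borel_measurable (lebesgue_on (\<Union>\<U>))" .
  moreover have "open (\<Union>\<U>)" using U by (auto simp: pieces_def)
  ultimately have "(\<lambda>x. if x \<in> \<Union>\<U> then u x else 0) \<in> borel_measurable lebesgue"
    by (intro borel_measurable_if_I) auto
  then show ?thesis
    by (rule borel_measurable_AE) (use L_piec_AE_piece[OF U] in auto)
qed

lemma L_piec_subset_L_infty: "L_piec \<subseteq> L_infty"
  using L_piec_measurable by (auto simp: L_infty_def L_piec_def bounded_iff)

lemma pw_const_add:
  assumes "pw_const u" "pw_const v" shows "pw_const (\<lambda>x. u x + v x)"
proof -
  obtain R R' where "\<forall>x. norm x > R \<longrightarrow> u x = 0" "\<forall>x. norm x > R' \<longrightarrow> v x = 0"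
    using assms by (auto simp: pw_const_def)
  then have "\<exists>R. \<forall>x. norm x > R \<longrightarrow> u x + v x = 0" by (intro exI[of _ "max R R'"]) auto
  then show ?thesis using assms by (auto simp: pw_const_def L_piec_add)
qed

lemma pw_const_zero: "pw_const (\<lambda>x. 0)"
  by (auto simp: pw_const_def L_piec_zero)

lemma pw_const_map:
  assumes "pw_const u" "bounded_linear h" shows "pw_const (\<lambda>x. h (u x))"
proof -
  have "h 0 = 0" using assms(2) by (rule linear_simps)
  moreover obtain R where "\<forall>x. norm x > R \<longrightarrow> u x = 0" using assms(1) by (auto simp: pw_const_def)
  ultimately have "\<exists>R. \<forall>x. norm x > R \<longrightarrow> h (u x) = 0" by (intro exI[of _ R]) auto
  moreover have "(\<lambda>x. h (u x)) \<in> borel_measurable borel"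
    using assms(1) linear_continuous_on[OF assms(2), of UNIV]
    by (intro borel_measurable_continuous_on[of h]) (auto simp: pw_const_def)
  ultimately show ?thesis using assms by (simp add: pw_const_def L_piec_map)
qed

lemma pw_const_sum:
  assumes "\<And>i. i \<in> I \<Longrightarrow> pw_const (f i)" shows "pw_const (\<lambda>x. \<Sum>i\<in>I. f i x)"
  using assms by (induction I rule: infinite_finite_induct) (auto intro: pw_const_zero pw_const_add)

lemma pw_const_cmult: "pw_const (u :: _ \<Rightarrow> real) \<Longrightarrow> pw_const (\<lambda>x. c * u x)"
  by (rule pw_const_map) (auto intro: bounded_linear_mult_right)

lemma pw_const_indicator:
  assumes "compact C" "convex C"
  shows "pw_const (indicator C :: 'a::euclidean_space \<Rightarrow> real)"
proof -
  have "pieces (indicator C :: 'a \<Rightarrow> real) {interior C, - C}"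
  proof -
    have "UNIV - \<Union>{interior C, - C} \<subseteq> frontier C"
      using closure_subset by (auto simp: frontier_def)
    then have "negligible (UNIV - \<Union>{interior C, - C})"
      using negligible_convex_frontier[OF assms(2)] negligible_subset by blast
    moreover have "disjoint {interior C, - C}"
      using interior_subset[of C] by (auto simp: disjoint_def)
    moreover have "indicator C constant_on interior C" "indicator C constant_on (- C)"
      using interior_subset[of C] by (auto simp: constant_on_def indicator_def)
    ultimately show ?thesis
      using compact_imp_closed[OF assms(1)] by (auto simp: pieces_def)
  qed
  moreover have "bounded (range (indicator C :: 'a \<Rightarrow> real))"
    by (auto simp: bounded_iff indicator_def intro!: exI[of _ 1])
  moreover obtain R where "\<forall>x\<in>C. norm x \<le> R"
    using compact_imp_bounded[OF assms(1)] bounded_iff by blast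
  then have "\<forall>x. norm x > R \<longrightarrow> indicator C x = (0::real)" by (auto simp: indicator_def)
  ultimately show ?thesis
    using compact_imp_closed[OF assms(1)] by (auto simp: pw_const_def L_piec_pieces)
qed

lemma negligible_affine_image:
  fixes T :: "'a::euclidean_space \<Rightarrow> 'a"
  assumes "linear T" "negligible S" shows "negligible ((\<lambda>x. T x + a) ` S)"
proof (rule negligible_differentiable_image_negligible[OF order_refl assms(2)])
  show "(\<lambda>x. T x + a) differentiable_on S"
    using linear_imp_differentiable_on[OF assms(1)] by (intro derivative_intros)
qed

lemma pw_const_affine:
  fixes T :: "'a::euclidean_space \<Rightarrow> 'a"
  assumes u: "pw_const u" and T: "linear T" "bij T"
  shows "pw_const (\<lambda>x. u (T x + a))"
proof -
  define S where "S = inv T"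
  have S: "linear S" "\<And>x. T (S x) = x" "\<And>x. S (T x) = x"
    using T unfolding S_def
    by (simp_all add: inj_linear_imp_inv_linear bij_is_inj bij_is_surj surj_f_inv_f)
  have cT: "continuous_on UNIV (\<lambda>x. T x + a)"
    using T(1) by (intro continuous_intros linear_continuous_on) (simp add: linear_conv_bounded_linear)
  obtain \<U> where U: "pieces u \<U>" using u by (auto simp: pw_const_def L_piec_pieces)
  let ?V = "(\<lambda>U. (\<lambda>x. T x + a) -` U) ` \<U>"
  have "pieces (\<lambda>x. u (T x + a)) ?V"
  proof -
    have "UNIV - \<Union>?V = (\<lambda>x. S x + (- S a)) ` (UNIV - \<Union>\<U>)"
    proof (intro set_eqI iffI)
      fix x assume "x \<in> UNIV - \<Union>?V"
      then show "x \<in> (\<lambda>x. S x + (- S a)) ` (UNIV - \<Union>\<U>)"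
        by (intro image_eqI[of _ _ "T x + a"]) (auto simp: S linear_add[OF S(1)])
    next
      fix x assume "x \<in> (\<lambda>x. S x + (- S a)) ` (UNIV - \<Union>\<U>)"
      then obtain y where "x = S (y - a)" "y \<notin> \<Union>\<U>" by (auto simp: linear_diff[OF S(1)])
      then show "x \<in> UNIV - \<Union>?V" by (auto simp: S)
    qed
    moreover have "negligible (UNIV - \<Union>\<U>)" using U by (simp add: pieces_def)
    ultimately have "negligible (UNIV - \<Union>?V)"
      using negligible_affine_image[OF S(1)] by metis
    moreover have "disjoint ?V"
      using U by (auto simp: pieces_def pairwise_image intro!: pairwise_mono[of disjnt \<U>] simp: disjnt_def)
    moreover have "open ((\<lambda>x. T x + a) -` U)" if "U \<in> \<U>" for U
      using U cT that by (auto simp: pieces_def intro: open_vimage)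
    moreover have "(\<lambda>x. u (T x + a)) constant_on ((\<lambda>x. T x + a) -` U)" if "U \<in> \<U>" for U
      using U that by (fastforce simp: pieces_def constant_on_def)
    ultimately show ?thesis using U by (auto simp: pieces_def)
  qed
  moreover have "bounded (range (\<lambda>x. u (T x + a)))"
    using u bounded_subset[of "range u" "range (\<lambda>x. u (T x + a))"] by (auto simp: pw_const_def L_piec_def)
  moreover have "(\<lambda>x. u (T x + a)) \<in> borel_measurable borel"
    using u by (intro measurable_compose[OF borel_measurable_continuous_onI[OF cT]]) (auto simp: pw_const_def)
  moreover have "\<exists>R. \<forall>x. norm x > R \<longrightarrow> u (T x + a) = 0"
  proof -
    obtain R where R: "\<forall>x. norm x > R \<longrightarrow> u x = 0" using u by (auto simp: pw_const_def)
    have "bounded ((\<lambda>x. x - S a) ` S ` cball 0 R)"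
      using S(1) by (intro bounded_translation_minus bounded_linear_image) (auto simp: linear_conv_bounded_linear)
    then obtain R' where R': "\<forall>y\<in>(\<lambda>x. x - S a) ` S ` cball 0 R. norm y \<le> R'" using bounded_iff by blast
    have "u (T x + a) = 0" if "norm x > R'" for x
    proof (rule ccontr)
      assume "u (T x + a) \<noteq> 0"
      then have "T x + a \<in> cball 0 R" using R by (auto simp: not_less)
      moreover have "x = S (T x + a) - S a" by (simp add: S linear_add[OF S(1)])
      ultimately have "x \<in> (\<lambda>x. x - S a) ` S ` cball 0 R" by blast
      then show False using R' that by force
    qed
    then show ?thesis by blast
  qed
  ultimately show ?thesis by (auto simp: pw_const_def L_piec_pieces)
qed

lemma pw_const_integrable:
  fixes u :: "'a::euclidean_space \<Rightarrow> real"
  assumes u: "pw_const u" and g: "continuous_on UNIV g"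
  shows "integrable lborel (\<lambda>x. u x * g x)"
proof -
  obtain R where R: "\<forall>x. norm x > R \<longrightarrow> u x = 0" using u by (auto simp: pw_const_def)
  obtain B where B: "\<And>x. \<bar>u x\<bar> \<le> B" using u by (auto simp: pw_const_def L_piec_def bounded_iff)
  have "compact (g ` cball 0 R)"
    using g by (intro compact_continuous_image) (auto intro: continuous_on_subset)
  then obtain C where C: "\<And>x. x \<in> cball 0 R \<Longrightarrow> \<bar>g x\<bar> \<le> C"
    using compact_imp_bounded bounded_iff by (metis imageI real_norm_def)
  show ?thesis
  proof (rule integrableI_bounded_set[where A = "cball 0 R" and B = "B * C"])
    show "(\<lambda>x. u x * g x) \<in> borel_measurable lborel"
      using u borel_measurable_continuous_onI[OF g] by (auto simp: pw_const_def)
    show "emeasure lborel (cball 0 R :: 'a set) < \<infinity>"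
      by (intro emeasure_bounded_finite) simp
    show "AE x in lborel. x \<in> cball 0 R \<longrightarrow> norm (u x * g x) \<le> B * C"
      using B C by (intro AE_I2 impI) (auto simp: abs_mult intro!: mult_mono order.trans[OF abs_ge_zero])
    show "AE x in lborel. x \<notin> cball 0 R \<longrightarrow> u x * g x = 0"
      using R by auto
  qed simp
qed

subsection \<open>Constant coefficient operators\<close>

text \<open>\<open>pdo w k p s\<close>: the operator \<open>p\<close> is a homogeneous polynomial of degree \<open>k\<close> in the directional
  derivatives, and \<open>s\<close> is the value of that polynomial at \<open>w\<close>.\<close>

inductive pdo :: "'a::euclidean_space \<Rightarrow> nat \<Rightarrow> (('a \<Rightarrow> real) \<Rightarrow> 'a \<Rightarrow> real) \<Rightarrow> real \<Rightarrow> bool" for w where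
  pdo_id: "pdo w 0 (\<lambda>f. f) 1"
| pdo_dird: "pdo w k p s \<Longrightarrow> pdo w (Suc k) (\<lambda>f. p (dird v f)) ((w \<bullet> v) * s)"
| pdo_lin: "pdo w k p s \<Longrightarrow> pdo w k q t \<Longrightarrow> pdo w k (\<lambda>f x. a * p f x + b * q f x) (a * s + b * t)"
| pdo_cong: "pdo w k p s \<Longrightarrow> (\<And>f. smooth f \<Longrightarrow> q f = p f) \<Longrightarrow> pdo w k q s"

lemma pdo_smooth: "pdo w k p s \<Longrightarrow> smooth f \<Longrightarrow> smooth (p f)"
proof (induction arbitrary: f rule: pdo.induct)
  case (pdo_lin k p s q t a b)
  then show ?case by (intro smooth_add smooth_cmult) simp_all
qed (simp_all add: smooth_dird)

lemma pdo_linear: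
  assumes "pdo w k p s" "smooth f" "smooth g"
  shows "p (\<lambda>x. a * f x + b * g x) = (\<lambda>x. a * p f x + b * p g x)"
  using assms
proof (induction arbitrary: f g rule: pdo.induct)
  case (pdo_dird k p s v)
  have "dird v (\<lambda>x. a * f x + b * g x) = (\<lambda>x. a * dird v f x + b * dird v g x)"
    using pdo_dird.prems by (simp add: dird_add dird_cmult smooth_cmult)
  then show ?case using pdo_dird by (simp add: smooth_dird)
next
  case (pdo_lin k p s q t c d)
  then show ?case by (simp add: algebra_simps)
next
  case (pdo_cong k p s q)
  then show ?case by (simp add: smooth_add smooth_cmult)
qed simp

lemma pdo_cmult_arg: "pdo w k p s \<Longrightarrow> smooth f \<Longrightarrow> p (\<lambda>x. a * f x) = (\<lambda>x. a * p f x)"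
  using pdo_linear[of w k p s f f a 0] by simp

lemma pdo_zero_arg: "pdo w k p s \<Longrightarrow> p (\<lambda>x. 0) = (\<lambda>x. 0)"
  using pdo_cmult_arg[of w k p s "\<lambda>x. 0" 0] by (simp add: smooth_const)

lemma pdo_sum_arg:
  assumes "pdo w k p s" "\<And>i. i \<in> I \<Longrightarrow> smooth (f i)"
  shows "p (\<lambda>x. \<Sum>i\<in>I. f i x) = (\<lambda>x. \<Sum>i\<in>I. p (f i) x)"
  using assms(2)
proof (induction I rule: infinite_finite_induct)
  case (insert i I)
  then show ?case
    using pdo_linear[OF assms(1), of "f i" "\<lambda>x. \<Sum>i\<in>I. f i x" 1 1] by (simp add: smooth_sum)
qed (simp_all add: pdo_zero_arg[OF assms(1)])

lemma pdo_dird_commute: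
  assumes "pdo w k p s" "smooth f"
  shows "p (dird v f) = dird v (p f)"
  using assms
proof (induction arbitrary: f rule: pdo.induct)
  case (pdo_dird k p s u)
  then show ?case by (metis dird_commute smooth_dird)
next
  case (pdo_lin k p s q t a b)
  then show ?case by (simp add: dird_add dird_cmult smooth_cmult pdo_smooth[of w])
next
  case (pdo_cong k p s q)
  then show ?case by (simp add: smooth_dird)
qed simp

lemma pdo_commute:
  assumes "pdo w k p s" "pdo w l q t" "smooth f"
  shows "p (q f) = q (p f)"
  using assms
proof (induction arbitrary: f rule: pdo.induct)
  case (pdo_dird k p s u)
  then show ?case by (metis pdo_dird_commute smooth_dird)
next
  case (pdo_lin k p s q' t' a b)
  then show ?case by (simp add: pdo_linear[of w l q t] pdo_smooth[of w])
next
  case (pdo_cong k p s q')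
  then show ?case by (simp add: pdo_smooth[of w])
qed simp

lemma pdo_translate:
  assumes "pdo w k p s" "smooth f"
  shows "p (\<lambda>x. f (x + a)) = (\<lambda>x. p f (x + a))"
  using assms
proof (induction arbitrary: f rule: pdo.induct)
  case (pdo_dird k p s u)
  then show ?case by (simp add: dird_translate smooth_dird)
qed (simp_all add: smooth_translate)

lemma pdo_const: "pdo w k p s \<Longrightarrow> k > 0 \<Longrightarrow> p (\<lambda>x. c) = (\<lambda>x. 0)"
  by (induction arbitrary: c rule: pdo.induct) (simp_all add: dird_const pdo_zero_arg smooth_const)

lemma pdo_exp: "pdo w k p s \<Longrightarrow> p (\<lambda>x. exp (w \<bullet> x)) = (\<lambda>x. s * exp (w \<bullet> x))"
proof (induction rule: pdo.induct)
  case (pdo_dird k p s v)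
  then show ?case
    using pdo_cmult_arg[OF pdo_dird.hyps smooth_exp, of "w \<bullet> v"] by (simp add: dird_exp mult.assoc)
qed (simp_all add: smooth_exp algebra_simps)

lemma pdo_comp:
  assumes q: "pdo w l q t" and p: "pdo w k p s"
  shows "pdo w (k + l) (\<lambda>f. p (q f)) (s * t)"
  using q
proof (induction rule: pdo.induct)
  case pdo_id
  then show ?case using p by simp
next
  case (pdo_dird l q t v)
  from pdo.pdo_dird[OF pdo_dird.IH, of v] show ?case by (simp add: ac_simps)
next
  case (pdo_lin l q t q' t' a b)
  from pdo.pdo_lin[OF pdo_lin.IH, of a b] have "pdo w (k + l) (\<lambda>f x. a * p (q f) x + b * p (q' f) x) (s * (a * t + b * t'))"
    by (simp add: algebra_simps)
  then show ?case
    by (rule pdo_cong) (use pdo_lin.hyps in \<open>auto intro!: pdo_linear[OF p] elim: pdo_smooth\<close>)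
next
  case (pdo_cong l q t q')
  show ?case by (rule pdo.pdo_cong[OF pdo_cong.IH]) (simp add: pdo_cong.hyps)
qed

lemma pdo_zero: "pdo w k p s \<Longrightarrow> pdo w k (\<lambda>f x. 0) 0"
  using pdo_lin[of w k p s p s 0 0] by simp

lemma pdo_sum:
  assumes "finite I" "I \<noteq> {}" "\<And>i. i \<in> I \<Longrightarrow> pdo w k (p i) (s i)"
  shows "pdo w k (\<lambda>f x. \<Sum>i\<in>I. p i f x) (\<Sum>i\<in>I. s i)"
  using assms
proof (induction rule: finite_ne_induct)
  case (insert i I)
  then show ?case using pdo_lin[of w k "p i" "s i" "\<lambda>f x. \<Sum>i\<in>I. p i f x" "\<Sum>i\<in>I. s i" 1 1] by simp
qed simp

lemma pdo_dir: "pdo w (Suc 0) (dird v) (w \<bullet> v)"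
  using pdo_dird[OF pdo_id, of w v] by simp

lemma pdo_iterate: "pdo w k ((dird v) ^^ k) ((w \<bullet> v) ^ k)"
proof (induction k)
  case (Suc k)
  show ?case using pdo_dird[OF Suc, of v] by (simp only: funpow_Suc_right o_def power_Suc)
qed (use pdo_id in \<open>simp add: id_def\<close>)

subsection \<open>Potentials\<close>

text \<open>Fraction free Gaussian elimination over the ring of constant coefficient operators: given
  operators annihilated by some rows of the system and one further row with image \<open>Q\<close>, the
  combinations \<open>Q c (P l c') - Q c' (P l c)\<close> are annihilated by that row too. Their symbols at \<open>w\<close>
  span the common kernel as soon as the symbol of \<open>Q c\<close> does not vanish at \<open>w\<close>.\<close>

lemma elimination:
  fixes \<alpha> :: "'m::finite \<Rightarrow> 'd::finite \<Rightarrow> 'a::euclidean_space"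
  assumes onto: "\<And>r. \<exists>v::'d \<Rightarrow> real. \<forall>r'. (\<Sum>l\<in>UNIV. (w \<bullet> \<alpha> r' l) * v l) = (if r' = r then 1 else 0)"
  shows "\<exists>k P s. (R \<noteq> {} \<longrightarrow> k > 0) \<and> (\<forall>l c. pdo w k (P l c) (s l c)) \<and>
    (\<forall>r\<in>R. \<forall>c f. smooth f \<longrightarrow> (\<lambda>x. \<Sum>l\<in>UNIV. dird (\<alpha> r l) (P l c f) x) = (\<lambda>x. 0)) \<and>
    (\<forall>v. (\<forall>r\<in>R. (\<Sum>l\<in>UNIV. (w \<bullet> \<alpha> r l) * v l) = 0) \<longrightarrow> (\<exists>y. \<forall>l::'d. (\<Sum>c\<in>(UNIV::'d set). s l c * y c) = v l))"
    (is "\<exists>k P s. ?Q R k P s")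
  using finite[of R]
proof (induction R rule: finite_induct)
  case empty
  define P where "P l c = (\<lambda>f::'a \<Rightarrow> real. if l = c then f else (\<lambda>x. 0))" for l c :: 'd
  define s where "s l c = (if l = c then 1 else 0 :: real)" for l c :: 'd
  have "pdo w 0 (P l c) (s l c)" for l c
    using pdo_id pdo_zero[OF pdo_id] by (auto simp: P_def s_def)
  moreover have "(\<Sum>c\<in>UNIV. s l c * v c) = v l" for v l
    by (simp add: s_def if_distrib[of "\<lambda>x. x * _"] cong: if_cong)
  ultimately show ?case by (intro exI[of _ 0] exI[of _ P] exI[of _ s]) auto
next
  case (insert r R)
  then obtain k P s where IH: "?Q R k P s" by (elim exE) (rule that)
  then have P: "pdo w k (P l c) (s l c)" for l c by simp
  have ann: "(\<lambda>x. \<Sum>l\<in>UNIV. dird (\<alpha> r l) (P l c f) x) = (\<lambda>x. 0)" if "r \<in> R" "smooth f" for r c f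
    using IH that by simp
  have ker: "\<exists>y. \<forall>l. (\<Sum>c\<in>UNIV. s l c * y c) = v l"
    if "\<And>r. r \<in> R \<Longrightarrow> (\<Sum>l\<in>UNIV. (w \<bullet> \<alpha> r l) * v l) = 0" for v
    using IH that by simp
  define Q where "Q c = (\<lambda>f x. \<Sum>l\<in>UNIV. dird (\<alpha> r l) (P l c f) x)" for c
  define q where "q c = (\<Sum>l\<in>UNIV. (w \<bullet> \<alpha> r l) * s l c)" for c
  have Q: "pdo w (Suc k) (Q c) (q c)" for c
    unfolding Q_def q_def using pdo_comp[OF P pdo_dir] by (intro pdo_sum) auto
  have smP: "smooth (P l c f)" if "smooth f" for l c f using pdo_smooth[OF P that] .
  have smQ: "smooth (Q c f)" if "smooth f" for c f using pdo_smooth[OF Q that] .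
  obtain c where c: "q c \<noteq> 0"
  proof -
    obtain v where v: "\<And>r'. (\<Sum>l\<in>UNIV. (w \<bullet> \<alpha> r' l) * v l) = (if r' = r then 1 else 0 :: real)"
      using onto by blast
    have "\<exists>y. \<forall>l. (\<Sum>c\<in>UNIV. s l c * y c) = v l"
      by (rule ker) (use v insert.hyps(2) in auto)
    then obtain y where y: "\<And>l. (\<Sum>c\<in>UNIV. s l c * y c) = v l"
      by blast
    have "(\<Sum>c\<in>UNIV. q c * y c) = (\<Sum>c\<in>UNIV. \<Sum>l\<in>UNIV. (w \<bullet> \<alpha> r l) * (s l c * y c))"
      by (simp add: q_def sum_distrib_left sum_distrib_right ac_simps)
    also have "\<dots> = (\<Sum>l\<in>UNIV. (w \<bullet> \<alpha> r l) * v l)"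
      by (subst sum.swap) (simp add: sum_distrib_left[symmetric] y)
    finally have "(\<Sum>c\<in>UNIV. q c * y c) = 1" by (simp add: v)
    then have "(\<Sum>c\<in>UNIV. q c * y c) \<noteq> 0" by simp
    then obtain c where "q c * y c \<noteq> 0" by (rule sum.not_neutral_contains_not_neutral)
    then show ?thesis using that by auto
  qed
  define P' where "P' l c' = (\<lambda>f x. Q c (P l c' f) x - Q c' (P l c f) x)" for l c'
  define s' where "s' l c' = q c * s l c' - q c' * s l c" for l c'
  have P': "pdo w (Suc k + k) (P' l c') (s' l c')" for l c'
    using pdo_lin[OF pdo_comp[OF P[of l c'] Q[of c]] pdo_comp[OF P[of l c] Q[of c']], where a = 1 and b = "-1"]
    by (simp add: P'_def s'_def)
  have expand: "(\<Sum>l\<in>UNIV. dird (\<alpha> r' l) (P' l c' f) x) =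
      Q c (\<lambda>x. \<Sum>l\<in>UNIV. dird (\<alpha> r' l) (P l c' f) x) x - Q c' (\<lambda>x. \<Sum>l\<in>UNIV. dird (\<alpha> r' l) (P l c f) x) x"
    if f: "smooth f" for r' c' f x
  proof -
    have "dird (\<alpha> r' l) (P' l c' f) = (\<lambda>x. Q c (dird (\<alpha> r' l) (P l c' f)) x - Q c' (dird (\<alpha> r' l) (P l c f)) x)" for l
      unfolding P'_def using f by (simp add: dird_diff smP smQ pdo_dird_commute[OF Q])
    then show ?thesis
      using f by (simp add: pdo_sum_arg[OF Q] smP smooth_dird sum_subtractf)
  qed
  have ann': "(\<lambda>x. \<Sum>l\<in>UNIV. dird (\<alpha> r' l) (P' l c' f) x) = (\<lambda>x. 0)" if "r' \<in> insert r R" "smooth f" for r' c' f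
  proof (cases "r' = r")
    case True
    have "Q c (Q c' f) = Q c' (Q c f)" by (rule pdo_commute[OF Q Q that(2)])
    then show ?thesis
      using that unfolding expand[OF that(2)] True by (simp add: Q_def)
  next
    case False
    then show ?thesis
      using that ann unfolding expand[OF that(2)] by (simp add: pdo_zero_arg[OF Q])
  qed
  have ker': "\<exists>y. \<forall>l. (\<Sum>c\<in>UNIV. s' l c * y c) = v l"
    if v: "\<And>r'. r' \<in> insert r R \<Longrightarrow> (\<Sum>l\<in>UNIV. (w \<bullet> \<alpha> r' l) * v l) = 0" for v
  proof -
    obtain y where y: "\<And>l. (\<Sum>c\<in>UNIV. s l c * y c) = v l" using ker[of v] v by auto
    have qy: "(\<Sum>c\<in>UNIV. q c * y c) = 0"
    proof -
      have "(\<Sum>c\<in>UNIV. q c * y c) = (\<Sum>c\<in>UNIV. \<Sum>l\<in>UNIV. (w \<bullet> \<alpha> r l) * (s l c * y c))"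
        by (simp add: q_def sum_distrib_left sum_distrib_right ac_simps)
      also have "\<dots> = (\<Sum>l\<in>UNIV. (w \<bullet> \<alpha> r l) * v l)"
        by (subst sum.swap) (simp add: sum_distrib_left[symmetric] y)
      finally show ?thesis using v by simp
    qed
    have "(\<Sum>c'\<in>UNIV. s' l c' * (y c' / q c)) = v l" for l
    proof -
      have "(\<Sum>c'\<in>UNIV. s' l c' * (y c' / q c)) = (\<Sum>c'\<in>UNIV. s l c' * y c' - (s l c / q c) * (q c' * y c'))"
        using c by (intro sum.cong) (auto simp: s'_def field_simps)
      also have "\<dots> = v l - (s l c / q c) * 0"
        by (simp only: sum_subtractf y sum_distrib_left[symmetric] qy)
      finally show ?thesis by simp
    qed
    then show ?thesis by (intro exI[of _ "\<lambda>c'. y c' / q c"]) simp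
  qed
  have K: "\<forall>v. (\<forall>r'\<in>insert r R. (\<Sum>l\<in>UNIV. (w \<bullet> \<alpha> r' l) * v l) = 0) \<longrightarrow>
      (\<exists>y. \<forall>l. (\<Sum>c\<in>UNIV. s' l c * y c) = v l)"
    by (intro allI impI ker') blast
  have "?Q (insert r R) (Suc k + k) P' s'"
    by (intro conjI K) (use P' ann' in auto)
  then show ?case by (intro exI)
qed

subsection \<open>Densities of spline functionals\<close>

definition generic :: "'a::euclidean_space list \<Rightarrow> bool" where
  "generic L \<longleftrightarrow> distinct L \<and> (\<forall>S\<subseteq>set L. card S \<le> DIM('a) \<longrightarrow> independent S)"

lemma generic_exists: "\<exists>L::'a::euclidean_space list. length L = n \<and> generic L"
proof (induction n)
  case 0
  show ?case by (rule exI[of _ "[]"]) (simp add: generic_def independent_empty)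
next
  case (Suc n)
  then obtain L :: "'a list" where L: "length L = n" "generic L" by blast
  let ?\<S> = "{S. S \<subseteq> set L \<and> card S < DIM('a)}"
  have "negligible (\<Union>(span ` ?\<S>) \<union> set L)"
  proof (rule negligible_Un[OF negligible_Union negligible_finite])
    show "finite (span ` ?\<S>)" by (intro finite_imageI finite_subset[of ?\<S> "Pow (set L)"]) auto
    fix T :: "'a set" assume "T \<in> span ` ?\<S>"
    then obtain S where S: "T = span S" "S \<subseteq> set L" "card S < DIM('a)" by blast
    then have "dim T \<le> card S" using dim_le_card[of S S] finite_subset[OF S(2)] by (simp add: span_superset)
    then show "negligible T" using S(3) by (intro negligible_lowdim) simp
  qed auto
  then obtain x where x: "x \<notin> \<Union>(span ` ?\<S>) \<union> set L"
    by (metis UNIV_I non_negligible_UNIV subsetI negligible_subset)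
  have "independent S" if S: "S \<subseteq> set (x # L)" "card S \<le> DIM('a)" for S
  proof (cases "x \<in> S")
    case True
    then obtain S' where S': "S = insert x S'" "x \<notin> S'" by (meson Set.set_insert)
    then have "S' \<subseteq> set L" "finite S'" using S x finite_subset[of S "set (x # L)"] by auto
    then have "card S' < DIM('a)" using S S' by auto
    moreover from this have "independent S'" using L(2) \<open>S' \<subseteq> set L\<close> by (auto simp: generic_def)
    ultimately show ?thesis
      using x S' \<open>S' \<subseteq> set L\<close> by (auto simp: independent_insert)
  next
    case False
    then show ?thesis using S L(2) by (auto simp: generic_def)
  qed
  then have "generic (x # L)" using x L(2) by (auto simp: generic_def)
  then show ?case using L(1) by (intro exI[of _ "x # L"]) simp
qed

lemma generic_remove: "generic (L1 @ z # L2) \<Longrightarrow> generic (L1 @ L2)"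
  by (auto simp: generic_def)

lemma spline_density_base:
  fixes L :: "'a::euclidean_space list"
  assumes L: "generic L" "length L = DIM('a)"
  shows "\<exists>u. pw_const u \<and> (\<forall>f. smooth f \<longrightarrow> spline L f = (\<integral>x. u x * f x \<partial>lborel))"
proof -
  obtain bs :: "'a list" where bs: "distinct bs" "set bs = Basis"
    using finite_distinct_list[OF finite_Basis] by blast
  have lb: "length bs = DIM('a)" using bs distinct_card by force
  have indL: "independent (set L)" using L by (auto simp: generic_def distinct_card)
  define g where "g b = L ! (SOME i. i < length bs \<and> bs ! i = b)" for b
  have g: "g (bs ! i) = L ! i" if "i < length bs" for i
  proof -
    have "(SOME j. j < length bs \<and> bs ! j = bs ! i) = i"
      using that bs(1) by (intro some_equality) (auto simp: nth_eq_iff_index_eq)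
    then show ?thesis by (simp add: g_def)
  qed
  define T where "T x = (\<Sum>b\<in>Basis. (x \<bullet> b) *\<^sub>R g b)" for x :: 'a
  have T: "linear T"
    unfolding T_def by (intro linear_compose_sum ballI) (auto simp: linear_iff inner_add_left scaleR_add_left)
  have Tb: "T b = g b" if "b \<in> Basis" for b
    using that by (simp add: T_def inner_Basis if_distrib[of "\<lambda>x. x *\<^sub>R _"] cong: if_cong)
  have map: "map T bs = L"
  proof (intro nth_equalityI)
    fix i assume "i < length (map T bs)"
    then show "map T bs ! i = L ! i" using g Tb bs by (metis length_map nth_map nth_mem)
  qed (use L lb in simp)
  have "surj T"
  proof -
    have "set L \<subseteq> range T" using map by (metis image_mono image_set subset_UNIV)
    then have "span (set L) \<subseteq> range T"
      using T by (intro span_minimal) (auto intro: linear_subspace_image subspace_UNIV)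
    moreover have "span (set L) = UNIV"
      using card_ge_dim_independent[of "set L" UNIV] indL L by (auto simp: generic_def distinct_card)
    ultimately show ?thesis by auto
  qed
  then have bij: "bij T" using T linear_surjective_imp_injective by (auto simp: bij_def)
  obtain c where c: "\<And>h :: 'a \<Rightarrow> real. h \<in> borel_measurable borel \<Longrightarrow> (\<integral>x. h (T x) \<partial>lborel) = c * (\<integral>x. h x \<partial>lborel)"
    using lborel_linear_substitution[OF T bij] by blast
  let ?C = "T ` cbox 0 One"
  have C: "compact ?C" "convex ?C"
    using T by (auto intro!: compact_continuous_image linear_continuous_on convex_linear_image simp: linear_conv_bounded_linear)
  have "spline L f = (\<integral>x. (c * indicator ?C x) * f x \<partial>lborel)" if f: "smooth f" for f
  proof -
    have "spline L f = spline bs (\<lambda>x. f (T x))" using spline_linear_image[OF T, of bs f] map by simp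
    also have "\<dots> = (\<integral>x. indicator (cbox 0 One) x * f (T x) \<partial>lborel)"
      using smooth_affine[OF f T, of 0] by (intro spline_basis bs) simp
    also have "\<dots> = (\<integral>x. indicator ?C (T x) * f (T x) \<partial>lborel)"
      using bij by (intro Bochner_Integration.integral_cong) (auto simp: indicator_def bij_def inj_image_mem_iff)
    also have "\<dots> = c * (\<integral>x. indicator ?C x * f x \<partial>lborel)"
      using C(1) f by (intro c borel_measurable_times borel_measurable_indicator borel_closed compact_imp_closed
          borel_measurable_continuous_onI smooth_continuous_on)
    finally show ?thesis by (simp add: mult.assoc)
  qed
  moreover have "pw_const (\<lambda>x. c * indicator ?C x)"
    using C by (intro pw_const_cmult pw_const_indicator)
  ultimately show ?thesis by blast
qed

lemma spline_density:
  fixes L :: "'a::euclidean_space list"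
  assumes "pdo w k p s" "generic L" "length L = DIM('a) + k"
  shows "\<exists>u. pw_const u \<and> (\<forall>f. smooth f \<longrightarrow> spline L (p f) = (\<integral>x. u x * f x \<partial>lborel))"
  using assms
proof (induction arbitrary: L rule: pdo.induct)
  case pdo_id
  then show ?case using spline_density_base by simp
next
  case (pdo_dird k p s v)
  let ?I = "{..<DIM('a)}"
  have "independent (set (take DIM('a) L))" "card (set (take DIM('a) L)) = DIM('a)"
    using pdo_dird.prems set_take_subset[of "DIM('a)" L]
    by (auto simp: generic_def distinct_card)
  then have "v \<in> span (set (take DIM('a) L))"
    using card_ge_dim_independent[of "set (take DIM('a) L)" UNIV] by auto
  then obtain r where r: "v = (\<Sum>z\<in>set (take DIM('a) L). r z *\<^sub>R z)"
    by (auto simp: span_finite)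
  also have "\<dots> = (\<Sum>i\<in>?I. r (L ! i) *\<^sub>R (L ! i))"
  proof (rule sum.reindex_bij_betw[symmetric])
    have "bij_betw ((!) (take DIM('a) L)) ?I (set (take DIM('a) L))"
      using pdo_dird.prems by (intro bij_betw_nth) (auto simp: generic_def)
    then show "bij_betw ((!) L) ?I (set (take DIM('a) L))"
      by (rule bij_betw_cong[THEN iffD1, rotated]) auto
  qed
  finally have v: "v = (\<Sum>i\<in>?I. r (L ! i) *\<^sub>R (L ! i))" .
  define L' where "L' i = take i L @ drop (Suc i) L" for i
  have split: "L = take i L @ L ! i # drop (Suc i) L" if "i \<in> ?I" for i
    using that pdo_dird.prems by (intro id_take_nth_drop) simp
  have "\<exists>u. pw_const u \<and> (\<forall>f. smooth f \<longrightarrow> spline (L' i) (p f) = (\<integral>x. u x * f x \<partial>lborel))" if i: "i \<in> ?I" for i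
  proof (rule pdo_dird.IH)
    show "generic (L' i)" unfolding L'_def
      using pdo_dird.prems(1) split[OF i] by (metis generic_remove)
    show "length (L' i) = DIM('a) + k" using pdo_dird.prems(2) i by (simp add: L'_def)
  qed
  then obtain u where u: "\<And>i. i \<in> ?I \<Longrightarrow> pw_const (u i)"
    "\<And>i f. i \<in> ?I \<Longrightarrow> smooth f \<Longrightarrow> spline (L' i) (p f) = (\<integral>x. u i x * f x \<partial>lborel)"
    by metis
  define U where "U i x = u i (x + (- (L ! i))) + (- 1) * u i x" for i x
  have tr: "pw_const (\<lambda>x. u i (x + a))" if "i \<in> ?I" for i a
    using pw_const_affine[OF u(1)[OF that], of "\<lambda>x. x" a] by (simp add: linear_iff bij_def)
  have U: "pw_const (U i)" if "i \<in> ?I" for i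
    unfolding U_def using that by (intro pw_const_add tr pw_const_cmult u(1))
  have pU: "spline L (p (dird (L ! i) f)) = (\<integral>x. U i x * f x \<partial>lborel)" if i: "i \<in> ?I" and f: "smooth f" for i f
  proof -
    let ?z = "L ! i"
    have smf: "smooth (\<lambda>x. f (x + ?z))" using f by (rule smooth_translate)
    have cont: "continuous_on UNIV f" using f by (rule smooth_continuous_on)
    have "spline L (p (dird ?z f)) = spline (take i L @ ?z # drop (Suc i) L) (dird ?z (p f))"
      using split[OF i] pdo_dird_commute[OF pdo_dird.hyps f] by simp
    also have "\<dots> = spline (L' i) (p (\<lambda>x. f (x + ?z))) - spline (L' i) (p f)"
      using f by (simp add: spline_dird pdo_smooth[OF pdo_dird.hyps] pdo_translate[OF pdo_dird.hyps] L'_def)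
    also have "\<dots> = (\<integral>x. u i x * f (x + ?z) \<partial>lborel) - (\<integral>x. u i x * f x \<partial>lborel)"
      using u(2)[OF i smf] u(2)[OF i f] by simp
    also have "(\<integral>x. u i x * f (x + ?z) \<partial>lborel) = (\<integral>x. u i (x + (- ?z)) * f x \<partial>lborel)"
    proof -
      have "(\<integral>x. u i (x + (- ?z)) * f x \<partial>lborel) = (\<integral>x. u i (x + (- ?z)) * f x \<partial>(distr lborel borel ((+) ?z)))"
        by (simp add: lborel_distr_plus)
      also have "\<dots> = (\<integral>x. u i x * f (x + ?z) \<partial>lborel)"
        using tr[OF i, of "- ?z"] borel_measurable_continuous_onI[OF cont]
        by (subst integral_distr) (auto simp: pw_const_def add.commute)
      finally show ?thesis by simp
    qed
    also have "\<dots> - (\<integral>x. u i x * f x \<partial>lborel) = (\<integral>x. U i x * f x \<partial>lborel)"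
      using pw_const_integrable[OF tr[OF i, of "- ?z"] cont] pw_const_integrable[OF u(1)[OF i] cont]
      by (subst Bochner_Integration.integral_diff[symmetric]) (auto simp: U_def algebra_simps)
    finally show ?thesis .
  qed
  define W where "W x = (\<Sum>i\<in>?I. r (L ! i) * U i x)" for x
  have "pw_const W"
    unfolding W_def using U by (intro pw_const_sum pw_const_cmult) auto
  moreover have "spline L (p (dird v f)) = (\<integral>x. W x * f x \<partial>lborel)" if f: "smooth f" for f
  proof -
    have cont: "continuous_on UNIV f" using f by (rule smooth_continuous_on)
    have "p (dird v f) = (\<lambda>x. \<Sum>i\<in>?I. r (L ! i) * p (dird (L ! i) f) x)"
      unfolding v dird_lincomb_dir[OF f]
      using f by (simp add: pdo_sum_arg[OF pdo_dird.hyps] pdo_cmult_arg[OF pdo_dird.hyps] smooth_dird smooth_cmult)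
    then have "spline L (p (dird v f)) = (\<Sum>i\<in>?I. r (L ! i) * spline L (p (dird (L ! i) f)))"
      using f by (simp add: spline_sum spline_cmult smooth_cmult smooth_dird pdo_smooth[OF pdo_dird.hyps])
    also have "\<dots> = (\<Sum>i\<in>?I. (\<integral>x. r (L ! i) * (U i x * f x) \<partial>lborel))"
      using pU[OF _ f] by simp
    also have "\<dots> = (\<integral>x. (\<Sum>i\<in>?I. r (L ! i) * (U i x * f x)) \<partial>lborel)"
      using pw_const_integrable[OF U cont]
      by (intro Bochner_Integration.integral_sum[symmetric] integrable_mult_right) auto
    finally show ?thesis by (simp add: W_def sum_distrib_left sum_distrib_right ac_simps)
  qed
  ultimately show ?case by blast
next
  case (pdo_lin k p s q t a b)
  obtain u v where u: "pw_const u" "\<And>f. smooth f \<Longrightarrow> spline L (p f) = (\<integral>x. u x * f x \<partial>lborel)"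
    and v: "pw_const v" "\<And>f. smooth f \<Longrightarrow> spline L (q f) = (\<integral>x. v x * f x \<partial>lborel)"
    using pdo_lin.IH pdo_lin.prems by metis
  have "spline L (\<lambda>x. a * p f x + b * q f x) = (\<integral>x. (a * u x + b * v x) * f x \<partial>lborel)" if f: "smooth f" for f
  proof -
    have cont: "continuous_on UNIV f" using f by (rule smooth_continuous_on)
    have "spline L (\<lambda>x. a * p f x + b * q f x) = a * (\<integral>x. u x * f x \<partial>lborel) + b * (\<integral>x. v x * f x \<partial>lborel)"
      using f u(2)[OF f] v(2)[OF f] pdo_smooth[OF pdo_lin.hyps(1) f] pdo_smooth[OF pdo_lin.hyps(2) f]
      by (simp add: spline_add spline_cmult smooth_cmult)
    also have "\<dots> = (\<integral>x. a * (u x * f x) + b * (v x * f x) \<partial>lborel)"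
      using pw_const_integrable[OF u(1) cont] pw_const_integrable[OF v(1) cont] by simp
    finally show ?thesis by (simp add: algebra_simps)
  qed
  moreover have "pw_const (\<lambda>x. a * u x + b * v x)"
    using u(1) v(1) by (intro pw_const_add pw_const_cmult)
  ultimately show ?case by blast
next
  case (pdo_cong k p s q)
  then show ?case by simp
qed

subsection \<open>Anisotropic fields\<close>

lemma pdo_stretch:
  assumes "pdo w k p s"
  shows "\<exists>q t. (\<forall>j. pdo w k (q j) (t j)) \<and> (\<forall>j>k. q j = (\<lambda>f x. 0)) \<and>
    (\<forall>f. smooth f \<longrightarrow> q 0 f = (\<lambda>x. s * (dird w ^^ k) f x)) \<and>
    (\<forall>T \<epsilon> f. linear T \<longrightarrow> (\<forall>v. T (\<epsilon> *\<^sub>R v + ((1 - \<epsilon>) * (w \<bullet> v)) *\<^sub>R w) = v) \<longrightarrow> smooth f \<longrightarrow>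
      (\<lambda>x. p f (T x)) = (\<lambda>x. \<Sum>j\<le>k. \<epsilon> ^ j * q j (\<lambda>x. f (T x)) x))"
    (is "\<exists>q t. ?P k p s q t")
  using assms
proof (induction rule: pdo.induct)
  case pdo_id
  let ?q = "\<lambda>j f x. if j = 0 then f x else (0::real)"
  have 1: "pdo w 0 (?q j) (if j = 0 then 1 else 0)" for j :: nat
    using pdo.pdo_id pdo_zero[OF pdo.pdo_id] by (cases "j = 0") auto
  show ?case by (intro exI[of _ ?q] exI[of _ "\<lambda>j. if j = 0 then 1 else 0"]) (use 1 in auto)
next
  case (pdo_dird k p s v)
  then obtain q t where IH: "?P k p s q t" by (elim exE) (rule that)
  then have q: "pdo w k (q j) (t j)" for j by blast
  define v' where "v' = v - (w \<bullet> v) *\<^sub>R w"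
  define Q where "Q j = (\<lambda>f x. (w \<bullet> v) * q j (dird w f) x + 1 * (case j of 0 \<Rightarrow> 0 | Suc i \<Rightarrow> q i (dird v' f) x))" for j
  define Qt where "Qt j = (w \<bullet> v) * ((w \<bullet> w) * t j) + 1 * (case j of 0 \<Rightarrow> 0 | Suc i \<Rightarrow> (w \<bullet> v') * t i)" for j
  have Q: "pdo w (Suc k) (Q j) (Qt j)" for j
  proof (cases j)
    case 0
    have "pdo w (Suc k) (\<lambda>f x. (w \<bullet> v) * q 0 (dird w f) x + 1 * 0) ((w \<bullet> v) * ((w \<bullet> w) * t 0) + 1 * 0)"
      by (intro pdo_lin pdo.pdo_dird q pdo_zero[OF pdo.pdo_dird[OF q]])
    then show ?thesis by (simp add: 0 Q_def Qt_def)
  next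
    case (Suc i)
    have "pdo w (Suc k) (\<lambda>f x. (w \<bullet> v) * q j (dird w f) x + 1 * q i (dird v' f) x)
      ((w \<bullet> v) * ((w \<bullet> w) * t j) + 1 * ((w \<bullet> v') * t i))"
      by (intro pdo_lin pdo.pdo_dird q)
    then show ?thesis by (simp add: Suc Q_def Qt_def)
  qed
  have Q0: "Q j = (\<lambda>f x. 0)" if "j > Suc k" for j
    using IH that by (auto simp: Q_def fun_eq_iff split: nat.split)
  have Qlead: "Q 0 f = (\<lambda>x. (w \<bullet> v) * s * (dird w ^^ Suc k) f x)" if "smooth f" for f
    using IH smooth_dird[OF that] by (simp add: Q_def funpow_swap1 mult.assoc)
  have ex: "(\<lambda>x. p (dird v f) (T x)) = (\<lambda>x. \<Sum>j\<le>Suc k. \<epsilon> ^ j * Q j (\<lambda>x. f (T x)) x)"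
    if T: "linear T" "\<forall>v. T (\<epsilon> *\<^sub>R v + ((1 - \<epsilon>) * (w \<bullet> v)) *\<^sub>R w) = v" and f: "smooth f" for T \<epsilon> f
  proof
    fix x
    let ?g = "\<lambda>x. f (T x)"
    have g: "smooth ?g" using smooth_affine[OF f T(1), of 0] by simp
    have "(\<lambda>x. dird v f (T x)) = dird (\<epsilon> *\<^sub>R v + ((1 - \<epsilon>) * (w \<bullet> v)) *\<^sub>R w) ?g"
      using dird_affine[OF f T(1), of _ 0] T(2) by simp
    also have "\<epsilon> *\<^sub>R v + ((1 - \<epsilon>) * (w \<bullet> v)) *\<^sub>R w = (w \<bullet> v) *\<^sub>R w + \<epsilon> *\<^sub>R v'"
      by (simp add: v'_def algebra_simps)
    finally have dg: "(\<lambda>x. dird v f (T x)) = (\<lambda>x. (w \<bullet> v) * dird w ?g x + \<epsilon> * dird v' ?g x)"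
      using g by (simp add: dird_add_dir dird_scale_dir)
    have "p (dird v f) (T x) = (\<Sum>j\<le>k. \<epsilon> ^ j * q j (\<lambda>x. dird v f (T x)) x)"
    proof -
      have "(\<lambda>x. p (dird v f) (T x)) = (\<lambda>x. \<Sum>j\<le>k. \<epsilon> ^ j * q j (\<lambda>x. dird v f (T x)) x)"
        using IH T smooth_dird[OF f] by blast
      then show ?thesis by (rule fun_cong)
    qed
    also have "\<dots> = (\<Sum>j\<le>k. \<epsilon> ^ j * ((w \<bullet> v) * q j (dird w ?g) x)) + (\<Sum>j\<le>k. \<epsilon> ^ Suc j * q j (dird v' ?g) x)"
      unfolding dg using g by (simp add: pdo_linear[OF q] smooth_dird sum.distrib[symmetric] algebra_simps)
    also have "(\<Sum>j\<le>k. \<epsilon> ^ j * ((w \<bullet> v) * q j (dird w ?g) x)) = (\<Sum>j\<le>Suc k. \<epsilon> ^ j * ((w \<bullet> v) * q j (dird w ?g) x))"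
      using IH by simp
    also have "(\<Sum>j\<le>k. \<epsilon> ^ Suc j * q j (dird v' ?g) x) =
        (\<Sum>j\<le>Suc k. \<epsilon> ^ j * (case j of 0 \<Rightarrow> 0 | Suc i \<Rightarrow> q i (dird v' ?g) x))"
      by (simp add: sum.atMost_Suc_shift del: sum.atMost_Suc power_Suc)
    finally show "p (dird v f) (T x) = (\<Sum>j\<le>Suc k. \<epsilon> ^ j * Q j ?g x)"
      unfolding Q_def by (simp only: sum.distrib[symmetric] distrib_left mult_1)
  qed
  show ?case by (rule exI[of _ Q], rule exI[of _ Qt]) (use Q Q0 Qlead ex in blast)
next
  case (pdo_lin k p s p' s' a b)
  obtain q t where q: "?P k p s q t" using pdo_lin.IH(1) by (elim exE) (rule that)
  obtain q' t' where q': "?P k p' s' q' t'" using pdo_lin.IH(2) by (elim exE) (rule that)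
  let ?Q = "\<lambda>j f x. a * q j f x + b * q' j f x"
  have 1: "\<forall>j. pdo w k (?Q j) (a * t j + b * t' j)" using q q' pdo.pdo_lin by blast
  have 2: "\<forall>j>k. ?Q j = (\<lambda>f x. 0)" using q q' by simp
  have 3: "\<forall>f. smooth f \<longrightarrow> ?Q 0 f = (\<lambda>x. (a * s + b * s') * (dird w ^^ k) f x)"
    using q q' by (simp add: algebra_simps)
  have 4: "(\<lambda>x. a * p f (T x) + b * p' f (T x)) = (\<lambda>x. \<Sum>j\<le>k. \<epsilon> ^ j * ?Q j (\<lambda>x. f (T x)) x)"
    if T: "linear T" "\<forall>v. T (\<epsilon> *\<^sub>R v + ((1 - \<epsilon>) * (w \<bullet> v)) *\<^sub>R w) = v" and f: "smooth f" for T \<epsilon> f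
  proof
    fix x
    have "(\<lambda>x. p f (T x)) = (\<lambda>x. \<Sum>j\<le>k. \<epsilon> ^ j * q j (\<lambda>x. f (T x)) x)" using q T f by blast
    from fun_cong[OF this, of x] have e1: "p f (T x) = (\<Sum>j\<le>k. \<epsilon> ^ j * q j (\<lambda>x. f (T x)) x)" .
    have "(\<lambda>x. p' f (T x)) = (\<lambda>x. \<Sum>j\<le>k. \<epsilon> ^ j * q' j (\<lambda>x. f (T x)) x)" using q' T f by blast
    from fun_cong[OF this, of x] have e2: "p' f (T x) = (\<Sum>j\<le>k. \<epsilon> ^ j * q' j (\<lambda>x. f (T x)) x)" .
    show "a * p f (T x) + b * p' f (T x) = (\<Sum>j\<le>k. \<epsilon> ^ j * ?Q j (\<lambda>x. f (T x)) x)"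
      unfolding e1 e2 by (simp add: sum_distrib_left sum.distrib[symmetric] algebra_simps)
  qed
  show ?case by (rule exI[of _ ?Q], rule exI[of _ "\<lambda>j. a * t j + b * t' j"]) (use 1 2 3 4 in blast)
next
  case (pdo_cong k p s p')
  then obtain q t where q: "?P k p s q t" by (elim exE) (rule that)
  show ?case by (rule exI[of _ q], rule exI[of _ t]) (use q pdo_cong.hyps in simp)
qed

definition row_vec :: "('n::finite \<Rightarrow> real^'d^'m) \<Rightarrow> 'm \<Rightarrow> 'd \<Rightarrow> real^'n" where
  "row_vec A r l = (\<chi> i. A i $ r $ l)"

lemma op_symbol_nth: "(op_symbol A w *v v) $ r = (\<Sum>l\<in>UNIV. (w \<bullet> row_vec A r l) * v $ l)"
  by (simp add: op_symbol_def row_vec_def matrix_vector_mult_def inner_vec_def sum_component sum_distrib_right)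

lemma distr_integrand_nth:
  fixes A :: "'n::finite \<Rightarrow> real^'d^'m" and \<phi> :: "real^'n \<Rightarrow> real"
  assumes "smooth \<phi>"
  shows "(\<Sum>i\<in>UNIV. partial_deriv i \<phi> x *\<^sub>R (A i *v y)) $ r = (\<Sum>l\<in>UNIV. dird (row_vec A r l) \<phi> x * y $ l)"
proof -
  have "dird (row_vec A r l) \<phi> x = (\<Sum>i\<in>UNIV. A i $ r $ l * partial_deriv i \<phi> x)" for l
  proof -
    have "row_vec A r l = (\<Sum>i\<in>UNIV. (A i $ r $ l) *\<^sub>R axis i 1)"
      by (subst basis_expansion[symmetric]) (simp add: row_vec_def scalar_mult_eq_scaleR)
    then show ?thesis using assms by (simp add: dird_lincomb_dir partial_deriv_def dird_def)
  qed
  then have "(\<Sum>l\<in>UNIV. dird (row_vec A r l) \<phi> x * y $ l) = (\<Sum>l\<in>UNIV. \<Sum>i\<in>UNIV. A i $ r $ l * partial_deriv i \<phi> x * y $ l)"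
    by (simp add: sum_distrib_right)
  also have "\<dots> = (\<Sum>i\<in>UNIV. \<Sum>l\<in>UNIV. A i $ r $ l * partial_deriv i \<phi> x * y $ l)" by (rule sum.swap)
  finally show ?thesis
    by (simp add: sum_component matrix_vector_mult_def sum_distrib_left ac_simps)
qed

lemma distr_A_freeI:
  fixes A :: "'n::finite \<Rightarrow> real^'d^'m"
  assumes "\<And>\<phi> r. smooth \<phi> \<Longrightarrow> (LINT x|lebesgue. (\<Sum>l\<in>UNIV. dird (row_vec A r l) \<phi> x * u x $ l)) = 0"
  shows "distr_A_free A u"
  unfolding distr_A_free_def
proof (intro allI impI)
  fix \<phi> :: "real^'n \<Rightarrow> real" assume "test_function \<phi>"
  then have sm: "smooth \<phi>" by (simp add: test_function_def)
  let ?F = "\<lambda>x. \<Sum>i\<in>UNIV. partial_deriv i \<phi> x *\<^sub>R (A i *v u x)"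
  show "(LINT x|lebesgue. ?F x) = 0"
  proof (cases "integrable lebesgue ?F")
    case True
    have "(LINT x|lebesgue. ?F x) $ r = 0" for r
    proof -
      have "(LINT x|lebesgue. ?F x) $ r = (LINT x|lebesgue. ?F x $ r)"
        using integral_bounded_linear[OF bounded_linear_vec_nth True, of r] by simp
      also have "\<dots> = 0" using assms[OF sm] by (simp only: distr_integrand_nth[OF sm])
      finally show ?thesis .
    qed
    then show ?thesis by (simp add: vec_eq_iff)
  qed (simp add: not_integrable_integral_eq)
qed

lemma anisotropic_fields:
  fixes A :: "'n::finite \<Rightarrow> real^'d^'m"
  assumes rank: "\<And>w. w \<noteq> 0 \<Longrightarrow> rank (op_symbol A w) = CARD('m)"
    and v: "v \<in> char_cone A"
  obtains h :: "real^'n \<Rightarrow> real" and C R \<eta> where "pw_const h" "R > 0" "\<And>x. norm x > R \<Longrightarrow> h x = 0"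
    "\<eta> > 0" "measure lborel {x. h x \<le> - \<eta>} > 0"
    "\<And>\<epsilon>. 0 < \<epsilon> \<Longrightarrow> \<epsilon> \<le> 1 \<Longrightarrow> \<exists>\<phi> L. linear L \<and> bij L \<and> pw_const \<phi> \<and> distr_A_free A \<phi> \<and>
      (\<integral>x. \<phi> x \<partial>lborel) = 0 \<and> (\<forall>x. norm (\<phi> x - h (L x) *\<^sub>R v) \<le> C * \<epsilon>) \<and> (\<forall>x. norm (L x) > R \<longrightarrow> \<phi> x = 0)"
proof -
  obtain w0 where w0: "w0 \<noteq> 0" "op_symbol A w0 *v v = 0" using v by (auto simp: char_cone_def)
  define w where "w = w0 /\<^sub>R norm w0"
  have w: "norm w = 1" "w \<noteq> 0" "w \<bullet> w = 1" using w0 by (auto simp: w_def dot_square_norm)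
  have Awv: "(\<Sum>l\<in>UNIV. (w \<bullet> row_vec A r l) * v $ l) = 0" for r
  proof -
    have "(\<Sum>l\<in>UNIV. (w0 \<bullet> row_vec A r l) * v $ l) = 0" using w0(2) op_symbol_nth[of A w0 v r] by simp
    then show ?thesis by (simp add: w_def sum_distrib_left[symmetric] mult.assoc)
  qed
  have onto: "\<exists>v::'d \<Rightarrow> real. \<forall>r'. (\<Sum>l\<in>UNIV. (w \<bullet> row_vec A r' l) * v l) = (if r' = r then 1 else 0)" for r
  proof -
    have "surj ((*v) (op_symbol A w))" using rank[OF w(2)] full_rank_surjective by blast
    then obtain z where "op_symbol A w *v z = axis r 1" by (metis surjD)
    then show ?thesis
      by (intro exI[of _ "\<lambda>l. z $ l"]) (auto simp: op_symbol_nth[symmetric] axis_def)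
  qed
  obtain k P s where E: "(UNIV \<noteq> ({} :: 'm set) \<longrightarrow> k > 0) \<and> (\<forall>l c. pdo w k (P l c) (s l c)) \<and>
    (\<forall>r\<in>UNIV. \<forall>c f. smooth f \<longrightarrow> (\<lambda>x. \<Sum>l\<in>UNIV. dird (row_vec A r l) (P l c f) x) = (\<lambda>x. 0)) \<and>
    (\<forall>v. (\<forall>r\<in>UNIV. (\<Sum>l\<in>UNIV. (w \<bullet> row_vec A r l) * v l) = 0) \<longrightarrow>
      (\<exists>y. \<forall>l::'d. (\<Sum>c\<in>(UNIV::'d set). s l c * y c) = v l))"
    using elimination[of w "row_vec A" UNIV, OF onto] by (elim exE) (rule that)
  then have k: "k > 0" and P: "pdo w k (P l c) (s l c)" for l c by simp_all
  have ann: "(\<lambda>x. \<Sum>l\<in>UNIV. dird (row_vec A r l) (P l c f) x) = (\<lambda>x. 0)" if "smooth f" for r c f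
    using E that by simp
  have ker: "\<exists>y. \<forall>l. (\<Sum>c\<in>UNIV. s l c * y c) = v l"
    if "\<forall>r. (\<Sum>l\<in>UNIV. (w \<bullet> row_vec A r l) * v l) = 0" for v
    using E that by simp
  obtain y where y: "\<And>l. (\<Sum>c\<in>UNIV. s l c * y c) = v $ l" using ker[of "\<lambda>l. v $ l"] Awv by auto
  define B where "B l = (\<lambda>f x. \<Sum>c\<in>UNIV. y c * P l c f x)" for l
  have B: "pdo w k (B l) (v $ l)" for l
  proof -
    have "pdo w k (\<lambda>f x. y c * P l c f x) (y c * s l c)" for c
      using pdo_lin[OF P[of l c] P[of l c], where a = "y c" and b = 0] by simp
    from pdo_sum[where I = UNIV and p = "\<lambda>c f x. y c * P l c f x" and s = "\<lambda>c. y c * s l c", OF _ _ this] y[of l] show ?thesis by (simp add: B_def mult.commute)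
  qed
  have Bann: "(\<lambda>x. \<Sum>l\<in>UNIV. dird (row_vec A r l) (B l f) x) = (\<lambda>x. 0)" if f: "smooth f" for r f
  proof
    fix x
    have "dird u (B l f) x = (\<Sum>c\<in>UNIV. y c * dird u (P l c f) x)" for u l
      unfolding B_def using f by (simp add: dird_sum smooth_cmult pdo_smooth[OF P] dird_cmult)
    then have "(\<Sum>l\<in>UNIV. dird (row_vec A r l) (B l f) x) = (\<Sum>c\<in>UNIV. y c * (\<Sum>l\<in>UNIV. dird (row_vec A r l) (P l c f) x))"
      by (simp add: sum_distrib_left) (rule sum.swap)
    also have "\<dots> = 0" using fun_cong[OF ann[OF f], of _ _ x] by simp
    finally show "(\<Sum>l\<in>UNIV. dird (row_vec A r l) (B l f) x) = 0" .
  qed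
  obtain Z :: "(real^'n) list" where Z: "length Z = DIM(real^'n) + k" "generic Z" using generic_exists by blast
  obtain h where h: "pw_const h" "\<And>f. smooth f \<Longrightarrow> spline Z ((dird w ^^ k) f) = (\<integral>x. h x * f x \<partial>lborel)"
    using spline_density[OF pdo_iterate Z(2,1)] by blast
  define q where "q l = (SOME q. \<exists>t. (\<forall>j. pdo w k (q j) (t j)) \<and> (\<forall>j>k. q j = (\<lambda>f x. 0)) \<and>
    (\<forall>f. smooth f \<longrightarrow> q 0 f = (\<lambda>x. v $ l * (dird w ^^ k) f x)) \<and>
    (\<forall>T \<epsilon> f. linear T \<longrightarrow> (\<forall>v. T (\<epsilon> *\<^sub>R v + ((1 - \<epsilon>) * (w \<bullet> v)) *\<^sub>R w) = v) \<longrightarrow> smooth f \<longrightarrow>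
      (\<lambda>x. B l f (T x)) = (\<lambda>x. \<Sum>j\<le>k. \<epsilon> ^ j * q j (\<lambda>x. f (T x)) x)))" for l
  have q: "\<exists>t. (\<forall>j. pdo w k (q l j) (t j)) \<and> (\<forall>j>k. q l j = (\<lambda>f x. 0)) \<and>
    (\<forall>f. smooth f \<longrightarrow> q l 0 f = (\<lambda>x. v $ l * (dird w ^^ k) f x)) \<and>
    (\<forall>T \<epsilon> f. linear T \<longrightarrow> (\<forall>v. T (\<epsilon> *\<^sub>R v + ((1 - \<epsilon>) * (w \<bullet> v)) *\<^sub>R w) = v) \<longrightarrow> smooth f \<longrightarrow>
      (\<lambda>x. B l f (T x)) = (\<lambda>x. \<Sum>j\<le>k. \<epsilon> ^ j * q l j (\<lambda>x. f (T x)) x))" for l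
    unfolding q_def by (rule someI_ex[OF pdo_stretch[OF B]])
  have dens: "\<exists>u. pw_const u \<and> (\<forall>f. smooth f \<longrightarrow> spline Z (q l j f) = (\<integral>x. u x * f x \<partial>lborel)) \<and>
      (j = 0 \<longrightarrow> u = (\<lambda>x. v $ l * h x))" for l j
  proof (cases "j = 0")
    case True
    have "spline Z (q l 0 f) = (\<integral>x. (v $ l * h x) * f x \<partial>lborel)" if f: "smooth f" for f
    proof -
      have "q l 0 f = (\<lambda>x. v $ l * (dird w ^^ k) f x)" using q[of l] f by blast
      then show ?thesis
        using h(2)[OF f] pdo_smooth[OF pdo_iterate[of w k w] f] by (simp add: spline_cmult mult.assoc)
    qed
    then show ?thesis using True h(1) by (intro exI[of _ "\<lambda>x. v $ l * h x"]) (simp add: pw_const_cmult)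
  next
    case False
    obtain t where "\<forall>j. pdo w k (q l j) (t j)" using q[of l] by blast
    then show ?thesis using spline_density[OF _ Z(2,1), of w "q l j"] False by blast
  qed
  then obtain u where u: "\<And>l j. pw_const (u l j)" "\<And>l. u l 0 = (\<lambda>x. v $ l * h x)"
    "\<And>l j f. smooth f \<Longrightarrow> spline Z (q l j f) = (\<integral>x. u l j x * f x \<partial>lborel)"
    by metis
  obtain R0 where R0: "\<And>l j x. j \<le> k \<Longrightarrow> norm x > R0 \<Longrightarrow> u l j x = 0"
  proof -
    have "\<forall>l j. \<exists>R. \<forall>x. norm x > R \<longrightarrow> u l j x = 0" using u(1) by (auto simp: pw_const_def)
    then obtain \<rho> where \<rho>: "\<And>l j x. norm x > \<rho> l j \<Longrightarrow> u l j x = 0" by metis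
    let ?F = "(\<lambda>(l, j). \<rho> l j) ` (UNIV \<times> {..k})"
    show ?thesis
    proof (rule that[of "Max ?F"])
      fix l :: 'd and j :: nat and x :: "real^'n" assume "j \<le> k" "norm x > Max ?F"
      moreover have "\<rho> l j \<le> Max ?F" using \<open>j \<le> k\<close> by (intro Max_ge) auto
      ultimately show "u l j x = 0" by (intro \<rho>) simp
    qed
  qed
  obtain R1 where R1: "\<And>x. norm x > R1 \<Longrightarrow> h x = 0" using h(1) by (auto simp: pw_const_def)
  define R where "R = max 1 (max R0 R1)"
  obtain b where b: "\<And>l j x. \<bar>u l j x\<bar> \<le> b l j"
  proof -
    have "\<forall>l j. \<exists>b. \<forall>x. \<bar>u l j x\<bar> \<le> b" using u(1) by (auto simp: pw_const_def L_piec_def bounded_iff)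
    then show ?thesis using that by metis
  qed
  define C where "C = (\<Sum>l\<in>UNIV. \<Sum>j\<in>{1..k}. b l j)"
  have mean: "(\<integral>x. h x \<partial>lborel) = 0"
  proof -
    have "(dird w ^^ k) (\<lambda>x. 1) = (\<lambda>x. 0)" using pdo_const[OF pdo_iterate k] .
    then show ?thesis using h(2)[OF smooth_const[of 1]] by (simp add: spline_zero)
  qed
  have "\<exists>\<eta>>0. measure lborel {x. h x \<le> - \<eta>} > 0"
  proof (rule ccontr)
    assume "\<not> ?thesis"
    then have m0: "measure lborel {x. h x \<le> - \<eta>} = 0" if "\<eta> > 0" for \<eta>
      using that measure_nonneg[of lborel "{x. h x \<le> - \<eta>}"] by (metis less_eq_real_def)
    have hm[measurable]: "h \<in> borel_measurable borel" using h(1) by (simp add: pw_const_def)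
    have ih: "integrable lborel h" using pw_const_integrable[OF h(1), of "\<lambda>x. 1"] by simp
    have "AE x in lborel. h x > - \<eta>" if "\<eta> > 0" for \<eta>
    proof -
      have "{x. h x \<le> - \<eta>} \<subseteq> cball 0 R1"
      proof
        fix x assume "x \<in> {x. h x \<le> - \<eta>}"
        then have "h x \<noteq> 0" using that by auto
        then have "\<not> norm x > R1" using R1 by blast
        then show "x \<in> cball 0 R1" by simp
      qed
      then have "emeasure lborel {x. h x \<le> - \<eta>} < \<infinity>"
        by (intro emeasure_bounded_finite bounded_subset[OF bounded_cball])
      then have "emeasure lborel {x. h x \<le> - \<eta>} = 0"
        using m0[OF that] by (auto simp: measure_def enn2real_eq_0_iff)
      moreover have "{x \<in> space lborel. \<not> h x > - \<eta>} = {x. h x \<le> - \<eta>}" by auto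
      ultimately show ?thesis by (intro AE_I'[of "{x. h x \<le> - \<eta>}"]) (auto simp: null_sets_def not_less)
    qed
    then have "AE x in lborel. \<forall>n. h x > - (1 / real (Suc n))" by (simp add: AE_all_countable)
    then have pos: "AE x in lborel. h x \<ge> 0"
    proof (rule AE_mp, intro AE_I2 impI)
      fix x assume *: "\<forall>n. h x > - (1 / real (Suc n))"
      show "h x \<ge> 0"
      proof (rule ccontr)
        assume "\<not> h x \<ge> 0"
        then obtain n where "1 / real (Suc n) < - h x" using nat_approx_posE[of "- h x"] by auto
        then show False using *[rule_format, of n] by simp
      qed
    qed
    have "AE x in lborel. h x = 0" using integral_nonneg_eq_0_iff_AE[OF ih pos] mean by simp
    then have "AE x in lborel. h x * exp (w \<bullet> x) = 0" by (rule AE_mp) (rule AE_I2, simp)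
    then have "(\<integral>x. h x * exp (w \<bullet> x) \<partial>lborel) = 0" by (rule integral_eq_zero_AE)
    moreover have "(dird w ^^ k) (\<lambda>x. exp (w \<bullet> x)) = (\<lambda>x. exp (w \<bullet> x))"
      using pdo_exp[OF pdo_iterate[of w k w]] w(3) by simp
    then have "spline Z (\<lambda>x. exp (w \<bullet> x)) = (\<integral>x. h x * exp (w \<bullet> x) \<partial>lborel)"
      using h(2)[OF smooth_exp[of w]] by simp
    ultimately show False using spline_pos[OF smooth_exp[of w], of Z] by simp
  qed
  then obtain \<eta> where \<eta>: "\<eta> > 0" "measure lborel {x. h x \<le> - \<eta>} > 0" by blast
  have main: "\<exists>\<phi> L. linear L \<and> bij L \<and> pw_const \<phi> \<and> distr_A_free A \<phi> \<and>
      (\<integral>x. \<phi> x \<partial>lborel) = 0 \<and> (\<forall>x. norm (\<phi> x - h (L x) *\<^sub>R v) \<le> C * \<epsilon>) \<and> (\<forall>x. norm (L x) > R \<longrightarrow> \<phi> x = 0)"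
    if \<epsilon>: "0 < \<epsilon>" "\<epsilon> \<le> 1" for \<epsilon>
  proof -
    define L where "L x = \<epsilon> *\<^sub>R x + ((1 - \<epsilon>) * (w \<bullet> x)) *\<^sub>R w" for x
    define T where "T x = (1 / \<epsilon>) *\<^sub>R x + ((1 - 1 / \<epsilon>) * (w \<bullet> x)) *\<^sub>R w" for x
    have lin: "linear L" "linear T"
      unfolding L_def T_def by (auto simp: linear_iff inner_add_right algebra_simps add_divide_distrib)
    have TL: "T (L x) = x" "L (T x) = x" for x
    proof -
      have c: "(1 / \<epsilon>) * ((1 - \<epsilon>) * a) + (1 - 1 / \<epsilon>) * a = 0"
        "\<epsilon> * ((1 - 1 / \<epsilon>) * a) + (1 - \<epsilon>) * a = 0" for a
        using \<epsilon>(1) by (simp_all add: field_simps)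
      have "w \<bullet> L x = w \<bullet> x" "w \<bullet> T x = w \<bullet> x"
        using w(3) by (simp_all add: L_def T_def inner_add_right algebra_simps)
      then have "T (L x) = (1 / \<epsilon>) *\<^sub>R (\<epsilon> *\<^sub>R x) + ((1 / \<epsilon>) * ((1 - \<epsilon>) * (w \<bullet> x)) + (1 - 1 / \<epsilon>) * (w \<bullet> x)) *\<^sub>R w"
        "L (T x) = \<epsilon> *\<^sub>R ((1 / \<epsilon>) *\<^sub>R x) + (\<epsilon> * ((1 - 1 / \<epsilon>) * (w \<bullet> x)) + (1 - \<epsilon>) * (w \<bullet> x)) *\<^sub>R w"
        by (simp_all add: T_def[of "L x"] L_def[of "T x"]) (simp_all add: L_def T_def scaleR_add_right scaleR_add_left)
      then show "T (L x) = x" "L (T x) = x" unfolding c using \<epsilon>(1) by simp_all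
    qed
    have bij: "bij L" using TL by (intro o_bij[of T]) (auto simp: fun_eq_iff)
    obtain c where c: "\<And>g :: real^'n \<Rightarrow> real. g \<in> borel_measurable borel \<Longrightarrow> (\<integral>x. g (L x) \<partial>lborel) = c * (\<integral>x. g x \<partial>lborel)"
      using lborel_linear_substitution[OF lin(1) bij] by blast
    define \<psi> where "\<psi> l x = (\<Sum>j\<le>k. \<epsilon> ^ j * u l j x)" for l x
    have \<psi>: "pw_const (\<psi> l)" for l
      unfolding \<psi>_def using u(1) by (intro pw_const_sum pw_const_cmult)
    have \<psi>L: "pw_const (\<lambda>x. \<psi> l (L x))" for l
      using pw_const_affine[OF \<psi> lin(1) bij, of _ 0] by simp
    define \<phi> where "\<phi> x = (\<chi> l. \<psi> l (L x))" for x
    have \<phi>: "pw_const \<phi>"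
    proof -
      have "\<phi> = (\<lambda>x. \<Sum>l\<in>UNIV. \<psi> l (L x) *\<^sub>R axis l 1)"
        unfolding \<phi>_def by (subst basis_expansion[symmetric]) (simp add: scalar_mult_eq_scaleR)
      then show ?thesis
        using pw_const_map[OF \<psi>L bounded_linear_scaleR_left] by (auto intro!: pw_const_sum)
    qed
    have key: "(\<integral>x. f x * \<phi> x $ l \<partial>lborel) = c * spline Z (\<lambda>x. B l f (T x))" if f: "smooth f" for f l
    proof -
      let ?g = "\<lambda>x. f (T x)"
      have g: "smooth ?g" using smooth_affine[OF f lin(2), of 0] by simp
      have gc: "continuous_on UNIV ?g" using g by (rule smooth_continuous_on)
      obtain t where t: "\<forall>j. pdo w k (q l j) (t j)" using q[of l] by blast
      have "(\<integral>x. f x * \<phi> x $ l \<partial>lborel) = (\<integral>x. ?g (L x) * \<psi> l (L x) \<partial>lborel)"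
        by (simp add: TL \<phi>_def)
      also have "\<dots> = c * (\<integral>x. ?g x * \<psi> l x \<partial>lborel)"
        using \<psi>[of l] borel_measurable_continuous_onI[OF gc] by (intro c) (auto simp: pw_const_def)
      also have "(\<integral>x. ?g x * \<psi> l x \<partial>lborel) = (\<integral>x. (\<Sum>j\<le>k. \<epsilon> ^ j * (u l j x * ?g x)) \<partial>lborel)"
        by (simp add: \<psi>_def sum_distrib_left ac_simps)
      also have "\<dots> = (\<Sum>j\<le>k. \<epsilon> ^ j * (\<integral>x. u l j x * ?g x \<partial>lborel))"
        using pw_const_integrable[OF u(1) gc] by simp
      also have "\<dots> = spline Z (\<lambda>x. \<Sum>j\<le>k. \<epsilon> ^ j * q l j ?g x)"
      proof -
        have "smooth (q l j ?g)" for j using pdo_smooth[OF t[rule_format] g] .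
        then show ?thesis by (simp add: spline_sum spline_cmult smooth_cmult u(3)[OF g])
      qed
      also have "(\<lambda>x. \<Sum>j\<le>k. \<epsilon> ^ j * q l j ?g x) = (\<lambda>x. B l f (T x))"
      proof -
        have st: "\<forall>T \<epsilon> f. linear T \<longrightarrow> (\<forall>v. T (\<epsilon> *\<^sub>R v + ((1 - \<epsilon>) * (w \<bullet> v)) *\<^sub>R w) = v) \<longrightarrow> smooth f \<longrightarrow>
          (\<lambda>x. B l f (T x)) = (\<lambda>x. \<Sum>j\<le>k. \<epsilon> ^ j * q l j (\<lambda>x. f (T x)) x)"
          using q[of l] by (elim exE conjE)
        show ?thesis
          by (rule sym, rule st[rule_format, OF lin(2) _ f]) (use TL(1) in \<open>simp add: L_def\<close>)
      qed
      finally show ?thesis .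
    qed
    have \<phi>int: "integrable lborel (\<lambda>x. f x * \<phi> x $ l)" if "smooth f" for f l
      using pw_const_integrable[OF \<psi>L smooth_continuous_on[OF that]] by (simp add: \<phi>_def mult.commute)
    have "distr_A_free A \<phi>"
    proof (rule distr_A_freeI)
      fix f :: "real^'n \<Rightarrow> real" and r assume f: "smooth f"
      have i: "integrable lborel (\<lambda>x. dird (row_vec A r l) f x * \<phi> x $ l)" for l
        using f by (intro \<phi>int smooth_dird)
      have "(LINT x|lebesgue. (\<Sum>l\<in>UNIV. dird (row_vec A r l) f x * \<phi> x $ l)) =
          (\<integral>x. (\<Sum>l\<in>UNIV. dird (row_vec A r l) f x * \<phi> x $ l) \<partial>lborel)"
        using i by (intro integral_completion borel_measurable_sum) auto
      also have "\<dots> = (\<Sum>l\<in>UNIV. c * spline Z (\<lambda>x. B l (dird (row_vec A r l) f) (T x)))"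
        using i f by (simp add: key smooth_dird)
      also have "\<dots> = (\<Sum>l\<in>UNIV. c * spline Z (\<lambda>x. dird (row_vec A r l) (B l f) (T x)))"
        using f by (simp add: pdo_dird_commute[OF B])
      also have "\<dots> = c * spline Z (\<lambda>x. \<Sum>l\<in>UNIV. dird (row_vec A r l) (B l f) (T x))"
      proof -
        have "smooth (\<lambda>x. dird (row_vec A r l) (B l f) (T x))" for l
          using smooth_affine[OF smooth_dird[OF pdo_smooth[OF B f]] lin(2), of _ _ 0] by simp
        then show ?thesis by (simp add: spline_sum sum_distrib_left)
      qed
      also have "\<dots> = 0"
        using fun_cong[OF Bann[OF f]] by (simp add: spline_zero)
      finally show "(LINT x|lebesgue. (\<Sum>l\<in>UNIV. dird (row_vec A r l) f x * \<phi> x $ l)) = 0" .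
    qed
    moreover have "(\<integral>x. \<phi> x \<partial>lborel) = 0"
    proof (cases "integrable lborel \<phi>")
      case True
      have "(\<integral>x. \<phi> x \<partial>lborel) $ l = 0" for l
      proof -
        have "(\<integral>x. \<phi> x \<partial>lborel) $ l = (\<integral>x. \<phi> x $ l \<partial>lborel)"
          using integral_bounded_linear[OF bounded_linear_vec_nth True, of l] by simp
        also have "\<dots> = 0"
          using key[OF smooth_const[of 1], of l] pdo_const[OF B k] by (simp add: spline_zero)
        finally show ?thesis .
      qed
      then show ?thesis by (simp add: vec_eq_iff)
    qed (simp add: not_integrable_integral_eq)
    moreover have "norm (\<phi> x - h (L x) *\<^sub>R v) \<le> C * \<epsilon>" for x
    proof -
      have "norm (\<phi> x - h (L x) *\<^sub>R v) \<le> (\<Sum>l\<in>UNIV. \<bar>(\<phi> x - h (L x) *\<^sub>R v) $ l\<bar>)" by (rule norm_le_l1_cart)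
      also have "\<dots> \<le> (\<Sum>l\<in>UNIV. \<Sum>j\<in>{1..k}. b l j * \<epsilon>)"
      proof (rule sum_mono)
        fix l
        have "{..k} = insert 0 {1..k}" by auto
        then have "\<psi> l (L x) = v $ l * h (L x) + (\<Sum>j\<in>{1..k}. \<epsilon> ^ j * u l j (L x))"
          by (simp add: \<psi>_def u(2))
        then have "\<bar>(\<phi> x - h (L x) *\<^sub>R v) $ l\<bar> = \<bar>\<Sum>j\<in>{1..k}. \<epsilon> ^ j * u l j (L x)\<bar>"
          by (simp add: \<phi>_def mult.commute)
        also have "\<dots> \<le> (\<Sum>j\<in>{1..k}. \<bar>\<epsilon> ^ j * u l j (L x)\<bar>)" by (rule sum_abs)
        also have "\<dots> \<le> (\<Sum>j\<in>{1..k}. b l j * \<epsilon>)"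
        proof (rule sum_mono)
          fix j assume j: "j \<in> {1..k}"
          have "\<epsilon> ^ j \<le> \<epsilon> ^ 1" using j \<epsilon> by (intro power_decreasing) auto
          then have "\<epsilon> ^ j * \<bar>u l j (L x)\<bar> \<le> \<epsilon> * b l j"
            using b[of l j "L x"] \<epsilon> by (intro mult_mono) auto
          then show "\<bar>\<epsilon> ^ j * u l j (L x)\<bar> \<le> b l j * \<epsilon>" using \<epsilon> by (simp add: abs_mult mult.commute)
        qed
        finally show "\<bar>(\<phi> x - h (L x) *\<^sub>R v) $ l\<bar> \<le> (\<Sum>j\<in>{1..k}. b l j * \<epsilon>)" .
      qed
      also have "\<dots> = C * \<epsilon>" by (simp add: C_def sum_distrib_right)
      finally show ?thesis .
    qed
    moreover have "\<phi> x = 0" if "norm (L x) > R" for x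
    proof -
      have "u l j (L x) = 0" if "j \<le> k" for l j using that \<open>norm (L x) > R\<close> by (intro R0) (auto simp: R_def)
      then show ?thesis by (simp add: \<phi>_def \<psi>_def vec_eq_iff)
    qed
    ultimately show ?thesis using lin(1) bij \<phi> by blast
  qed
  show ?thesis
    by (rule that[OF h(1), of R \<eta> C]) (use R1 \<eta> main in \<open>auto simp: R_def\<close>)
qed

subsection \<open>Test functions\<close>

lemma dird_eq_0_outside:
  assumes "smooth f" "x \<notin> closure {x. f x \<noteq> 0}"
  shows "dird v f x = 0"
proof -
  have "(f has_derivative (\<lambda>v. 0)) (at x)"
  proof (rule has_derivative_transform_within_open[of "\<lambda>x. 0"])
    show "open (- closure {x. f x \<noteq> 0})" by auto
    show "x \<in> - closure {x. f x \<noteq> 0}" using assms by simp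
    fix y assume "y \<in> - closure {x. f x \<noteq> 0}"
    then show "0 = f y" using closure_subset[of "{x. f x \<noteq> 0}"] by auto
  qed simp
  then show ?thesis by (rule dird_eq)
qed

lemma partial_deriv_dird: "partial_deriv i \<phi> = dird (axis i 1) \<phi>"
  by (simp add: partial_deriv_def[abs_def] dird_def[abs_def])

lemma integrable_cont_compact_support:
  fixes g :: "'a::euclidean_space \<Rightarrow> real" and u :: "'a \<Rightarrow> 'b::euclidean_space" and h :: "'b \<Rightarrow> 'c::euclidean_space"
  assumes g: "continuous_on UNIV g" "compact S" "\<And>x. x \<notin> S \<Longrightarrow> g x = 0"
    and u: "u \<in> L_infty" and h: "bounded_linear h"
  shows "integrable lebesgue (\<lambda>x. g x *\<^sub>R h (u x))"
proof -
  obtain C where C: "AE x in lebesgue. norm (u x) \<le> C" and um: "u \<in> borel_measurable lebesgue"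
    using u by (auto simp: L_infty_def)
  have "compact (g ` S)" using g by (intro compact_continuous_image) (auto intro: continuous_on_subset)
  then obtain B where B: "\<And>x. x \<in> S \<Longrightarrow> \<bar>g x\<bar> \<le> B"
    using compact_imp_bounded bounded_iff by (metis imageI real_norm_def)
  obtain K where K: "K > 0" "\<And>x. norm (h x) \<le> norm x * K" using bounded_linear.pos_bounded[OF h] by blast
  have hm: "(\<lambda>x. h (u x)) \<in> borel_measurable lebesgue"
    using um linear_continuous_on[OF h, of UNIV] by (intro borel_measurable_continuous_on[of h]) auto
  show ?thesis
  proof (rule integrableI_bounded_set[where A = S and B = "B * (C * K)"])
    show "S \<in> sets lebesgue" using g(2) by (simp add: compact_imp_closed borel_closed)
    show "(\<lambda>x. g x *\<^sub>R h (u x)) \<in> borel_measurable lebesgue"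
    proof (rule borel_measurable_scaleR[OF _ hm])
      show "g \<in> borel_measurable lebesgue"
        using borel_measurable_continuous_onI[OF g(1)] by (intro measurable_completion) simp
    qed
    show "emeasure lebesgue S < \<infinity>"
      using emeasure_compact_finite[OF g(2)] g(2) by (simp add: compact_imp_closed borel_closed)
    show "AE x in lebesgue. x \<in> S \<longrightarrow> norm (g x *\<^sub>R h (u x)) \<le> B * (C * K)"
      using C
    proof (rule AE_mp, intro AE_I2 impI)
      fix x assume x: "norm (u x) \<le> C" "x \<in> S"
      have "norm (h (u x)) \<le> C * K" using K(2)[of "u x"] x K(1) by (meson mult_right_mono less_imp_le order_trans)
      then show "norm (g x *\<^sub>R h (u x)) \<le> B * (C * K)"
        using B[OF x(2)] order_trans[OF abs_ge_zero B[OF x(2)]] by (auto intro!: mult_mono)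
    qed
    show "AE x in lebesgue. x \<notin> S \<longrightarrow> g x *\<^sub>R h (u x) = 0" using g(3) by auto
  qed
qed

lemma test_integrable:
  fixes A :: "'n::finite \<Rightarrow> real^'d^'m"
  assumes "test_function \<phi>" "u \<in> L_infty"
  shows "integrable lebesgue (\<lambda>x. \<Sum>i\<in>UNIV. partial_deriv i \<phi> x *\<^sub>R (A i *v u x))"
proof (rule Bochner_Integration.integrable_sum)
  fix i
  have s: "smooth \<phi>" and c: "compact (closure {x. \<phi> x \<noteq> 0})" using assms(1) by (auto simp: test_function_def)
  show "integrable lebesgue (\<lambda>x. partial_deriv i \<phi> x *\<^sub>R (A i *v u x))"
    unfolding partial_deriv_dird
    by (rule integrable_cont_compact_support[OF _ c _ assms(2) matrix_vector_mul_bounded_linear])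
      (use s in \<open>auto intro!: smooth_continuous_on smooth_dird dird_eq_0_outside\<close>)
qed

lemma distr_A_free_add:
  assumes "distr_A_free A u" "distr_A_free A v" "u \<in> L_infty" "v \<in> L_infty"
  shows "distr_A_free A (\<lambda>x. u x + v x)"
  unfolding distr_A_free_def
proof (intro allI impI)
  fix \<phi> :: "real^'a \<Rightarrow> real" assume t: "test_function \<phi>"
  have "(\<Sum>i\<in>UNIV. partial_deriv i \<phi> x *\<^sub>R (A i *v (u x + v x))) =
      (\<Sum>i\<in>UNIV. partial_deriv i \<phi> x *\<^sub>R (A i *v u x)) + (\<Sum>i\<in>UNIV. partial_deriv i \<phi> x *\<^sub>R (A i *v v x))" for x
    by (simp add: matrix_vector_right_distrib scaleR_add_right sum.distrib)
  then show "(LINT x|lebesgue. (\<Sum>i\<in>UNIV. partial_deriv i \<phi> x *\<^sub>R (A i *v (u x + v x)))) = 0"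
    using assms(1,2) t test_integrable[OF t assms(3), of A] test_integrable[OF t assms(4), of A]
    by (simp add: distr_A_free_def)
qed

lemma distr_A_free_zero: "distr_A_free A (\<lambda>x. 0)"
  by (simp add: distr_A_free_def)

lemma distr_A_free_sum:
  assumes "\<And>i. i \<in> I \<Longrightarrow> distr_A_free A (f i) \<and> f i \<in> L_piec"
  shows "distr_A_free A (\<lambda>x. \<Sum>i\<in>I. f i x)"
  using assms
proof (induction I rule: infinite_finite_induct)
  case (insert i I)
  have "(\<lambda>x. \<Sum>i\<in>I. f i x) \<in> L_piec" using insert.prems by (intro L_piec_sum) auto
  then show ?case
    using insert L_piec_subset_L_infty distr_A_free_add[of A "f i" "\<lambda>x. \<Sum>i\<in>I. f i x"] by auto
qed (simp_all add: distr_A_free_zero)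

subsection \<open>Cells\<close>

definition cell_field :: "('n::finite \<Rightarrow> real^'d^'m) \<Rightarrow> (real^'n \<Rightarrow> real^'d) \<Rightarrow> bool" where
  "cell_field A \<phi> \<longleftrightarrow> pw_const \<phi> \<and> distr_A_free A \<phi> \<and> (\<integral>x. \<phi> x \<partial>lborel) = 0 \<and> (\<forall>x. norm x > 1 \<longrightarrow> \<phi> x = 0)"

definition place :: "'a::real_vector \<Rightarrow> real \<Rightarrow> ('a \<Rightarrow> 'b) \<Rightarrow> 'a \<Rightarrow> 'b" where
  "place x r \<phi> y = \<phi> ((1 / r) *\<^sub>R (y - x))"

lemma place_affine: "place x r \<phi> = (\<lambda>y. \<phi> ((1 / r) *\<^sub>R y + (- (1 / r) *\<^sub>R x)))"
  by (simp add: place_def[abs_def] algebra_simps)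

lemma scale_linear_bij: "c \<noteq> 0 \<Longrightarrow> linear (\<lambda>x::'a::euclidean_space. c *\<^sub>R x) \<and> bij (\<lambda>x::'a. c *\<^sub>R x)"
  by (auto simp: linear_iff algebra_simps intro!: o_bij[of "\<lambda>x. (1 / c) *\<^sub>R x"])

lemma pw_const_place: "pw_const \<phi> \<Longrightarrow> r > 0 \<Longrightarrow> pw_const (place x r \<phi>)"
  unfolding place_affine using scale_linear_bij[of "1 / r"] by (intro pw_const_affine) auto

lemma integral_place:
  fixes g :: "'a::euclidean_space \<Rightarrow> 'b::euclidean_space"
  assumes "g \<in> borel_measurable borel" "r > 0"
  shows "(\<integral>y. place x r g y \<partial>lborel) = r ^ DIM('a) *\<^sub>R (\<integral>z. g z \<partial>lborel)"
proof -
  have [measurable]: "place x r g \<in> borel_measurable borel"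
    unfolding place_affine using assms(1) by measurable
  have "(\<integral>y. place x r g y \<partial>lborel) = (\<integral>y. place x r g y \<partial>density (distr lborel borel (\<lambda>z. x + r *\<^sub>R z)) (\<lambda>_. ennreal (\<bar>r\<bar> ^ DIM('a))))"
    using lborel_affine[of r x] assms(2) by (simp add: ennreal_power)
  also have "\<dots> = r ^ DIM('a) *\<^sub>R (\<integral>y. place x r g y \<partial>distr lborel borel (\<lambda>z. x + r *\<^sub>R z))"
    using assms by (subst integral_density) auto
  also have "(\<integral>y. place x r g y \<partial>distr lborel borel (\<lambda>z. x + r *\<^sub>R z)) = (\<integral>z. place x r g (x + r *\<^sub>R z) \<partial>lborel)"
    by (subst integral_distr) auto
  also have "\<dots> = (\<integral>z. g z \<partial>lborel)" using assms(2) by (simp add: place_def)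
  finally show ?thesis .
qed

lemma place_zero: "(\<And>z. norm z > 1 \<Longrightarrow> \<phi> z = 0) \<Longrightarrow> r > 0 \<Longrightarrow> y \<notin> cball x r \<Longrightarrow> place x r \<phi> y = 0"
proof -
  assume *: "\<And>z. norm z > 1 \<Longrightarrow> \<phi> z = 0" "r > 0" "y \<notin> cball x r"
  have "norm ((1 / r) *\<^sub>R (y - x)) = norm (y - x) / r" using *(2) by simp
  also have "\<dots> > 1" using *(2,3) by (simp add: dist_norm norm_minus_commute)
  finally show ?thesis using *(1) by (simp add: place_def)
qed

lemma distr_A_free_place:
  fixes A :: "'n::finite \<Rightarrow> real^'d^'m"
  assumes \<phi>: "distr_A_free A \<phi>" "\<phi> \<in> borel_measurable borel" and r: "r > 0"
  shows "distr_A_free A (place x r \<phi>)"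
  unfolding distr_A_free_def
proof (intro allI impI)
  fix f :: "real^'n \<Rightarrow> real" assume t: "test_function f"
  then have f: "smooth f" "bounded {x. f x \<noteq> 0}" by (auto simp: test_function_def)
  define g where "g z = f (r *\<^sub>R z + x)" for z
  have lin: "linear (\<lambda>z::real^'n. r *\<^sub>R z)" using scale_linear_bij[of r] r by auto
  have g: "smooth g" unfolding g_def by (rule smooth_affine[OF f(1) lin])
  have dg: "partial_deriv i g z = r * partial_deriv i f (r *\<^sub>R z + x)" for i z
    unfolding partial_deriv_dird g_def by (simp add: dird_affine[OF f(1) lin] dird_scale_dir[OF f(1)])
  have tg: "test_function g"
  proof -
    have "{z. g z \<noteq> 0} = (\<lambda>y. (1 / r) *\<^sub>R (y - x)) ` {y. f y \<noteq> 0}"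
    proof (intro set_eqI iffI)
      fix z assume "z \<in> {z. g z \<noteq> 0}"
      then show "z \<in> (\<lambda>y. (1 / r) *\<^sub>R (y - x)) ` {y. f y \<noteq> 0}"
        using r by (intro image_eqI[of _ _ "r *\<^sub>R z + x"]) (auto simp: g_def)
    qed (use r in \<open>auto simp: g_def\<close>)
    also have "bounded \<dots>"
      using bounded_scaling[OF bounded_translation_minus[OF f(2), of x], of "1 / r"] by (simp add: image_image)
    finally show ?thesis using g by (simp add: test_function_def)
  qed
  let ?G = "\<lambda>z. \<Sum>i\<in>UNIV. partial_deriv i f (r *\<^sub>R z + x) *\<^sub>R (A i *v \<phi> z)"
  have [measurable]: "partial_deriv i f \<in> borel_measurable borel" for i
    unfolding partial_deriv_dird using f(1) by (intro borel_measurable_continuous_onI smooth_continuous_on smooth_dird)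
  have Am: "(\<lambda>z. A i *v \<phi> z) \<in> borel_measurable borel" for i
    using \<phi>(2) by (intro borel_measurable_continuous_on[of "(*v) (A i)"] linear_continuous_on matrix_vector_mul_bounded_linear) auto
  have Gm: "?G \<in> borel_measurable borel"
    using Am by measurable
  have "(LINT z|lebesgue. (\<Sum>i\<in>UNIV. partial_deriv i g z *\<^sub>R (A i *v \<phi> z))) = 0"
    using \<phi>(1) tg by (simp add: distr_A_free_def)
  then have "r *\<^sub>R (LINT z|lebesgue. ?G z) = 0"
    by (simp add: dg scaleR_sum_right[symmetric] flip: scaleR_scaleR)
  then have G0: "(\<integral>z. ?G z \<partial>lborel) = 0"
    using r Gm by (simp add: integral_completion)
  have eq: "(\<Sum>i\<in>UNIV. partial_deriv i f y *\<^sub>R (A i *v place x r \<phi> y)) = place x r ?G y" for y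
    using r by (simp add: place_def)
  have "place x r ?G \<in> borel_measurable borel" unfolding place_affine using Gm by measurable
  then have "(LINT y|lebesgue. place x r ?G y) = (\<integral>y. place x r ?G y \<partial>lborel)"
    by (simp add: integral_completion)
  also have "\<dots> = 0" using integral_place[OF Gm r] G0 by simp
  finally show "(LINT y|lebesgue. (\<Sum>i\<in>UNIV. partial_deriv i f y *\<^sub>R (A i *v place x r \<phi> y))) = 0"
    unfolding eq .
qed

lemma vitali_finite:
  fixes \<U> :: "'a::euclidean_space set set"
  assumes U: "\<And>U. U \<in> \<U> \<Longrightarrow> open U" and b: "bounded (\<Union>\<U>)" and pos: "\<epsilon> > 0" "\<rho> > 0"
  obtains F :: "('a \<times> real) set" where "finite F"
    "\<And>x r. (x, r) \<in> F \<Longrightarrow> 0 < r \<and> r < \<rho> \<and> (\<exists>U\<in>\<U>. cball x r \<subseteq> U)"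
    "disjoint_family_on (\<lambda>(x, r). cball x r) F"
    "measure lebesgue (\<Union>\<U> - (\<Union>(x, r)\<in>F. cball x r)) < \<epsilon>"
proof -
  let ?K = "{(x, r). 0 < r \<and> r < \<rho> \<and> (\<exists>U\<in>\<U>. cball x r \<subseteq> U)}" and ?S = "\<Union>\<U>"
  obtain C where C: "countable C" "C \<subseteq> ?K"
    "pairwise (\<lambda>i j. disjnt (cball (fst i) (snd i)) (cball (fst j) (snd j))) C"
    "negligible (?S - (\<Union>i\<in>C. cball (fst i) (snd i)))"
  proof (rule Vitali_covering_theorem_cballs[of ?K snd ?S fst])
    fix x :: 'a and d :: real assume "x \<in> ?S" "0 < d"
    then obtain U where "U \<in> \<U>" "x \<in> U" by blast
    then obtain e where e: "e > 0" "cball x e \<subseteq> U" using U open_contains_cball by blast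
    define r where "r = min (e / 2) (min (d / 2) (\<rho> / 2))"
    have "0 < r" "r < \<rho>" "r < d" "r \<le> e" using e \<open>0 < d\<close> pos by (auto simp: r_def)
    moreover have "cball x r \<subseteq> U" using e(2) \<open>r \<le> e\<close> by auto
    ultimately show "\<exists>i. i \<in> ?K \<and> x \<in> cball (fst i) (snd i) \<and> snd i < d"
      using \<open>U \<in> \<U>\<close> by (intro exI[of _ "(x, r)"]) auto
  next
    fix i assume "i \<in> ?K"
    then show "0 < snd i" by auto
  next
    fix C assume "countable C" "C \<subseteq> ?K"
      "pairwise (\<lambda>i j. disjnt (cball (fst i) (snd i)) (cball (fst j) (snd j))) C"
      "negligible (?S - (\<Union>i\<in>C. cball (fst i) (snd i)))"
    then show thesis by (rule that)
  qed
  have dis: "disjoint_family_on (\<lambda>(x, r). cball x r) C"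
    using C(3) by (fastforce simp: disjoint_family_on_def pairwise_def disjnt_def case_prod_beta)
  have opS: "open ?S" using U by auto
  have finS: "emeasure lebesgue ?S < \<infinity>"
    using emeasure_bounded_finite[OF b] opS by (simp add: borel_open)
  have "\<exists>F. finite F \<and> F \<subseteq> C \<and> measure lebesgue (?S - (\<Union>(x, r)\<in>F. cball x r)) < \<epsilon>"
  proof (cases "C = {}")
    case True
    then have "measure lebesgue ?S = 0" using C(4) by (simp add: negligible_imp_measure0)
    then show ?thesis using True pos by (intro exI[of _ "{}"]) simp
  next
    case False
    define c where "c = from_nat_into C"
    have cC: "range c = C" unfolding c_def using range_from_nat_into[OF False C(1)] .
    define D where "D n = ?S - (\<Union>i<n. cball (fst (c i)) (snd (c i)))" for n
    have Dm: "D n \<in> sets lebesgue" for n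
      unfolding D_def using opS by (intro sets.Diff sets.finite_UN) (auto simp: borel_open)
    have "(\<lambda>n. measure lebesgue (D n)) \<longlonglongrightarrow> measure lebesgue (\<Inter>n. D n)"
    proof (rule Lim_measure_decseq)
      show "range D \<subseteq> sets lebesgue" using Dm by auto
      show "decseq D" unfolding D_def decseq_def by (fastforce intro: less_le_trans)
      fix n
      have "emeasure lebesgue (D n) \<le> emeasure lebesgue ?S"
        using opS by (intro emeasure_mono) (auto simp: D_def borel_open)
      then show "emeasure lebesgue (D n) \<noteq> \<infinity>" using finS by (auto simp: top_unique)
    qed
    moreover have "(\<Inter>n. D n) = ?S - (\<Union>i\<in>C. cball (fst i) (snd i))"
      unfolding cC[symmetric] D_def by (auto intro: lessI)
    then have "measure lebesgue (\<Inter>n. D n) = 0" using C(4) by (simp add: negligible_imp_measure0)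
    ultimately have "(\<lambda>n. measure lebesgue (D n)) \<longlonglongrightarrow> 0" by simp
    then have "eventually (\<lambda>n. measure lebesgue (D n) < \<epsilon>) sequentially"
      using pos by (intro order_tendstoD) auto
    then obtain n where "measure lebesgue (D n) < \<epsilon>" by (auto simp: eventually_sequentially)
    moreover have "D n = ?S - (\<Union>(x, r)\<in>c ` {..<n}. cball x r)" by (auto simp: D_def case_prod_beta)
    ultimately show ?thesis using cC by (intro exI[of _ "c ` {..<n}"]) auto
  qed
  then obtain F where F: "finite F" "F \<subseteq> C" "measure lebesgue (?S - (\<Union>(x, r)\<in>F. cball x r)) < \<epsilon>" by blast
  show ?thesis
    by (rule that[OF F(1) _ disjoint_family_on_mono[OF F(2) dis] F(3)]) (use F(2) C(2) in blast)
qed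

subsection \<open>Oscillating perturbations are weakly small\<close>

definition oscillating :: "real \<Rightarrow> real \<Rightarrow> ('a::euclidean_space \<Rightarrow> 'b::euclidean_space) \<Rightarrow> bool" where
  "oscillating \<rho> M d \<longleftrightarrow> d \<in> borel_measurable lebesgue \<and> (\<forall>y. norm (d y) \<le> M) \<and>
     (\<exists>F. finite F \<and> disjoint_family_on (\<lambda>(x, r). cball x r) F \<and>
       (\<forall>(x, r)\<in>F. 0 < r \<and> r < \<rho> \<and> (LINT y|lebesgue. indicator (cball x r) y *\<^sub>R d y) = 0) \<and>
       (\<forall>y. y \<notin> (\<Union>(x, r)\<in>F. cball x r) \<longrightarrow> d y = 0))"

lemma oscillating_mono: "oscillating \<rho> M d \<Longrightarrow> \<rho> \<le> \<rho>' \<Longrightarrow> oscillating \<rho>' M d"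
  unfolding oscillating_def by (elim conjE exE, intro conjI exI) (auto split: prod.splits)

lemma integrable_bounded_times:
  fixes d g :: "'a::euclidean_space \<Rightarrow> 'b::euclidean_space"
  assumes "d \<in> borel_measurable lebesgue" "AE y in lebesgue. norm (d y) \<le> M" "integrable lebesgue g"
  shows "integrable lebesgue (\<lambda>y. d y \<bullet> g y)"
proof (rule Bochner_Integration.integrable_bound[of lebesgue "\<lambda>y. M * norm (g y)"])
  show "integrable lebesgue (\<lambda>y. M * norm (g y))" using assms(3) by auto
  show "(\<lambda>y. d y \<bullet> g y) \<in> borel_measurable lebesgue"
    using assms(1) borel_measurable_integrable[OF assms(3)] by (intro borel_measurable_inner)
  show "AE y in lebesgue. norm (d y \<bullet> g y) \<le> norm (M * norm (g y))"
    using assms(2)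
  proof (rule AE_mp, intro AE_I2 impI)
    fix y assume "norm (d y) \<le> M"
    then have "norm (d y) * norm (g y) \<le> M * norm (g y)" by (intro mult_right_mono) auto
    then show "norm (d y \<bullet> g y) \<le> norm (M * norm (g y))"
      using Cauchy_Schwarz_ineq2[of "d y" "g y"] by simp
  qed
qed

lemma lmeasurable_inner_compact:
  fixes B :: "'a::euclidean_space set"
  assumes B: "B \<in> lmeasurable" and e: "\<epsilon> > 0"
  obtains C where "compact C" "C \<subseteq> B" "measure lebesgue (B - C) < \<epsilon>"
proof -
  obtain T where T: "closed T" "T \<subseteq> B" "B - T \<in> lmeasurable" "emeasure lebesgue (B - T) < ennreal (\<epsilon> / 2)"
    using sets_lebesgue_inner_closed[of B "\<epsilon> / 2"] B e by (metis fmeasurableD half_gt_zero)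
  have T2: "measure lebesgue (B - T) < \<epsilon> / 2"
    using T(3,4) e by (simp add: emeasure_eq_measure2 ennreal_less_iff)
  have Tm: "T \<in> lmeasurable"
    using B T(1,2) by (meson fmeasurableI2 lborelD sets_completionI_sets borel_closed sets_lborel)
  define D where "D n = T - cball 0 (real n)" for n
  have Dm: "D n \<in> lmeasurable" for n unfolding D_def by (intro fmeasurable_Diff Tm) auto
  have "(\<lambda>n. measure lebesgue (D n)) \<longlonglongrightarrow> measure lebesgue (\<Inter>n. D n)"
  proof (rule Lim_measure_decseq)
    show "range D \<subseteq> sets lebesgue" using Dm by auto
    show "decseq D" by (auto simp: D_def decseq_def)
    show "emeasure lebesgue (D n) \<noteq> \<infinity>" for n using Dm[of n] by (auto simp: fmeasurable_def)
  qed
  moreover have "(\<Inter>n. D n) = {}"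
  proof -
    have "x \<notin> (\<Inter>n. D n)" for x
    proof -
      obtain n where "norm x \<le> real n" using real_arch_simple by blast
      then have "x \<notin> D n" by (simp add: D_def)
      then show ?thesis by blast
    qed
    then show ?thesis by blast
  qed
  ultimately have "(\<lambda>n. measure lebesgue (D n)) \<longlonglongrightarrow> 0" by simp
  then have "eventually (\<lambda>n. measure lebesgue (D n) < \<epsilon> / 2) sequentially"
    using e by (intro order_tendstoD) auto
  then obtain n where n: "measure lebesgue (D n) < \<epsilon> / 2" by (auto simp: eventually_sequentially)
  show ?thesis
  proof (rule that[of "T \<inter> cball 0 (real n)"])
    show "compact (T \<inter> cball 0 (real n))" using T(1) by (intro closed_Int_compact) auto
    show "T \<inter> cball 0 (real n) \<subseteq> B" using T(2) by blast
    have "B - T \<inter> cball 0 (real n) = (B - T) \<union> D n" using T(2) by (auto simp: D_def)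
    then have "measure lebesgue (B - T \<inter> cball 0 (real n)) \<le> measure lebesgue (B - T) + measure lebesgue (D n)"
      using T(3) Dm[of n] by (auto intro!: measure_Un_le)
    then show "measure lebesgue (B - T \<inter> cball 0 (real n)) < \<epsilon>" using n T2 by simp
  qed
qed

lemma integrable_indicator_bounded:
  fixes d :: "'a::euclidean_space \<Rightarrow> 'b::euclidean_space"
  assumes d: "d \<in> borel_measurable lebesgue" "\<And>y. norm (d y) \<le> M" and S: "S \<in> lmeasurable"
  shows "integrable lebesgue (\<lambda>y. indicator S y *\<^sub>R d y)"
proof (rule integrableI_bounded_set[where A = S and B = M])
  show "S \<in> sets lebesgue" using S by auto
  then show "(\<lambda>y. indicator S y *\<^sub>R d y) \<in> borel_measurable lebesgue"
    by (intro borel_measurable_scaleR borel_measurable_indicator d)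
  show "emeasure lebesgue S < \<infinity>" using S by (auto simp: fmeasurable_def)
  show "AE y in lebesgue. y \<in> S \<longrightarrow> norm (indicator S y *\<^sub>R d y) \<le> M" using d(2) by auto
  show "AE y in lebesgue. y \<notin> S \<longrightarrow> indicator S y *\<^sub>R d y = 0" by auto
qed

lemma oscillating_weakly_small_indicator:
  fixes c :: "'b::euclidean_space" and B :: "'a::euclidean_space set"
  assumes B: "B \<in> sets lebesgue" "emeasure lebesgue B < \<infinity>" and M: "M \<ge> 0" and e: "\<epsilon> > 0"
  shows "\<exists>\<rho>>0. \<forall>d. oscillating \<rho> M d \<longrightarrow> \<bar>LINT y|lebesgue. d y \<bullet> (indicator B y *\<^sub>R c)\<bar> \<le> \<epsilon>"
proof -
  define K where "K = M * norm c + 1"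
  have K: "K > 0" using M by (simp add: K_def add_nonneg_pos)
  have Bl: "B \<in> lmeasurable" using B by (auto simp: fmeasurable_def)
  obtain U where U0: "open U" "B \<subseteq> U" "U - B \<in> lmeasurable" "emeasure lebesgue (U - B) < ennreal (\<epsilon> / (2 * K))"
    using sets_lebesgue_outer_open[OF B(1), of "\<epsilon> / (2 * K)"] e K by (metis divide_pos_pos mult_pos_pos zero_less_numeral)
  have U: "open U" "B \<subseteq> U" "U \<in> lmeasurable" "measure lebesgue (U - B) < \<epsilon> / (2 * K)"
  proof -
    have "U = B \<union> (U - B)" using U0(2) by blast
    then show "U \<in> lmeasurable" using Bl U0(3) fmeasurable.Un by metis
    show "measure lebesgue (U - B) < \<epsilon> / (2 * K)"
      using U0(3,4) e K by (simp add: emeasure_eq_measure2 ennreal_less_iff)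
  qed (use U0 in auto)
  obtain C where C: "compact C" "C \<subseteq> B" "measure lebesgue (B - C) < \<epsilon> / (2 * K)"
    using lmeasurable_inner_compact[OF Bl, of "\<epsilon> / (2 * K)"] e K
    by (metis divide_pos_pos mult_pos_pos zero_less_numeral)
  obtain \<delta> where \<delta>: "\<delta> > 0" "(\<Union>x\<in>C. ball x \<delta>) \<subseteq> U"
    using compact_subset_open_imp_ball_epsilon_subset[OF C(1) U(1)] C(2) U(2) by blast
  have Cl: "C \<in> lmeasurable" using C(1) by (rule lmeasurable_compact)
  have UC: "measure lebesgue (U - C) \<le> \<epsilon> / K"
  proof -
    have "U - C = (U - B) \<union> (B - C)" using C(2) U(2) by blast
    then have "measure lebesgue (U - C) \<le> measure lebesgue (U - B) + measure lebesgue (B - C)"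
      using Bl U(3) Cl by (auto intro!: measure_Un_le)
    then show ?thesis using U(4) C(3) by (simp add: field_simps)
  qed
  show ?thesis
  proof (intro exI[of _ "\<delta> / 2"] conjI allI impI)
    show "\<delta> / 2 > 0" using \<delta> by simp
    fix d :: "'a \<Rightarrow> 'b" assume "oscillating (\<delta> / 2) M d"
    then obtain F where d: "d \<in> borel_measurable lebesgue" "\<And>y. norm (d y) \<le> M"
      and F: "finite F" "disjoint_family_on (\<lambda>(x, r). cball x r) F"
        "\<And>x r. (x, r) \<in> F \<Longrightarrow> 0 < r \<and> r < \<delta> / 2 \<and> (LINT y|lebesgue. indicator (cball x r) y *\<^sub>R d y) = 0"
        "\<And>y. y \<notin> (\<Union>(x, r)\<in>F. cball x r) \<Longrightarrow> d y = 0"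
      unfolding oscillating_def by blast
    define H where "H = {p \<in> F. cball (fst p) (snd p) \<inter> C \<noteq> {}}"
    define T where "T = (\<Union>p\<in>H. cball (fst p) (snd p))"
    have H: "finite H" "H \<subseteq> F" using F(1) by (auto simp: H_def)
    have TU: "T \<subseteq> U"
    proof
      fix y assume "y \<in> T"
      then obtain x r z where *: "(x, r) \<in> F" "y \<in> cball x r" "z \<in> cball x r" "z \<in> C" by (force simp: T_def H_def)
      have "dist z y \<le> dist z x + dist x y" by (rule dist_triangle)
      also have "\<dots> < \<delta>" using * F(3)[OF *(1)] by (auto simp: dist_commute)
      finally show "y \<in> U" by (intro subsetD[OF \<delta>(2)] UN_I[OF *(4)]) simp
    qed
    have T0: "(LINT y|lebesgue. indicator T y *\<^sub>R d y) = 0"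
    proof -
      have dj: "disjoint_family_on (\<lambda>p. cball (fst p) (snd p)) H"
        using disjoint_family_on_mono[OF H(2) F(2)] by (simp add: case_prod_unfold)
      have "indicator T y = (\<Sum>p\<in>H. indicator (cball (fst p) (snd p)) y :: real)" for y
        unfolding T_def by (rule indicator_UN_disjoint[OF H(1) dj])
      then have "(LINT y|lebesgue. indicator T y *\<^sub>R d y) = (LINT y|lebesgue. (\<Sum>p\<in>H. indicator (cball (fst p) (snd p)) y *\<^sub>R d y))"
        by (simp add: scaleR_sum_left)
      also have "\<dots> = (\<Sum>p\<in>H. (LINT y|lebesgue. indicator (cball (fst p) (snd p)) y *\<^sub>R d y))"
      proof (rule Bochner_Integration.integral_sum)
        fix p
        show "integrable lebesgue (\<lambda>y. indicator (cball (fst p) (snd p)) y *\<^sub>R d y)"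
          by (intro integrable_indicator_bounded[OF d]) auto
      qed
      also have "\<dots> = 0" using F(3) H(2) by (intro sum.neutral) force
      finally show ?thesis .
    qed
    have Tm: "T \<in> sets lebesgue" unfolding T_def using H(1) by (intro sets.finite_UN) auto
    have bound: "\<bar>d y \<bullet> (indicator B y *\<^sub>R c) - (indicator T y *\<^sub>R d y) \<bullet> c\<bar> \<le> (M * norm c) * indicator (U - C) y" for y
    proof -
      have dc: "\<bar>d y \<bullet> c\<bar> \<le> M * norm c"
        using Cauchy_Schwarz_ineq2[of "d y" c] d(2)[of y] by (meson mult_right_mono norm_ge_zero order_trans)
      have Mc: "0 \<le> M * norm c" using M by simp
      consider "d y = 0" | x r where "(x, r) \<in> F" "y \<in> cball x r"
        using F(4)[of y] by (cases "y \<in> (\<Union>(x, r)\<in>F. cball x r)") auto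
      then show ?thesis
      proof cases
        case 1 then show ?thesis using Mc by (simp add: indicator_def)
      next
        case 2
        show ?thesis
        proof (cases "y \<in> T")
          case True
          then show ?thesis using dc Mc TU C(2) by (cases "y \<in> B") (auto simp: indicator_def)
        next
          case False
          then have "y \<notin> C" using 2 by (force simp: T_def H_def)
          then show ?thesis using dc Mc False U(2) by (cases "y \<in> B") (auto simp: indicator_def)
        qed
      qed
    qed
    have i1: "integrable lebesgue (\<lambda>y. d y \<bullet> (indicator B y *\<^sub>R c))"
      using d Bl by (intro integrable_bounded_times[of _ M] integrable_scaleR_left) (auto simp: integrable_indicator_iff fmeasurable_def)
    have i2: "integrable lebesgue (\<lambda>y. indicator T y *\<^sub>R d y)"
      by (intro integrable_indicator_bounded[OF d] fmeasurableI2[OF U(3) TU Tm])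
    have i3: "integrable lebesgue (\<lambda>y. (indicator T y *\<^sub>R d y) \<bullet> c)"
      using i2 by (rule integrable_inner_left)
    have i3z: "(LINT y|lebesgue. (indicator T y *\<^sub>R d y) \<bullet> c) = 0"
      using integral_inner_left[of c lebesgue "\<lambda>y. indicator T y *\<^sub>R d y"] i2 T0 by simp
    have "(LINT y|lebesgue. d y \<bullet> (indicator B y *\<^sub>R c)) = (LINT y|lebesgue. d y \<bullet> (indicator B y *\<^sub>R c) - (indicator T y *\<^sub>R d y) \<bullet> c)"
      by (simp only: Bochner_Integration.integral_diff[OF i1 i3] i3z diff_zero)
    also have "\<bar>\<dots>\<bar> \<le> (LINT y|lebesgue. (M * norm c) * indicator (U - C) y)"
    proof (rule integral_abs_bound_integral[OF Bochner_Integration.integrable_diff[OF i1 i3] _ bound])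
      have "U - C \<in> lmeasurable" using U(3) Cl by (intro fmeasurable_Diff) auto
      then show "integrable lebesgue (\<lambda>y. (M * norm c) * indicator (U - C) y)"
        by (auto simp: integrable_indicator_iff fmeasurable_def)
    qed
    also have "\<dots> = (M * norm c) * measure lebesgue (U - C)" using U(3) Cl by simp
    also have "\<dots> \<le> K * (\<epsilon> / K)"
      using UC K M by (intro mult_mono) (auto simp: K_def)
    also have "\<dots> = \<epsilon>" using K by simp
    finally show "\<bar>LINT y|lebesgue. d y \<bullet> (indicator B y *\<^sub>R c)\<bar> \<le> \<epsilon>" .
  qed
qed

lemma oscillating_weakly_small:
  fixes g :: "'a::euclidean_space \<Rightarrow> 'b::euclidean_space"
  assumes "integrable lebesgue g" and M: "M \<ge> 0" and "\<epsilon> > 0"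
  shows "\<exists>\<rho>>0. \<forall>d. oscillating \<rho> M d \<longrightarrow> \<bar>LINT y|lebesgue. d y \<bullet> g y\<bar> \<le> \<epsilon>"
  using assms(1,3)
proof (induction arbitrary: \<epsilon> rule: integrable_induct)
  case (base B c)
  then show ?case by (intro oscillating_weakly_small_indicator M) auto
next
  case (add f g)
  obtain \<rho>1 where 1: "\<rho>1 > 0" "\<And>d. oscillating \<rho>1 M d \<Longrightarrow> \<bar>LINT y|lebesgue. d y \<bullet> f y\<bar> \<le> \<epsilon> / 2"
    using add.IH(1)[of "\<epsilon> / 2"] add.prems by auto
  obtain \<rho>2 where 2: "\<rho>2 > 0" "\<And>d. oscillating \<rho>2 M d \<Longrightarrow> \<bar>LINT y|lebesgue. d y \<bullet> g y\<bar> \<le> \<epsilon> / 2"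
    using add.IH(2)[of "\<epsilon> / 2"] add.prems by auto
  show ?case
  proof (intro exI[of _ "min \<rho>1 \<rho>2"] conjI allI impI)
    fix d :: "'a \<Rightarrow> 'b" assume d: "oscillating (min \<rho>1 \<rho>2) M d"
    have dm: "d \<in> borel_measurable lebesgue" "AE y in lebesgue. norm (d y) \<le> M" using d by (auto simp: oscillating_def)
    have "(LINT y|lebesgue. d y \<bullet> (f y + g y)) = (LINT y|lebesgue. d y \<bullet> f y) + (LINT y|lebesgue. d y \<bullet> g y)"
      unfolding inner_add_right
      by (intro Bochner_Integration.integral_add integrable_bounded_times[OF dm] add.hyps)
    then show "\<bar>LINT y|lebesgue. d y \<bullet> (f y + g y)\<bar> \<le> \<epsilon>"
      using 1(2)[OF oscillating_mono[OF d]] 2(2)[OF oscillating_mono[OF d]] by simp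
  qed (use 1 2 in simp)
next
  case (lim f s)
  have "(\<lambda>i. LINT y|lebesgue. norm (s i y - f y)) \<longlonglongrightarrow> (LINT y|(lebesgue :: 'a measure). norm (0::'b))"
  proof (rule integral_dominated_convergence[where w = "\<lambda>y. 3 * norm (f y)"])
    show "AE y in lebesgue. (\<lambda>i. norm (s i y - f y)) \<longlonglongrightarrow> norm (0::'b)"
      using lim.hyps(2) by (intro AE_I2 tendsto_norm) (auto simp: LIM_zero_iff)
    show "AE y in lebesgue. norm (norm (s i y - f y)) \<le> 3 * norm (f y)" for i
    proof (rule AE_I2)
      fix y :: 'a assume "y \<in> space lebesgue"
      then show "norm (norm (s i y - f y)) \<le> 3 * norm (f y)"
        using lim.hyps(3)[of y i] norm_triangle_ineq4[of "s i y" "f y"] by simp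
    qed
  qed (use lim.hyps in auto)
  then have "eventually (\<lambda>i. (LINT y|lebesgue. norm (s i y - f y)) < \<epsilon> / (2 * (M + 1))) sequentially"
    using lim.prems M by (intro order_tendstoD) auto
  then obtain i where i: "(LINT y|lebesgue. norm (s i y - f y)) < \<epsilon> / (2 * (M + 1))"
    by (auto simp: eventually_sequentially)
  obtain \<rho> where \<rho>: "\<rho> > 0" "\<And>d. oscillating \<rho> M d \<Longrightarrow> \<bar>LINT y|lebesgue. d y \<bullet> s i y\<bar> \<le> \<epsilon> / 2"
    using lim.IH[of "\<epsilon> / 2" i] lim.prems by auto
  show ?case
  proof (intro exI[of _ \<rho>] conjI allI impI)
    fix d :: "'a \<Rightarrow> 'b" assume d: "oscillating \<rho> M d"
    have dm: "d \<in> borel_measurable lebesgue" "AE y in lebesgue. norm (d y) \<le> M"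
      and dM: "\<And>y. norm (d y) \<le> M" using d by (auto simp: oscillating_def)
    have isf: "integrable lebesgue (\<lambda>y. s i y - f y)" using lim.hyps by auto
    have "\<bar>LINT y|lebesgue. d y \<bullet> (s i y - f y)\<bar> \<le> (LINT y|lebesgue. M * norm (s i y - f y))"
    proof (rule integral_abs_bound_integral)
      show "\<bar>d y \<bullet> (s i y - f y)\<bar> \<le> M * norm (s i y - f y)" for y
        using Cauchy_Schwarz_ineq2[of "d y" "s i y - f y"] dM[of y] by (meson mult_right_mono norm_ge_zero order_trans)
    qed (use integrable_bounded_times[OF dm isf] isf in auto)
    also have "\<dots> = M * (LINT y|lebesgue. norm (s i y - f y))" by simp
    also have "\<dots> \<le> (M + 1) * (\<epsilon> / (2 * (M + 1)))" using i M by (intro mult_mono) auto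
    also have "\<dots> = \<epsilon> / 2" using M by (simp add: field_simps)
    finally have 1: "\<bar>LINT y|lebesgue. d y \<bullet> (s i y - f y)\<bar> \<le> \<epsilon> / 2" .
    have "(LINT y|lebesgue. d y \<bullet> (s i y - f y)) = (LINT y|lebesgue. d y \<bullet> s i y) - (LINT y|lebesgue. d y \<bullet> f y)"
      unfolding inner_diff_right
      by (intro Bochner_Integration.integral_diff integrable_bounded_times[OF dm] lim.hyps)
    then show "\<bar>LINT y|lebesgue. d y \<bullet> f y\<bar> \<le> \<epsilon>" using 1 \<rho>(2)[OF d] by linarith
  qed (use \<rho> in simp)
qed

subsection \<open>Insertion of cells into the pieces of a field\<close>

definition insert_cells ::
    "('a::euclidean_space \<Rightarrow> 'b::euclidean_space) \<Rightarrow> ('b \<Rightarrow> 'a \<Rightarrow> 'b) \<Rightarrow> ('a \<times> real) set \<Rightarrow> 'a \<Rightarrow> 'b" where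
  "insert_cells u \<Theta> F y = u y + (\<Sum>p\<in>F. place (fst p) (snd p) (\<Theta> (u (fst p))) y)"

definition cell_family :: "('a::euclidean_space \<Rightarrow> 'b) \<Rightarrow> 'b set \<Rightarrow> 'a set \<Rightarrow> ('a \<times> real) set \<Rightarrow> bool" where
  "cell_family u Z G F \<longleftrightarrow> finite F \<and> disjoint_family_on (\<lambda>(x, r). cball x r) F \<and>
     (\<forall>(x, r)\<in>F. 0 < r \<and> cball x r \<subseteq> G \<and> u x \<in> Z \<and> (\<forall>y\<in>cball x r. u y = u x))"

lemma cell_familyD:
  assumes "cell_family u Z G F" "p \<in> F"
  shows "snd p > 0" "cball (fst p) (snd p) \<subseteq> G" "u (fst p) \<in> Z" "y \<in> cball (fst p) (snd p) \<Longrightarrow> u y = u (fst p)"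
  using assms by (auto simp: cell_family_def case_prod_unfold)

lemma cell_family_finite: "cell_family u Z G F \<Longrightarrow> finite F"
  by (simp add: cell_family_def)

lemma cell_family_disjoint:
  assumes "cell_family u Z G F" "p \<in> F" "p' \<in> F" "p \<noteq> p'"
  shows "cball (fst p) (snd p) \<inter> cball (fst p') (snd p') = {}"
  using assms by (simp add: cell_family_def disjoint_family_on_def case_prod_unfold)

lemma cell_family_subset: "cell_family u Z G F \<Longrightarrow> (\<Union>(x, r)\<in>F. cball x r) \<subseteq> G"
  using cell_familyD(2) by (fastforce simp: case_prod_unfold)

lemma cell_family_exists:
  fixes u :: "'a::euclidean_space \<Rightarrow> 'b::euclidean_space"
  assumes u: "u \<in> L_piec" and G: "open G" "bounded G" and pos: "\<epsilon> > 0" "\<rho> > 0"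
  obtains F where "cell_family u Z G F" "\<And>x r. (x, r) \<in> F \<Longrightarrow> r < \<rho>"
    "{y \<in> G. u y \<in> Z} - (\<Union>(x, r)\<in>F. cball x r) \<in> lmeasurable"
    "measure lebesgue ({y \<in> G. u y \<in> Z} - (\<Union>(x, r)\<in>F. cball x r)) < \<epsilon>"
proof -
  obtain \<U> where U: "pieces u \<U>" using u L_piec_pieces by blast
  define \<V> where "\<V> = {U \<inter> G |U. U \<in> \<U> \<and> (\<forall>y\<in>U. u y \<in> Z)}"
  have opV: "open V" if "V \<in> \<V>" for V using that U G(1) by (auto simp: \<V>_def pieces_def)
  have bV: "bounded (\<Union>\<V>)" using G(2) by (rule bounded_subset) (auto simp: \<V>_def)
  obtain F where F: "finite F" "\<And>x r. (x, r) \<in> F \<Longrightarrow> 0 < r \<and> r < \<rho> \<and> (\<exists>V\<in>\<V>. cball x r \<subseteq> V)"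
    "disjoint_family_on (\<lambda>(x, r). cball x r) F"
    "measure lebesgue (\<Union>\<V> - (\<Union>(x, r)\<in>F. cball x r)) < \<epsilon>"
    using vitali_finite[OF opV bV pos] by metis
  let ?T = "\<Union>(x, r)\<in>F. cball x r"
  let ?S = "{y \<in> G. u y \<in> Z}"
  have cf: "cell_family u Z G F"
  proof -
    have "0 < r \<and> cball x r \<subseteq> G \<and> u x \<in> Z \<and> (\<forall>y\<in>cball x r. u y = u x)" if xr: "(x, r) \<in> F" for x r
    proof -
      obtain V where r: "0 < r" and "V \<in> \<V>" "cball x r \<subseteq> V" using F(2)[OF xr] by blast
      then obtain W where W: "W \<in> \<U>" "\<forall>y\<in>W. u y \<in> Z" "cball x r \<subseteq> W" "cball x r \<subseteq> G" by (auto simp: \<V>_def)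
      have "u constant_on W" using U W(1) by (auto simp: pieces_def)
      then obtain c where "\<forall>y\<in>W. u y = c" unfolding constant_on_def by blast
      moreover have "x \<in> cball x r" using r by simp
      ultimately show ?thesis using W r by (metis subsetD)
    qed
    then show ?thesis using F(1,3) by (auto simp: cell_family_def)
  qed
  have VS: "\<Union>\<V> \<subseteq> ?S" by (auto simp: \<V>_def)
  have SV: "?S - \<Union>\<V> \<subseteq> UNIV - \<Union>\<U>"
  proof
    fix y assume y: "y \<in> ?S - \<Union>\<V>"
    have "y \<notin> W" if W: "W \<in> \<U>" for W
    proof
      assume "y \<in> W"
      have "u constant_on W" using U W by (auto simp: pieces_def)
      then obtain c where "\<forall>y\<in>W. u y = c" unfolding constant_on_def by blast
      then have "W \<inter> G \<in> \<V>" using y W \<open>y \<in> W\<close> by (auto simp: \<V>_def)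
      then show False using y \<open>y \<in> W\<close> by blast
    qed
    then show "y \<in> UNIV - \<Union>\<U>" by blast
  qed
  then have neg: "negligible (?S - \<Union>\<V>)" using U negligible_subset unfolding pieces_def by blast
  have Vm: "\<Union>\<V> \<in> lmeasurable" using opV bV by (intro lmeasurable_open open_Union) auto
  have Tm: "?T \<in> sets lebesgue" using F(1) by (intro sets.finite_UN) auto
  have dec: "?S - ?T = (\<Union>\<V> - ?T) \<union> ((?S - \<Union>\<V>) - ?T)" using VS by blast
  have n2: "negligible ((?S - \<Union>\<V>) - ?T)" using neg by (rule negligible_subset) blast
  have m1: "\<Union>\<V> - ?T \<in> lmeasurable" using Vm Tm by (rule fmeasurable_Diff)
  show ?thesis
  proof (rule that[OF cf])
    show "\<And>x r. (x, r) \<in> F \<Longrightarrow> r < \<rho>" using F(2) by blast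
    show lm: "?S - ?T \<in> lmeasurable"
      unfolding dec using m1 negligible_imp_measurable[OF n2] by (rule fmeasurable.Un)
    have "measure lebesgue (?S - ?T) \<le> measure lebesgue (\<Union>\<V> - ?T) + measure lebesgue ((?S - \<Union>\<V>) - ?T)"
      unfolding dec using m1 negligible_imp_measurable[OF n2] by (intro measure_Un_le) auto
    then show "measure lebesgue (?S - ?T) < \<epsilon>" using F(4) negligible_imp_measure0[OF n2] by simp
  qed
qed

lemma insert_cells_ball:
  assumes F: "cell_family u Z G F" and \<Theta>: "\<And>p z. p \<in> Z \<Longrightarrow> norm z > 1 \<Longrightarrow> \<Theta> p z = 0"
    and xr: "(x, r) \<in> F" and y: "y \<in> cball x r"
  shows "insert_cells u \<Theta> F y = u x + place x r (\<Theta> (u x)) y"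
proof -
  have "place (fst p) (snd p) (\<Theta> (u (fst p))) y = 0" if p: "p \<in> F - {(x, r)}" for p
  proof (rule place_zero)
    show "snd p > 0" using cell_familyD(1)[OF F] p by blast
    have "cball (fst p) (snd p) \<inter> cball x r = {}"
      using cell_family_disjoint[OF F, of p "(x, r)"] p xr by simp
    then show "y \<notin> cball (fst p) (snd p)" using y by blast
    have "u (fst p) \<in> Z" using cell_familyD(3)[OF F] p by blast
    then show "\<And>z. norm z > 1 \<Longrightarrow> \<Theta> (u (fst p)) z = 0" by (rule \<Theta>)
  qed
  then have "(\<Sum>p\<in>F - {(x, r)}. place (fst p) (snd p) (\<Theta> (u (fst p))) y) = 0" by (rule sum.neutral[rule_format])
  moreover have "finite F" "u y = u x"
    using cell_family_finite[OF F] cell_familyD(4)[OF F xr, of y] y by simp_all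
  ultimately show ?thesis by (simp add: insert_cells_def sum.remove[OF _ xr])
qed

lemma insert_cells_outside:
  assumes F: "cell_family u Z G F" and \<Theta>: "\<And>p z. p \<in> Z \<Longrightarrow> norm z > 1 \<Longrightarrow> \<Theta> p z = 0"
    and y: "y \<notin> (\<Union>(x, r)\<in>F. cball x r)"
  shows "insert_cells u \<Theta> F y = u y"
proof -
  have "place (fst p) (snd p) (\<Theta> (u (fst p))) y = 0" if p: "p \<in> F" for p
  proof (rule place_zero)
    show "snd p > 0" using cell_familyD(1)[OF F] p by blast
    show "y \<notin> cball (fst p) (snd p)" using y p by (cases p) auto
    have "u (fst p) \<in> Z" using cell_familyD(3)[OF F] p by blast
    then show "\<And>z. norm z > 1 \<Longrightarrow> \<Theta> (u (fst p)) z = 0" by (rule \<Theta>)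
  qed
  then show ?thesis by (simp add: insert_cells_def)
qed

lemma insert_cells_admissible:
  fixes A :: "'n::finite \<Rightarrow> real^'d^'m"
  assumes F: "cell_family u Z G F" and \<Theta>: "\<And>p. p \<in> Z \<Longrightarrow> cell_field A (\<Theta> p)"
  shows "u \<in> L_piec \<Longrightarrow> insert_cells u \<Theta> F \<in> L_piec"
    and "u \<in> L_piec \<Longrightarrow> distr_A_free A u \<Longrightarrow> distr_A_free A (insert_cells u \<Theta> F)"
    and "pw_const u \<Longrightarrow> pw_const (insert_cells u \<Theta> F)"
    and "pw_const u \<Longrightarrow> integral\<^sup>L lborel (insert_cells u \<Theta> F) = integral\<^sup>L lborel u"
proof -
  let ?f = "\<lambda>p. place (fst p) (snd p) (\<Theta> (u (fst p)))"
  have c: "cell_field A (\<Theta> (u (fst p)))" and r: "snd p > 0" if "p \<in> F" for p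
    using \<Theta>[OF cell_familyD(3)[OF F that]] cell_familyD(1)[OF F that] by simp_all
  have pw: "pw_const (?f p)" if "p \<in> F" for p
    using c[OF that] r[OF that] by (auto simp: cell_field_def pw_const_place)
  have Af: "distr_A_free A (?f p)" if "p \<in> F" for p
    using c[OF that] r[OF that] by (auto simp: cell_field_def pw_const_def distr_A_free_place)
  have i0: "integral\<^sup>L lborel (?f p) = 0" if "p \<in> F" for p
    using c[OF that] integral_place[OF _ r[OF that], of "\<Theta> (u (fst p))" "fst p"] by (auto simp: cell_field_def pw_const_def)
  have L: "?f p \<in> L_piec" if "p \<in> F" for p using pw[OF that] by (simp add: pw_const_def)
  have sL: "(\<lambda>y. \<Sum>p\<in>F. ?f p y) \<in> L_piec" using L by (intro L_piec_sum)
  have eq: "insert_cells u \<Theta> F = (\<lambda>y. u y + (\<Sum>p\<in>F. ?f p y))" by (simp add: insert_cells_def[abs_def])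
  show "u \<in> L_piec \<Longrightarrow> insert_cells u \<Theta> F \<in> L_piec" unfolding eq using sL by (intro L_piec_add)
  show "distr_A_free A (insert_cells u \<Theta> F)" if "u \<in> L_piec" "distr_A_free A u"
    unfolding eq using that sL Af L L_piec_subset_L_infty
    by (intro distr_A_free_add distr_A_free_sum) auto
  show pu: "pw_const (insert_cells u \<Theta> F)" if "pw_const u"
    unfolding eq using that pw by (intro pw_const_add pw_const_sum)
  have int: "integrable lborel f" if f: "pw_const f" for f :: "real^'n \<Rightarrow> real^'d"
  proof -
    obtain R where R: "\<forall>x. norm x > R \<longrightarrow> f x = 0" using f by (auto simp: pw_const_def)
    obtain B where B: "\<And>x. norm (f x) \<le> B" using f by (auto simp: pw_const_def L_piec_def bounded_iff)
    show ?thesis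
    proof (rule integrableI_bounded_set[where A = "cball 0 R" and B = B])
      show "emeasure lborel (cball 0 R :: (real^'n) set) < \<infinity>" by (intro emeasure_bounded_finite) simp
    qed (use f R B in \<open>auto simp: pw_const_def\<close>)
  qed
  show "integral\<^sup>L lborel (insert_cells u \<Theta> F) = integral\<^sup>L lborel u" if "pw_const u"
    unfolding eq using int[OF that] int[OF pw] int[OF pw_const_sum[OF pw]] i0 by simp
qed

lemma cell_family_integral_le:
  fixes f g :: "'a::euclidean_space \<Rightarrow> real"
  assumes F: "cell_family u Z G F" and G: "G \<in> lmeasurable"
    and f: "f \<in> borel_measurable lebesgue" "\<And>y. \<bar>f y\<bar> \<le> M" and g: "g \<in> borel_measurable lebesgue" "\<And>y. \<bar>g y\<bar> \<le> M'"
    and le: "\<And>x r. (x, r) \<in> F \<Longrightarrow> (LINT y|lebesgue. indicator (cball x r) y * f y) \<le> (LINT y|lebesgue. indicator (cball x r) y * g y)"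
    and gnn: "\<And>y. g y \<ge> 0"
  shows "(LINT y|lebesgue. indicator (\<Union>(x, r)\<in>F. cball x r) y * f y) \<le> (LINT y|lebesgue. indicator G y * g y)"
proof -
  let ?T = "\<Union>(x, r)\<in>F. cball x r"
  have fin: "finite F" and dj: "disjoint_family_on (\<lambda>p. cball (fst p) (snd p)) F"
    using F by (simp_all add: cell_family_def case_prod_unfold)
  have T: "?T = (\<Union>p\<in>F. cball (fst p) (snd p))" by (simp add: case_prod_unfold)
  have ind: "indicator ?T y = (\<Sum>p\<in>F. indicator (cball (fst p) (snd p)) y :: real)" for y
    unfolding T by (rule indicator_UN_disjoint[OF fin dj])
  have int: "integrable lebesgue (\<lambda>y. indicator S y * h y)"
    if "S \<in> lmeasurable" "h \<in> borel_measurable lebesgue" "\<And>y. \<bar>h y\<bar> \<le> N" for S N and h :: "'a \<Rightarrow> real"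
    using integrable_indicator_bounded[of h N S] that by simp
  have Tm: "?T \<in> lmeasurable" unfolding T using fin by (intro fmeasurable.finite_UN) auto
  have "(LINT y|lebesgue. indicator ?T y * f y) = (\<Sum>p\<in>F. LINT y|lebesgue. indicator (cball (fst p) (snd p)) y * f y)"
    unfolding ind sum_distrib_right by (intro Bochner_Integration.integral_sum int[OF _ f]) auto
  also have "\<dots> \<le> (\<Sum>p\<in>F. LINT y|lebesgue. indicator (cball (fst p) (snd p)) y * g y)"
    using le by (intro sum_mono) auto
  also have "\<dots> = (LINT y|lebesgue. indicator ?T y * g y)"
    unfolding ind sum_distrib_right by (intro Bochner_Integration.integral_sum[symmetric] int[OF _ g]) auto
  also have "\<dots> \<le> (LINT y|lebesgue. indicator G y * g y)"
  proof (intro integral_mono int[OF _ g] Tm G)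
    fix y
    have "?T \<subseteq> G" by (rule cell_family_subset[OF F])
    then show "indicator ?T y * g y \<le> indicator G y * g y" using gnn[of y] by (auto simp: indicator_def)
  qed
  finally show ?thesis .
qed

lemma integral_on_ball_place:
  fixes \<phi> :: "'a::euclidean_space \<Rightarrow> 'b::euclidean_space" and q :: "'b \<Rightarrow> real"
  assumes "\<phi> \<in> borel_measurable borel" "continuous_on UNIV q" "r > 0"
  shows "(LINT y|lebesgue. indicator (cball x r) y * q (c + place x r \<phi> y)) =
    r ^ DIM('a) * (\<integral>z. indicator (cball 0 1) z * q (c + \<phi> z) \<partial>lborel)"
    and "measure lebesgue (cball x r) = r ^ DIM('a) * measure lebesgue (cball (0::'a) 1)"
proof -
  let ?g = "\<lambda>z. indicator (cball 0 1) z * q (c + \<phi> z)"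
  have qm: "q \<in> borel_measurable borel" using assms(2) by (rule borel_measurable_continuous_onI)
  have "cball (0::'a) 1 \<in> sets borel" by simp
  then have im: "(indicator (cball 0 1) :: 'a \<Rightarrow> real) \<in> borel_measurable borel" by (rule borel_measurable_indicator)
  have gm: "?g \<in> borel_measurable borel"
    using assms(1) by (intro borel_measurable_times im measurable_compose[OF _ qm]) auto
  have eq: "place x r (indicator (cball 0 1) :: 'a \<Rightarrow> real) y = indicator (cball x r) y" for y
  proof -
    have "norm ((1 / r) *\<^sub>R (y - x)) \<le> 1 \<longleftrightarrow> norm (y - x) \<le> r" using assms(3) by simp
    then show ?thesis by (simp add: place_def indicator_def dist_norm norm_minus_commute)
  qed
  have pl: "place x r ?g y = indicator (cball x r) y * q (c + place x r \<phi> y)" for y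
    using eq[of y] by (simp add: place_def)
  have "place x r ?g \<in> borel_measurable borel" unfolding place_affine using gm by measurable
  then have "(LINT y|lebesgue. place x r ?g y) = (\<integral>y. place x r ?g y \<partial>lborel)" by (simp add: integral_completion)
  also have "\<dots> = r ^ DIM('a) * (\<integral>z. ?g z \<partial>lborel)" using integral_place[OF gm assms(3)] by simp
  finally show "(LINT y|lebesgue. indicator (cball x r) y * q (c + place x r \<phi> y)) =
    r ^ DIM('a) * (\<integral>z. indicator (cball 0 1) z * q (c + \<phi> z) \<partial>lborel)" unfolding pl .
  show "measure lebesgue (cball x r) = r ^ DIM('a) * measure lebesgue (cball (0::'a) 1)"
  proof -
    have "place x r (indicator (cball 0 1) :: 'a \<Rightarrow> real) = indicator (cball x r)" by (rule ext) (rule eq)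
    then show ?thesis using integral_place[OF im assms(3), of x] by simp
  qed
qed

subsection \<open>Relaxation\<close>

definition admissible ::
    "('n::finite \<Rightarrow> real^'d^'m) \<Rightarrow> (real^'d) set \<Rightarrow> real^'d \<Rightarrow> (real^'n \<Rightarrow> real^'d) \<Rightarrow> bool" where
  "admissible A U \<xi> \<phi> \<longleftrightarrow> cell_field A \<phi> \<and> (\<exists>C. compact C \<and> C \<subseteq> U \<and> (\<forall>x. \<xi> + \<phi> x \<in> C))"

definition cell_energy :: "(real^'d \<Rightarrow> real) \<Rightarrow> real^'d \<Rightarrow> (real^'n::finite \<Rightarrow> real^'d) \<Rightarrow> real" where
  "cell_energy q \<xi> \<phi> = (\<integral>z. indicator (cball 0 1) z * q (\<xi> + \<phi> z) \<partial>lborel)"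

definition relaxation ::
    "('n::finite \<Rightarrow> real^'d^'m) \<Rightarrow> (real^'d) set \<Rightarrow> (real^'d \<Rightarrow> real) \<Rightarrow> real^'d \<Rightarrow> real" where
  "relaxation A U q \<xi> = Inf (cell_energy q \<xi> ` {\<phi>. admissible A U \<xi> \<phi>})"

lemma cell_field_zero: "cell_field A (\<lambda>x. 0)"
  by (simp add: cell_field_def pw_const_zero distr_A_free_zero)

locale relaxed_energy =
  fixes A :: "'n::finite \<Rightarrow> real^'d^'m" and U :: "(real^'d) set" and q :: "real^'d \<Rightarrow> real"
  assumes open_U: "open U" and bounded_U: "bounded U"
    and q_cont: "continuous_on UNIV q" and q_nonneg: "\<And>p. q p \<ge> 0"
begin

definition vol :: real where "vol = measure lebesgue (cball (0::real^'n) 1)"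

lemma vol_pos: "vol > 0"
  unfolding vol_def using content_cball_pos[of 1 "0::real^'n"] by simp

abbreviation "f \<equiv> relaxation A U q"

lemma q_measurable: "q \<in> borel_measurable borel"
  using q_cont by (rule borel_measurable_continuous_onI)

lemma energy_lebesgue:
  assumes "\<phi> \<in> borel_measurable borel"
  shows "cell_energy q \<xi> \<phi> = (LINT z|lebesgue. indicator (cball (0::real^'n) 1) z * q (\<xi> + \<phi> z))"
  using integral_on_ball_place(1)[OF assms q_cont, of 1 0 \<xi>] by (simp add: cell_energy_def place_def)

lemma energy_nonneg: "cell_energy q \<xi> \<phi> \<ge> 0"
  unfolding cell_energy_def using q_nonneg by (intro integral_nonneg_AE) (auto simp: indicator_def)

lemma admissible_zero: "\<xi> \<in> U \<Longrightarrow> admissible A U \<xi> (\<lambda>x. 0)"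
  unfolding admissible_def by (intro conjI cell_field_zero exI[of _ "{\<xi>}"]) auto

lemma bdd: "bdd_below (cell_energy q \<xi> ` {\<phi>. admissible A U \<xi> \<phi>})"
  by (intro bdd_belowI[of _ 0]) (auto simp: energy_nonneg)

lemma f_le: "admissible A U \<xi> \<phi> \<Longrightarrow> f \<xi> \<le> cell_energy q \<xi> \<phi>"
  unfolding relaxation_def by (intro cInf_lower bdd) auto

lemma f_nonneg: "\<xi> \<in> U \<Longrightarrow> f \<xi> \<ge> 0"
  unfolding relaxation_def using admissible_zero energy_nonneg by (intro cInf_greatest) auto

lemma f_le_q: "\<xi> \<in> U \<Longrightarrow> f \<xi> \<le> vol * q \<xi>"
proof -
  assume "\<xi> \<in> U"
  from f_le[OF admissible_zero[OF this]] show ?thesis by (simp add: cell_energy_def vol_def)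
qed

lemma f_less_obtain:
  assumes "\<xi> \<in> U" "f \<xi> < c"
  obtains \<phi> where "admissible A U \<xi> \<phi>" "cell_energy q \<xi> \<phi> < c"
proof -
  have "cell_energy q \<xi> ` {\<phi>. admissible A U \<xi> \<phi>} \<noteq> {}" using admissible_zero[OF assms(1)] by blast
  then have "\<exists>y\<in>cell_energy q \<xi> ` {\<phi>. admissible A U \<xi> \<phi>}. y < c"
    using assms(2) cInf_less_iff[OF _ bdd, of \<xi> c] unfolding relaxation_def by blast
  then show ?thesis using that by auto
qed

lemma q_bound: "\<exists>M\<ge>0. \<forall>p\<in>U. q p \<le> M"
proof -
  have "compact (q ` closure U)" using bounded_U continuous_on_subset[OF q_cont] by (intro compact_continuous_image) auto
  then obtain M where "\<And>p. p \<in> closure U \<Longrightarrow> \<bar>q p\<bar> \<le> M"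
    using compact_imp_bounded bounded_iff by (metis imageI real_norm_def)
  then have "q p \<le> max M 0" if "p \<in> U" for p using that closure_subset[of U] by (smt (verit) subsetD)
  then show ?thesis by (intro exI[of _ "max M 0"]) auto
qed

lemma upper_semicontinuous:
  assumes \<xi>: "\<xi> \<in> U" "f \<xi> < c"
  shows "\<exists>\<delta>>0. \<forall>\<eta>\<in>ball \<xi> \<delta>. \<eta> \<in> U \<and> f \<eta> < c"
proof -
  obtain \<phi> where \<phi>: "admissible A U \<xi> \<phi>" "cell_energy q \<xi> \<phi> < c" using f_less_obtain[OF \<xi>] .
  obtain C where C: "compact C" "C \<subseteq> U" "\<And>x. \<xi> + \<phi> x \<in> C" using \<phi>(1) by (auto simp: admissible_def)
  have \<phi>m: "\<phi> \<in> borel_measurable borel" and cf: "cell_field A \<phi>"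
    using \<phi>(1) by (auto simp: admissible_def cell_field_def pw_const_def)
  obtain d where d: "d > 0" "(\<Union>x\<in>C. ball x d) \<subseteq> U"
    using compact_subset_open_imp_ball_epsilon_subset[OF C(1) open_U C(2)] by blast
  define D where "D = {x + y |x y. x \<in> C \<and> y \<in> cball 0 (d / 2)}"
  have D: "compact D" unfolding D_def using C(1) by (intro compact_sums) auto
  have DU: "D \<subseteq> U"
  proof
    fix z assume "z \<in> D"
    then obtain x y where "z = x + y" "x \<in> C" "norm y \<le> d / 2" by (auto simp: D_def)
    then have "z \<in> ball x d" using d(1) by (simp add: dist_norm)
    then show "z \<in> U" using d(2) \<open>x \<in> C\<close> by blast
  qed
  define e where "e = (c - cell_energy q \<xi> \<phi>) / (2 * vol)"
  have e: "e > 0" using \<phi>(2) vol_pos by (simp add: e_def)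
  have "uniformly_continuous_on D q"
    using D continuous_on_subset[OF q_cont] by (intro compact_uniformly_continuous) auto
  then obtain \<delta>0 where \<delta>0: "\<delta>0 > 0" "\<And>x y. x \<in> D \<Longrightarrow> y \<in> D \<Longrightarrow> dist y x < \<delta>0 \<Longrightarrow> dist (q y) (q x) < e"
    using e unfolding uniformly_continuous_on_def by metis
  show ?thesis
  proof (intro exI[of _ "min \<delta>0 (d / 2)"] conjI ballI)
    show "min \<delta>0 (d / 2) > 0" using \<delta>0 d by simp
    fix \<eta> assume \<eta>: "\<eta> \<in> ball \<xi> (min \<delta>0 (d / 2))"
    have inD: "\<eta> + \<phi> x \<in> D" "\<xi> + \<phi> x \<in> D" for x
    proof -
      show "\<eta> + \<phi> x \<in> D" unfolding D_def
        using \<eta> C(3)[of x] by (intro CollectI exI[of _ "\<xi> + \<phi> x"] exI[of _ "\<eta> - \<xi>"]) (auto simp: dist_norm norm_minus_commute)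
      show "\<xi> + \<phi> x \<in> D" unfolding D_def
        using d C(3)[of x] by (intro CollectI exI[of _ "\<xi> + \<phi> x"] exI[of _ 0]) auto
    qed
    have adm: "admissible A U \<eta> \<phi>" using cf D DU inD(1) by (auto simp: admissible_def)
    have cfi: "\<phi> x = 0" if "norm x > 1" for x using cf that by (simp add: cell_field_def)
    obtain x0 :: "real^'n" where "norm x0 = 2" using vector_choose_size[of 2] by auto
    then have "\<phi> x0 = 0" by (intro cfi) simp
    then show "\<eta> \<in> U" using inD(1)[of x0] DU by auto
    have int: "integrable lborel (\<lambda>z. indicator (cball (0::real^'n) 1) z * q (\<zeta> + \<phi> z))" if "\<And>x. \<zeta> + \<phi> x \<in> D" for \<zeta>
    proof -
      obtain M where M: "M \<ge> 0" "\<And>p. p \<in> U \<Longrightarrow> q p \<le> M" using q_bound by blast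
      show ?thesis
      proof (rule integrableI_bounded_set[where A = "cball 0 1" and B = M])
        show "emeasure lborel (cball 0 1 :: (real^'n) set) < \<infinity>" by (intro emeasure_bounded_finite) simp
        show "(\<lambda>z. indicator (cball (0::real^'n) 1) z * q (\<zeta> + \<phi> z)) \<in> borel_measurable lborel"
          using \<phi>m by (intro borel_measurable_times borel_measurable_indicator measurable_compose[OF _ q_measurable]) auto
        show "AE x in lborel. x \<in> cball 0 1 \<longrightarrow> norm (indicator (cball (0::real^'n) 1) x * q (\<zeta> + \<phi> x)) \<le> M"
          using M that DU q_nonneg by (intro AE_I2) (auto simp: abs_mult)
      qed auto
    qed
    have "f \<eta> \<le> cell_energy q \<eta> \<phi>" by (rule f_le[OF adm])
    also have "\<dots> \<le> (\<integral>z. indicator (cball (0::real^'n) 1) z * q (\<xi> + \<phi> z) + e * indicator (cball (0::real^'n) 1) z \<partial>lborel)"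
      unfolding cell_energy_def
    proof (intro integral_mono Bochner_Integration.integrable_add int inD integrable_mult_right)
      show "integrable lborel (indicator (cball (0::real^'n) 1) :: _ \<Rightarrow> real)"
        using emeasure_bounded_finite[of "cball (0::real^'n) 1"] by (simp add: integrable_indicator_iff)
      fix z
      have "dist (q (\<eta> + \<phi> z)) (q (\<xi> + \<phi> z)) < e"
        using \<eta> by (intro \<delta>0(2) inD) (auto simp: dist_norm norm_minus_commute)
      then show "indicator (cball 0 1) z * q (\<eta> + \<phi> z) \<le> indicator (cball 0 1) z * q (\<xi> + \<phi> z) + e * indicator (cball 0 1) z"
        by (auto simp: indicator_def dist_real_def)
    qed
    also have "\<dots> = cell_energy q \<xi> \<phi> + e * vol"
      using int[OF inD(2)] emeasure_bounded_finite[of "cball (0::real^'n) 1"]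
      by (subst Bochner_Integration.integral_add) (auto simp: cell_energy_def vol_def integrable_indicator_iff)
    also have "\<dots> < c" using \<phi>(2) vol_pos by (simp add: e_def field_simps)
    finally show "f \<eta> < c" .
  qed
qed

lemma subaverage:
  assumes adm: "admissible A U \<xi> \<phi>"
  shows "vol * f \<xi> \<le> (LINT y|lebesgue. indicator (cball (0::real^'n) 1) y * f (\<xi> + \<phi> y))"
proof (rule field_le_epsilon)
  fix e :: real assume e: "e > 0"
  obtain C where C: "compact C" "C \<subseteq> U" "\<And>x. \<xi> + \<phi> x \<in> C" using adm by (auto simp: admissible_def)
  have cf: "cell_field A \<phi>" using adm by (simp add: admissible_def)
  then have pw: "pw_const \<phi>" "\<phi> \<in> L_piec" "\<phi> \<in> borel_measurable borel" and Af: "distr_A_free A \<phi>"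
    and supp: "\<And>x. norm x > 1 \<Longrightarrow> \<phi> x = 0"
    by (auto simp: cell_field_def pw_const_def)
  have inU: "\<xi> + \<phi> x \<in> U" for x using C by blast
  obtain M where M: "M \<ge> 0" "\<And>p. p \<in> U \<Longrightarrow> q p \<le> M" using q_bound by blast
  define e1 where "e1 = e / (2 * vol)"
  have e1: "e1 > 0" using e vol_pos by (simp add: e1_def)
  have "\<exists>\<psi>. admissible A U (\<xi> + p) \<psi> \<and> cell_energy q (\<xi> + p) \<psi> < f (\<xi> + p) + e1" if "p \<in> range \<phi>" for p
    using f_less_obtain[of "\<xi> + p" "f (\<xi> + p) + e1"] e1 inU that by force
  then obtain \<Theta> where \<Theta>: "\<And>p. p \<in> range \<phi> \<Longrightarrow> admissible A U (\<xi> + p) (\<Theta> p)"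
    "\<And>p. p \<in> range \<phi> \<Longrightarrow> cell_energy q (\<xi> + p) (\<Theta> p) < f (\<xi> + p) + e1" by metis
  have \<Theta>cf: "cell_field A (\<Theta> p)" if "p \<in> range \<phi>" for p using \<Theta>(1)[OF that] by (simp add: admissible_def)
  have \<Theta>0: "\<Theta> p z = 0" if "p \<in> range \<phi>" "norm z > 1" for p z using \<Theta>cf[OF that(1)] that(2) by (simp add: cell_field_def)
  define e2 where "e2 = e / (2 * vol * (M + 1))"
  have e2: "e2 > 0" using e vol_pos M by (simp add: e2_def)
  let ?G = "ball (0::real^'n) 1"
  obtain F where F: "cell_family \<phi> (range \<phi>) ?G F"
    "{y \<in> ?G. \<phi> y \<in> range \<phi>} - (\<Union>(x, r)\<in>F. cball x r) \<in> lmeasurable"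
    "measure lebesgue ({y \<in> ?G. \<phi> y \<in> range \<phi>} - (\<Union>(x, r)\<in>F. cball x r)) < e2"
    by (rule cell_family_exists[OF pw(2) open_ball[of 0 1] bounded_ball[of 0 1] e2 zero_less_one]) (rule that)
  let ?T = "\<Union>(x, r)\<in>F. cball x r"
  have GT: "{y \<in> ?G. \<phi> y \<in> range \<phi>} - ?T = ?G - ?T" by auto
  define v where "v = insert_cells \<phi> \<Theta> F"
  have vb: "v y = \<phi> x + place x r (\<Theta> (\<phi> x)) y" if "(x, r) \<in> F" "y \<in> cball x r" for x r y
    unfolding v_def by (rule insert_cells_ball[OF F(1) \<Theta>0 that])
  have vo: "v y = \<phi> y" if "y \<notin> ?T" for y
    unfolding v_def by (rule insert_cells_outside[OF F(1) \<Theta>0 that])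
  have TG: "?T \<subseteq> ?G" and fin: "finite F"
    using cell_family_subset[OF F(1)] cell_family_finite[OF F(1)] by simp_all
  have vU: "admissible A U \<xi> v"
  proof -
    have "pw_const v" unfolding v_def by (rule insert_cells_admissible(3)[OF F(1) \<Theta>cf pw(1)])
    moreover have "distr_A_free A v" unfolding v_def by (rule insert_cells_admissible(2)[OF F(1) \<Theta>cf pw(2) Af])
    moreover have "integral\<^sup>L lborel v = 0"
      unfolding v_def using insert_cells_admissible(4)[OF F(1) \<Theta>cf pw(1)] cf by (simp add: cell_field_def)
    moreover have "v x = 0" if "norm x > 1" for x
    proof -
      have "x \<notin> ?T" using TG that by force
      then show ?thesis using vo supp that by simp
    qed
    ultimately have "cell_field A v" by (simp add: cell_field_def)
    obtain CC where CC: "\<And>p. p \<in> range \<phi> \<Longrightarrow> compact (CC p) \<and> CC p \<subseteq> U \<and> (\<forall>x. \<xi> + p + \<Theta> p x \<in> CC p)"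
      using \<Theta>(1) unfolding admissible_def by metis
    let ?C = "C \<union> (\<Union>p\<in>F. CC (\<phi> (fst p)))"
    have "compact ?C" using C(1) fin CC by (intro compact_Un compact_UN) auto
    moreover have "?C \<subseteq> U" using C(2) CC by auto
    moreover have "\<xi> + v y \<in> ?C" for y
    proof (cases "y \<in> ?T")
      case True
      then obtain x r where xr: "(x, r) \<in> F" "y \<in> cball x r" by auto
      have "\<xi> + v y = \<xi> + \<phi> x + \<Theta> (\<phi> x) ((1 / r) *\<^sub>R (y - x))" using vb[OF xr] by (simp add: place_def)
      also have "\<dots> \<in> CC (\<phi> x)" using CC by blast
      finally show ?thesis using xr(1) by force
    next
      case False
      then show ?thesis using vo C(3) by simp
    qed
    ultimately show ?thesis using \<open>cell_field A v\<close> unfolding admissible_def by blast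
  qed
  then have vm: "v \<in> borel_measurable borel" by (auto simp: admissible_def cell_field_def pw_const_def)
  have vinU: "\<xi> + v y \<in> U" for y using vU by (auto simp: admissible_def)
  define k where "k y = (f (\<xi> + \<phi> y) + e1) / vol" for y
  have fb: "0 \<le> f (\<xi> + \<phi> y)" "f (\<xi> + \<phi> y) \<le> vol * M" for y
    using f_nonneg[OF inU] f_le_q[OF inU, of y] M(2)[OF inU, of y] vol_pos
    by (auto intro: order_trans[OF _ mult_left_mono])
  have fL: "(\<lambda>y. f (\<xi> + \<phi> y)) \<in> L_piec"
  proof (rule L_piec_combine[OF pw(2) pw(2)])
    show "bounded (range (\<lambda>y. f (\<xi> + \<phi> y)))"
      using fb by (auto simp: bounded_iff intro!: exI[of _ "vol * M"])
  qed simp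
  then have fm: "(\<lambda>y. f (\<xi> + \<phi> y)) \<in> borel_measurable lebesgue" by (rule L_piec_measurable)
  have km: "k \<in> borel_measurable lebesgue" unfolding k_def using fm by measurable
  have kb: "k y \<ge> 0" "\<bar>k y\<bar> \<le> (vol * M + e1) / vol" for y
    unfolding k_def using fb[of y] e1 vol_pos by (auto simp: divide_right_mono)
  have qm: "(\<lambda>y. q (\<xi> + v y)) \<in> borel_measurable lebesgue"
    using vm by (intro measurable_completion measurable_compose[OF _ q_measurable]) auto
  have qb: "\<bar>q (\<xi> + v y)\<bar> \<le> M" for y using q_nonneg[of "\<xi> + v y"] M(2)[OF vinU[of y]] by simp
  have Gl: "?G \<in> lmeasurable" by simp
  have main: "(LINT y|lebesgue. indicator ?T y * q (\<xi> + v y)) \<le> (LINT y|lebesgue. indicator ?G y * k y)"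
  proof (rule cell_family_integral_le[OF F(1) Gl qm qb km kb(2) _ kb(1)])
    fix x r assume xr: "(x, r) \<in> F"
    have r: "r > 0" using cell_familyD(1)[OF F(1) xr] by simp
    have cx: "\<phi> y = \<phi> x" if "y \<in> cball x r" for y
      using cell_familyD(4)[OF F(1) xr, of y] that by simp
    have \<Theta>m: "\<Theta> (\<phi> x) \<in> borel_measurable borel" using \<Theta>cf[of "\<phi> x"] by (auto simp: cell_field_def pw_const_def)
    have "(LINT y|lebesgue. indicator (cball x r) y * q (\<xi> + v y)) =
        (LINT y|lebesgue. indicator (cball x r) y * q ((\<xi> + \<phi> x) + place x r (\<Theta> (\<phi> x)) y))"
      using vb[OF xr] by (intro Bochner_Integration.integral_cong) (auto simp: indicator_def add.assoc)
    also have "\<dots> = r ^ DIM(real^'n) * cell_energy q (\<xi> + \<phi> x) (\<Theta> (\<phi> x))"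
      unfolding cell_energy_def by (rule integral_on_ball_place(1)[OF \<Theta>m q_cont r])
    also have "\<dots> \<le> r ^ DIM(real^'n) * (f (\<xi> + \<phi> x) + e1)"
      using \<Theta>(2)[of "\<phi> x"] r by (intro mult_left_mono) auto
    also have "\<dots> = measure lebesgue (cball x r) * k x"
      using integral_on_ball_place(2)[OF \<Theta>m q_cont r, of x] vol_pos by (simp add: k_def vol_def)
    also have "\<dots> = (LINT y|lebesgue. indicator (cball x r) y * k x)" by simp
    also have "\<dots> = (LINT y|lebesgue. indicator (cball x r) y * k y)"
    proof (rule Bochner_Integration.integral_cong)
      fix y
      show "indicator (cball x r) y * k x = indicator (cball x r) y * k y"
        using cx[of y] by (cases "y \<in> cball x r") (simp_all add: k_def)
    qed simp
    finally show "(LINT y|lebesgue. indicator (cball x r) y * q (\<xi> + v y)) \<le> (LINT y|lebesgue. indicator (cball x r) y * k y)" .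
  qed
  have int: "integrable lebesgue (\<lambda>y. indicator S y * h y)"
    if "S \<in> lmeasurable" "h \<in> borel_measurable lebesgue" "\<And>y. \<bar>h y\<bar> \<le> N" for S N and h :: "real^'n \<Rightarrow> real"
    using integrable_indicator_bounded[of h N S] that by simp
  have Tl: "?T \<in> lmeasurable" using fin by (intro fmeasurable.finite_UN) auto
  have GTl: "?G - ?T \<in> lmeasurable" using F(2) unfolding GT .
  have sphere0: "AE y in lebesgue. indicator (cball (0::real^'n) 1) y = (indicator ?G y :: real)"
  proof -
    have "sphere (0::real^'n) 1 \<in> null_sets lebesgue" using negligible_sphere negligible_iff_null_sets by blast
    then have "AE y in lebesgue. y \<notin> sphere (0::real^'n) 1" by (rule AE_not_in)
    then show ?thesis by (rule AE_mp) (auto simp: indicator_def)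
  qed
  have conv: "(LINT y|lebesgue. indicator (cball (0::real^'n) 1) y * h y) = (LINT y|lebesgue. indicator ?G y * h y)"
    if "h \<in> borel_measurable lebesgue" for h :: "real^'n \<Rightarrow> real"
  proof (rule integral_cong_AE)
    show "(\<lambda>y. indicator (cball (0::real^'n) 1) y * h y) \<in> borel_measurable lebesgue"
      "(\<lambda>y. indicator ?G y * h y) \<in> borel_measurable lebesgue"
      using that by (auto intro!: borel_measurable_times borel_measurable_indicator)
    show "AE y in lebesgue. indicator (cball (0::real^'n) 1) y * h y = indicator ?G y * h y"
      using sphere0 by (rule AE_mp) (rule AE_I2, simp)
  qed
  have "vol * f \<xi> \<le> vol * cell_energy q \<xi> v" using f_le[OF vU] vol_pos by simp
  also have "cell_energy q \<xi> v = (LINT y|lebesgue. indicator ?G y * q (\<xi> + v y))"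
    using energy_lebesgue[OF vm] conv[OF qm] by simp
  also have "\<dots> = (LINT y|lebesgue. indicator ?T y * q (\<xi> + v y) + indicator (?G - ?T) y * q (\<xi> + v y))"
    using TG by (intro Bochner_Integration.integral_cong) (auto simp: indicator_def)
  also have "\<dots> = (LINT y|lebesgue. indicator ?T y * q (\<xi> + v y)) + (LINT y|lebesgue. indicator (?G - ?T) y * q (\<xi> + v y))"
    by (intro Bochner_Integration.integral_add int[OF _ qm qb] Tl GTl)
  also have "\<dots> \<le> (LINT y|lebesgue. indicator ?G y * k y) + M * e2"
  proof (intro add_mono main)
    have "(LINT y|lebesgue. indicator (?G - ?T) y * q (\<xi> + v y)) \<le> (LINT y|lebesgue. indicator (?G - ?T) y * M)"
    proof (intro integral_mono int[OF GTl qm qb])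
      show "integrable lebesgue (\<lambda>y. indicator (?G - ?T) y * M)" using GTl by (intro int[of _ _ "\<bar>M\<bar>"]) auto
      show "indicator (?G - ?T) y * q (\<xi> + v y) \<le> indicator (?G - ?T) y * M" for y
        using M(2)[OF vinU[of y]] by (auto simp: indicator_def)
    qed
    also have "\<dots> = measure lebesgue (?G - ?T) * M" using GTl by simp
    also have "\<dots> \<le> e2 * M" using F(3) M(1) unfolding GT by (intro mult_right_mono) auto
    finally show "(LINT y|lebesgue. indicator (?G - ?T) y * q (\<xi> + v y)) \<le> M * e2" by (simp add: mult.commute)
  qed
  also have "(LINT y|lebesgue. indicator ?G y * k y) = (LINT y|lebesgue. indicator ?G y * f (\<xi> + \<phi> y)) / vol + e1"
  proof -
    have "measure lebesgue ?G = vol"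
      using conv[of "\<lambda>y. 1"] by (simp add: vol_def)
    moreover have "(\<lambda>y. indicator ?G y * k y) = (\<lambda>y. (1 / vol) * (indicator ?G y * f (\<xi> + \<phi> y)) + (e1 / vol) * indicator ?G y)"
      using vol_pos by (auto simp: k_def fun_eq_iff field_simps)
    moreover have "integrable lebesgue (\<lambda>y. indicator ?G y * f (\<xi> + \<phi> y))"
      using fb by (intro int[OF Gl fm, of "vol * M"]) auto
    moreover have "integrable lebesgue (indicator ?G :: _ \<Rightarrow> real)"
      using int[OF Gl, of "\<lambda>y. 1" 1] by simp
    ultimately show ?thesis using vol_pos by simp
  qed
  also have "vol * ((LINT y|lebesgue. indicator ?G y * f (\<xi> + \<phi> y)) / vol + e1 + M * e2) =
      (LINT y|lebesgue. indicator ?G y * f (\<xi> + \<phi> y)) + vol * e1 + vol * (M * e2)"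
    using vol_pos by (simp add: field_simps)
  also have "\<dots> \<le> (LINT y|lebesgue. indicator (cball (0::real^'n) 1) y * f (\<xi> + \<phi> y)) + e"
  proof -
    have "vol * (M * e2) \<le> vol * ((M + 1) * e2)" using vol_pos e2 by simp
    also have "\<dots> = e / 2"
    proof -
      have "M + 1 \<noteq> 0" "vol \<noteq> 0" using M(1) vol_pos by auto
      then show ?thesis by (simp add: e2_def)
    qed
    finally show ?thesis using vol_pos by (simp add: e1_def conv[OF fm])
  qed
  finally show "vol * f \<xi> \<le> (LINT y|lebesgue. indicator (cball (0::real^'n) 1) y * f (\<xi> + \<phi> y)) + e"
    using vol_pos by simp
qed

end

subsection \<open>Convexity of the relaxation along the characteristic cone\<close>

lemma cell_field_scale:
  assumes "cell_field A \<phi>" shows "cell_field A (\<lambda>x. c *\<^sub>R \<phi> x)"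
proof -
  have "distr_A_free A (\<lambda>x. c *\<^sub>R \<phi> x)"
    unfolding distr_A_free_def
  proof (intro allI impI)
    fix f :: "real^'a \<Rightarrow> real" assume "test_function f"
    then have "(LINT x|lebesgue. (\<Sum>i\<in>UNIV. partial_deriv i f x *\<^sub>R (A i *v \<phi> x))) = 0"
      using assms by (simp add: cell_field_def distr_A_free_def)
    moreover have "(\<Sum>i\<in>UNIV. partial_deriv i f x *\<^sub>R (A i *v (c *\<^sub>R \<phi> x))) =
        c *\<^sub>R (\<Sum>i\<in>UNIV. partial_deriv i f x *\<^sub>R (A i *v \<phi> x))" for x
      by (simp add: scaleR_sum_right matrix_vector_mult_scaleR mult.commute)
    ultimately show "(LINT x|lebesgue. (\<Sum>i\<in>UNIV. partial_deriv i f x *\<^sub>R (A i *v (c *\<^sub>R \<phi> x)))) = 0"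
      by simp
  qed
  moreover have "pw_const (\<lambda>x. c *\<^sub>R \<phi> x)"
    using assms by (intro pw_const_map[OF _ bounded_linear_scaleR_right]) (simp add: cell_field_def)
  ultimately show ?thesis using assms by (simp add: cell_field_def)
qed

lemma cone_cells:
  fixes A :: "'n::finite \<Rightarrow> real^'d^'m"
  assumes rank: "\<And>w. w \<noteq> 0 \<Longrightarrow> rank (op_symbol A w) = CARD('m)"
    and v: "v \<in> char_cone A"
  obtains h :: "real^'n \<Rightarrow> real" and C R \<eta> where "pw_const h" "R > 0" "\<And>x. norm x > R \<Longrightarrow> h x = 0"
    "\<eta> > 0" "measure lborel {x. h x \<le> - \<eta>} > 0"
    "\<And>\<epsilon>. 0 < \<epsilon> \<Longrightarrow> \<epsilon> \<le> 1 \<Longrightarrow> \<exists>\<phi> L. linear L \<and> bij L \<and> cell_field A \<phi> \<and>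
      (\<forall>x. norm (\<phi> x - h (L x) *\<^sub>R v) \<le> C * \<epsilon>) \<and> (\<forall>x. norm (L x) > R \<longrightarrow> \<phi> x = 0) \<and>
      (\<forall>x. norm (L x) \<le> R \<longrightarrow> norm x \<le> 1)"
proof -
  obtain h :: "real^'n \<Rightarrow> real" and C R \<eta> where h: "pw_const h" "R > 0" "\<And>x. norm x > R \<Longrightarrow> h x = 0"
    "\<eta> > 0" "measure lborel {x. h x \<le> - \<eta>} > 0"
    and fields: "\<And>\<epsilon>. 0 < \<epsilon> \<Longrightarrow> \<epsilon> \<le> 1 \<Longrightarrow> \<exists>\<phi> L. linear L \<and> bij L \<and> pw_const \<phi> \<and> distr_A_free A \<phi> \<and>
      (\<integral>x. \<phi> x \<partial>lborel) = 0 \<and> (\<forall>x. norm (\<phi> x - h (L x) *\<^sub>R v) \<le> C * \<epsilon>) \<and> (\<forall>x. norm (L x) > R \<longrightarrow> \<phi> x = 0)"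
    by (rule anisotropic_fields[OF rank v]) (assumption, rule that)
  show ?thesis
  proof (rule that[OF h])
    fix \<epsilon> :: real assume "0 < \<epsilon>" "\<epsilon> \<le> 1"
    then obtain \<phi> L where L: "linear L" "bij L" and \<phi>: "pw_const \<phi>" "distr_A_free A \<phi>" "(\<integral>x. \<phi> x \<partial>lborel) = 0"
      and near: "\<And>x. norm (\<phi> x - h (L x) *\<^sub>R v) \<le> C * \<epsilon>" and supp: "\<And>x. norm (L x) > R \<Longrightarrow> \<phi> x = 0"
      using fields by blast
    obtain B where B: "B > 0" "\<And>x. B * norm x \<le> norm (L x)"
      using linear_inj_bounded_below_pos[OF L(1)] L(2) by (auto simp: bij_def)
    define s where "s = max 1 (R / B)"
    have s: "s > 0" "R \<le> B * s"
      using B(1) by (auto simp: s_def max_def field_simps)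
    define \<psi> where "\<psi> = place 0 (1 / s) \<phi>"
    define T where "T x = L (s *\<^sub>R x)" for x
    have \<psi>: "\<psi> x = \<phi> (s *\<^sub>R x)" for x by (simp add: \<psi>_def place_def)
    have big: "norm (T x) \<ge> (B * s) * norm x" for x using B(2)[of "s *\<^sub>R x"] s(1) by (simp add: T_def)
    have Bs: "B * s > 0" using B(1) s(1) by simp
    have lT: "linear T" "bij T"
      using scale_linear_bij[of s] s(1) L linear_compose[of "\<lambda>x. s *\<^sub>R x" L] bij_comp[of "\<lambda>x. s *\<^sub>R x" L]
      by (auto simp: T_def[abs_def] o_def)
    have "cell_field A \<psi>"
      unfolding cell_field_def
    proof (intro conjI allI impI)
      show "pw_const \<psi>" unfolding \<psi>_def using \<phi>(1) s(1) by (intro pw_const_place) auto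
      show "distr_A_free A \<psi>" unfolding \<psi>_def using \<phi>(1,2) s(1) by (intro distr_A_free_place) (auto simp: pw_const_def)
      show "(\<integral>x. \<psi> x \<partial>lborel) = 0"
        unfolding \<psi>_def using integral_place[of \<phi> "1 / s" 0] \<phi>(1,3) s(1) by (simp add: pw_const_def)
      fix x :: "real^'n" assume "norm x > 1"
      then have "B * s * 1 < B * s * norm x" using Bs by (intro mult_strict_left_mono)
      then have "norm (L (s *\<^sub>R x)) > R" using big[of x] s(2) by (simp add: T_def)
      then show "\<psi> x = 0" unfolding \<psi> by (rule supp)
    qed
    moreover have "norm x \<le> 1" if "norm (T x) \<le> R" for x
    proof (rule ccontr)
      assume "\<not> norm x \<le> 1"
      then have "B * s * 1 < B * s * norm x" using Bs by (intro mult_strict_left_mono) auto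
      then show False using big[of x] s(2) that by simp
    qed
    ultimately show "\<exists>\<phi> L. linear L \<and> bij L \<and> cell_field A \<phi> \<and>
      (\<forall>x. norm (\<phi> x - h (L x) *\<^sub>R v) \<le> C * \<epsilon>) \<and> (\<forall>x. norm (L x) > R \<longrightarrow> \<phi> x = 0) \<and>
      (\<forall>x. norm (L x) \<le> R \<longrightarrow> norm x \<le> 1)"
      using lT near supp by (intro exI[of _ \<psi>] exI[of _ T]) (auto simp: T_def \<psi>)
  qed
qed

lemma usc_attains_sup:
  fixes g :: "real \<Rightarrow> real"
  assumes usc: "\<And>s c. s \<in> {0..1} \<Longrightarrow> g s < c \<Longrightarrow> \<exists>d>0. \<forall>s'\<in>{0..1}. \<bar>s' - s\<bar> < d \<longrightarrow> g s' < c"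
    and bd: "\<And>s. s \<in> {0..1} \<Longrightarrow> g s \<le> B"
  shows "\<exists>s\<in>{0..1}. \<forall>s'\<in>{0..1}. g s' \<le> g s"
proof (rule ccontr)
  assume no: "\<not> ?thesis"
  define m where "m = Sup (g ` {0..1})"
  have bdd: "bdd_above (g ` {0..1})" using bd by (auto intro: bdd_aboveI[of _ B])
  have le: "g s \<le> m" if "s \<in> {0..1}" for s unfolding m_def using that by (intro cSup_upper bdd) auto
  have lt: "g s < m" if "s \<in> {0..1}" for s
  proof -
    obtain s' where "s' \<in> {0..1}" "g s < g s'" using no \<open>s \<in> {0..1}\<close> by force
    then show ?thesis using le[of s'] by simp
  qed
  have "\<forall>s\<in>{0..1}. \<exists>d>0. \<forall>s'\<in>{0..1}. \<bar>s' - s\<bar> < d \<longrightarrow> g s' < (g s + m) / 2"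
  proof
    fix s :: real assume s: "s \<in> {0..1}"
    have "g s < (g s + m) / 2" using lt[OF s] by simp
    then show "\<exists>d>0. \<forall>s'\<in>{0..1}. \<bar>s' - s\<bar> < d \<longrightarrow> g s' < (g s + m) / 2" by (rule usc[OF s])
  qed
  then obtain d where d: "\<And>s. s \<in> {0..1} \<Longrightarrow> d s > 0"
    "\<And>s s'. s \<in> {0..1} \<Longrightarrow> s' \<in> {0..1} \<Longrightarrow> \<bar>s' - s\<bar> < d s \<Longrightarrow> g s' < (g s + m) / 2"
    by metis
  obtain K where K: "K \<subseteq> {0..1}" "finite K" "{0..1} \<subseteq> (\<Union>s\<in>K. ball s (d s))"
  proof (rule compactE_image[of "{0..1::real}" "{0..1}" "\<lambda>s. ball s (d s)"])
    show "{0..1} \<subseteq> (\<Union>s\<in>{0..1}. ball s (d s))" using d(1) by force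
  qed auto
  have "K \<noteq> {}" using K(3) by force
  define M where "M = Max ((\<lambda>s. (g s + m) / 2) ` K)"
  have "M < m" unfolding M_def using K(1,2) \<open>K \<noteq> {}\<close> lt by (subst Max_less_iff) (auto simp: field_simps subset_eq)
  have "g s \<le> M" if s: "s \<in> {0..1}" for s
  proof -
    obtain k where k: "k \<in> K" "s \<in> ball k (d k)" using K(3) s by blast
    then have "g s < (g k + m) / 2" using d(2)[of k s] K(1) s by (auto simp: dist_real_def abs_minus_commute)
    also have "\<dots> \<le> M" unfolding M_def using K(2) k(1) by (intro Max_ge) auto
    finally show ?thesis by simp
  qed
  then have "m \<le> M" unfolding m_def by (intro cSup_least) auto
  then show False using \<open>M < m\<close> by simp
qed

text \<open>If convexity failed along a direction \<open>v\<close> of the cone, then \<open>f\<close> would be touched from above,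
  at an interior point of the segment, by a function which is strictly concave along \<open>v\<close> and
  affine across. Oscillating a little along \<open>v\<close> then contradicts the subaverage inequality.\<close>

lemma (in relaxed_energy) convex_along_cone:
  assumes rank: "\<And>w. w \<noteq> 0 \<Longrightarrow> rank (op_symbol A w) = CARD('m)"
    and v: "v \<in> char_cone A" "v \<noteq> 0"
    and seg: "\<And>s. s \<in> {0..1} \<Longrightarrow> a + s *\<^sub>R v \<in> U"
    and s1: "s1 \<in> {0..1}"
  shows "f (a + s1 *\<^sub>R v) \<le> f a + s1 * (f (a + v) - f a)"
proof (rule ccontr)
  assume contr: "\<not> ?thesis"
  define \<Delta> where "\<Delta> = f (a + v) - f a"
  define \<kappa> where "\<kappa> = (f (a + s1 *\<^sub>R v) - (f a + s1 * \<Delta>)) / 2"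
  have \<kappa>: "\<kappa> > 0" using contr by (simp add: \<kappa>_def \<Delta>_def)
  define l where "l s = f a + s * \<Delta> - \<kappa> * s\<^sup>2" for s
  define g where "g s = f (a + s *\<^sub>R v) - l s" for s
  have lc: "continuous_on UNIV l" unfolding l_def by (intro continuous_intros)
  obtain M where M: "M \<ge> 0" "\<And>p. p \<in> U \<Longrightarrow> q p \<le> M" using q_bound by blast
  have "\<exists>s\<in>{0..1}. \<forall>s'\<in>{0..1}. g s' \<le> g s"
  proof (rule usc_attains_sup)
    fix s c :: real assume s: "s \<in> {0..1}" and gc: "g s < c"
    define e where "e = (c - g s) / 2"
    have e: "e > 0" using gc by (simp add: e_def)
    obtain \<delta> where \<delta>: "\<delta> > 0" "\<And>\<eta>. \<eta> \<in> ball (a + s *\<^sub>R v) \<delta> \<Longrightarrow> f \<eta> < f (a + s *\<^sub>R v) + e"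
      using upper_semicontinuous[OF seg[OF s], of "f (a + s *\<^sub>R v) + e"] e by auto
    obtain d where d: "d > 0" "\<And>s'. dist s' s < d \<Longrightarrow> dist (l s') (l s) < e"
      using lc e unfolding continuous_on_iff by blast
    show "\<exists>d>0. \<forall>s'\<in>{0..1}. \<bar>s' - s\<bar> < d \<longrightarrow> g s' < c"
    proof (intro exI[of _ "min d (\<delta> / norm v)"] conjI ballI impI)
      show "min d (\<delta> / norm v) > 0" using d \<delta> v(2) by simp
      fix s' assume "s' \<in> {0..1}" and near: "\<bar>s' - s\<bar> < min d (\<delta> / norm v)"
      have "norm ((s' - s) *\<^sub>R v) = \<bar>s' - s\<bar> * norm v" by (rule norm_scaleR)
      also have "\<dots> < \<delta>" using near v(2) by (simp add: pos_less_divide_eq)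
      finally have "norm ((s' - s) *\<^sub>R v) < \<delta>" .
      then have "a + s' *\<^sub>R v \<in> ball (a + s *\<^sub>R v) \<delta>"
      proof -
        have "dist (a + s *\<^sub>R v) (a + s' *\<^sub>R v) = norm ((s' - s) *\<^sub>R v)"
          unfolding dist_norm scaleR_diff_left by (subst norm_minus_commute) simp
        then show ?thesis using \<open>norm ((s' - s) *\<^sub>R v) < \<delta>\<close> by (simp only: mem_ball)
      qed
      from \<delta>(2)[OF this] have "f (a + s' *\<^sub>R v) < f (a + s *\<^sub>R v) + e" .
      moreover have "l s' > l s - e" using d(2)[of s'] near by (auto simp: dist_real_def abs_less_iff)
      ultimately show "g s' < c" by (simp add: g_def e_def field_simps)
    qed
  next
    fix s :: real assume s: "s \<in> {0..1}"
    have "f (a + s *\<^sub>R v) \<le> vol * M" using f_le_q[OF seg[OF s]] M(2)[OF seg[OF s]] vol_pos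
      by (meson mult_left_mono less_imp_le order_trans)
    moreover have "compact (l ` {0..1})" using lc by (intro compact_continuous_image) (auto intro: continuous_on_subset)
    then have "bdd_below (l ` {0..1})" by (intro bounded_imp_bdd_below compact_imp_bounded)
    then have "Inf (l ` {0..1}) \<le> l s" using s by (intro cInf_lower) auto
    ultimately show "g s \<le> vol * M - Inf (l ` {0..1})" by (simp add: g_def)
  qed
  then obtain s where s: "s \<in> {0..1}" "\<And>s'. s' \<in> {0..1} \<Longrightarrow> g s' \<le> g s" by blast
  have gs: "g s > \<kappa>"
  proof -
    have "g s1 = 2 * \<kappa> + \<kappa> * s1\<^sup>2" by (simp add: g_def l_def \<kappa>_def)
    then have "g s1 > \<kappa>" using \<kappa> by (simp add: add_pos_nonneg)
    then show ?thesis using s(2)[OF s1] by simp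
  qed
  have g01: "g 0 = 0" "g 1 = \<kappa>" by (simp_all add: g_def l_def \<Delta>_def)
  have sint: "0 < s" "s < 1" using s(1) gs g01 \<kappa> by (auto simp: less_le)
  define m where "m = g s"
  define \<xi> where "\<xi> = a + s *\<^sub>R v"
  have vv: "v \<bullet> v > 0" "norm v > 0" using v(2) by auto
  define t where "t p = ((p - a) \<bullet> v) / (v \<bullet> v)" for p
  have t: "t (a + r *\<^sub>R v) = r" for r using vv by (simp add: t_def)
  define P where "P p = l (t p) + m" for p
  have Pc: "continuous_on UNIV P"
    unfolding P_def l_def t_def by (intro continuous_intros) (use vv in auto)
  have fP: "f (a + r *\<^sub>R v) \<le> P (a + r *\<^sub>R v)" if "r \<in> {0..1}" for r
    using s(2)[OF that] by (simp add: P_def t m_def g_def)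
  have f\<xi>: "f \<xi> = P \<xi>" by (simp add: P_def t m_def g_def \<xi>_def)
  obtain h :: "real^'n \<Rightarrow> real" and C R \<eta> where h: "pw_const h" "R > 0" "\<And>x. norm x > R \<Longrightarrow> h x = 0"
    "\<eta> > 0" "measure lborel {x. h x \<le> - \<eta>} > 0"
    and cells: "\<And>\<epsilon>. 0 < \<epsilon> \<Longrightarrow> \<epsilon> \<le> 1 \<Longrightarrow> \<exists>\<phi> L. linear L \<and> bij L \<and> cell_field A \<phi> \<and>
      (\<forall>x. norm (\<phi> x - h (L x) *\<^sub>R v) \<le> C * \<epsilon>) \<and> (\<forall>x. norm (L x) > R \<longrightarrow> \<phi> x = 0) \<and>
      (\<forall>x. norm (L x) \<le> R \<longrightarrow> norm x \<le> 1)"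
    by (rule cone_cells[OF rank v(1)]) (assumption, rule that)
  have hm: "h \<in> borel_measurable borel" using h(1) by (simp add: pw_const_def)
  obtain H0 where H0: "\<And>x. \<bar>h x\<bar> \<le> H0" using h(1) by (auto simp: pw_const_def L_piec_def bounded_iff)
  define H where "H = max 1 H0"
  have H: "H \<ge> 1" "\<And>x. \<bar>h x\<bar> \<le> H" using order_trans[OF H0] by (auto simp: H_def)
  define \<rho> where "\<rho> = min s (1 - s) / H"
  have \<rho>: "\<rho> > 0" using sint H by (simp add: \<rho>_def)
  have \<rho>h: "s + \<rho> * h x \<in> {0..1}" for x
  proof -
    have "\<bar>\<rho> * h x\<bar> \<le> \<rho> * H" using H(2)[of x] \<rho> by (simp add: abs_mult)
    also have "\<dots> = min s (1 - s)" using H(1) by (simp add: \<rho>_def)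
    finally show ?thesis by (auto simp: abs_le_iff)
  qed
  define \<mu> where "\<mu> = measure lborel {x. h x \<le> - \<eta>}"
  define \<beta> where "\<beta> = measure lborel (cball (0::real^'n) R)"
  have \<mu>: "\<mu> > 0" using h(5) by (simp add: \<mu>_def)
  have \<beta>: "\<beta> > 0" unfolding \<beta>_def using content_cball_pos[OF h(2), of "0::real^'n"] by simp
  define gain where "gain = \<kappa> * (\<rho> * \<eta> / 2)\<^sup>2"
  have gain: "gain > 0" using \<kappa> \<rho> h(4) by (simp add: gain_def)
  define e where "e = gain * \<mu> / (2 * \<beta>)"
  have e: "e > 0" using gain \<mu> \<beta> by (simp add: e_def)
  define \<gamma> where "\<gamma> = (\<lambda>r. a + r *\<^sub>R v) ` {0..1}"
  define W where "W = {p \<in> U. f p < P p + e}"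
  have "open W"
    unfolding open_contains_ball
  proof
    fix p assume "p \<in> W"
    then have p: "p \<in> U" "f p < P p + e" by (auto simp: W_def)
    define e' where "e' = (P p + e - f p) / 2"
    have e': "e' > 0" using p by (simp add: e'_def)
    obtain d1 where d1: "d1 > 0" "\<And>y. y \<in> ball p d1 \<Longrightarrow> y \<in> U \<and> f y < f p + e'"
      using upper_semicontinuous[OF p(1), of "f p + e'"] e' by auto
    obtain d2 where d2: "d2 > 0" "\<And>y. dist y p < d2 \<Longrightarrow> dist (P y) (P p) < e'"
      using Pc e' unfolding continuous_on_iff by blast
    have "y \<in> W" if y: "y \<in> ball p (min d1 d2)" for y
    proof -
      have "y \<in> U \<and> f y < f p + e'" using d1(2) y by simp
      moreover have "\<bar>P y - P p\<bar> < e'" using d2(2)[of y] y by (simp add: dist_commute dist_real_def)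
      moreover have "2 * e' = P p + e - f p" by (simp add: e'_def)
      ultimately have "f y < P y + e" by (simp add: abs_less_iff)
      then show ?thesis using \<open>y \<in> U \<and> f y < f p + e'\<close> by (simp add: W_def)
    qed
    then show "\<exists>e>0. ball p e \<subseteq> W" using d1(1) d2(1) by (intro exI[of _ "min d1 d2"]) auto
  qed
  moreover have \<gamma>c: "compact \<gamma>" unfolding \<gamma>_def by (intro compact_continuous_image continuous_intros) auto
  moreover have "\<gamma> \<subseteq> W" using seg fP e by (fastforce simp: \<gamma>_def W_def)
  ultimately obtain \<epsilon>0 where \<epsilon>0: "\<epsilon>0 > 0" "(\<Union>x\<in>\<gamma>. ball x \<epsilon>0) \<subseteq> W"
    using compact_subset_open_imp_ball_epsilon_subset by metis
  define C' where "C' = \<bar>C\<bar> + 1"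
  have C': "C' > 0" "C \<le> C'" by (auto simp: C'_def)
  define \<epsilon> where "\<epsilon> = min 1 (min (\<epsilon>0 / (2 * \<rho> * C')) (\<eta> * norm v / (2 * C')))"
  have \<epsilon>: "\<epsilon> > 0" "\<epsilon> \<le> 1" using \<epsilon>0(1) \<rho> C' h(4) vv by (auto simp: \<epsilon>_def)
  have \<epsilon>1: "\<rho> * (C' * \<epsilon>) < \<epsilon>0"
  proof -
    have "\<epsilon> \<le> \<epsilon>0 / (2 * \<rho> * C')" by (simp add: \<epsilon>_def)
    then have "\<rho> * (C' * \<epsilon>) \<le> \<rho> * (C' * (\<epsilon>0 / (2 * \<rho> * C')))" using \<rho> C' by (intro mult_left_mono) auto
    also have "\<dots> < \<epsilon>0" using \<rho> C' \<epsilon>0(1) by simp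
    finally show ?thesis .
  qed
  have \<epsilon>2: "C' * \<epsilon> \<le> \<eta> * norm v / 2"
  proof -
    have "\<epsilon> \<le> \<eta> * norm v / (2 * C')" by (simp add: \<epsilon>_def)
    then have "C' * \<epsilon> \<le> C' * (\<eta> * norm v / (2 * C'))" using C' by (intro mult_left_mono) auto
    then show ?thesis using C' by simp
  qed
  obtain \<phi> L where L: "linear L" "bij L" and cf: "cell_field A \<phi>"
    and near0: "\<And>x. norm (\<phi> x - h (L x) *\<^sub>R v) \<le> C * \<epsilon>"
    and supp: "\<And>x. norm (L x) > R \<Longrightarrow> \<phi> x = 0" and unit: "\<And>x. norm (L x) \<le> R \<Longrightarrow> norm x \<le> 1"
    using cells[OF \<epsilon>] by blast
  have near: "norm (\<phi> x - h (L x) *\<^sub>R v) \<le> C' * \<epsilon>" for x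
    using near0[of x] C'(2) \<epsilon>(1) by (meson mult_right_mono less_imp_le order_trans)
  define \<psi> where "\<psi> x = \<rho> *\<^sub>R \<phi> x" for x
  have \<psi>cf: "cell_field A \<psi>" unfolding \<psi>_def using cf by (rule cell_field_scale)
  then have \<psi>pw: "pw_const \<psi>" "\<psi> \<in> L_piec" "\<psi> \<in> borel_measurable borel" by (auto simp: cell_field_def pw_const_def)
  define D where "D = {x + y |x y. x \<in> \<gamma> \<and> y \<in> cball 0 (\<rho> * (C' * \<epsilon>))}"
  have D: "compact D" unfolding D_def using \<gamma>c by (intro compact_sums) auto
  have DW: "D \<subseteq> W"
  proof
    fix z assume "z \<in> D"
    then obtain x y where "z = x + y" "x \<in> \<gamma>" "norm y \<le> \<rho> * (C' * \<epsilon>)" by (auto simp: D_def)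
    then have "z \<in> ball x \<epsilon>0" using \<epsilon>1 by (simp add: dist_norm)
    then show "z \<in> W" using \<epsilon>0(2) \<open>x \<in> \<gamma>\<close> by blast
  qed
  have inD: "\<xi> + \<psi> x \<in> D" for x
  proof -
    have "\<xi> + \<psi> x = (a + (s + \<rho> * h (L x)) *\<^sub>R v) + \<rho> *\<^sub>R (\<phi> x - h (L x) *\<^sub>R v)"
      by (simp add: \<xi>_def \<psi>_def algebra_simps)
    moreover have "a + (s + \<rho> * h (L x)) *\<^sub>R v \<in> \<gamma>" unfolding \<gamma>_def using \<rho>h by blast
    moreover have "norm (\<rho> *\<^sub>R (\<phi> x - h (L x) *\<^sub>R v)) \<le> \<rho> * (C' * \<epsilon>)" using near[of x] \<rho> by simp
    ultimately show ?thesis unfolding D_def by (intro CollectI exI conjI) auto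
  qed
  then have inW: "\<xi> + \<psi> x \<in> U" "f (\<xi> + \<psi> x) < P (\<xi> + \<psi> x) + e" for x using DW by (auto simp: W_def)
  have adm: "admissible A U \<xi> \<psi>"
    unfolding admissible_def using \<psi>cf D DW inD by (auto simp: W_def intro!: exI[of _ D])
  define \<tau> where "\<tau> x = (\<psi> x \<bullet> v) / (v \<bullet> v)" for x
  define k where "k = \<Delta> - 2 * \<kappa> * s"
  have P\<psi>: "P (\<xi> + \<psi> x) = f \<xi> + k * \<tau> x - \<kappa> * (\<tau> x)\<^sup>2" for x
  proof -
    have "t (\<xi> + \<psi> x) = s + \<tau> x"
      using vv by (simp add: t_def \<tau>_def \<xi>_def inner_add_left add_divide_distrib)
    moreover have "t \<xi> = s" by (simp add: \<xi>_def t)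
    ultimately show ?thesis unfolding f\<xi> by (simp add: P_def l_def k_def power2_eq_square algebra_simps)
  qed
  let ?B = "{x. h (L x) \<le> - \<eta>}" and ?cell = "{x. norm (L x) \<le> R}" and ?Q = "cball (0::real^'n) 1"
  have Bcell: "?B \<subseteq> ?cell" using h(3,4) by (force simp: not_le[symmetric])
  have cellQ: "?cell \<subseteq> ?Q" using unit by auto
  have \<tau>B: "(\<rho> * \<eta> / 2)\<^sup>2 \<le> (\<tau> x)\<^sup>2" if "x \<in> ?B" for x
  proof -
    have "\<tau> x / \<rho> - h (L x) = ((\<phi> x - h (L x) *\<^sub>R v) \<bullet> v) / (v \<bullet> v)"
      using \<rho> vv by (simp add: \<tau>_def \<psi>_def inner_diff_left diff_divide_distrib)
    also have "\<dots> \<le> (C' * \<epsilon> * norm v) / (v \<bullet> v)"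
    proof (rule divide_right_mono)
      have "(\<phi> x - h (L x) *\<^sub>R v) \<bullet> v \<le> norm (\<phi> x - h (L x) *\<^sub>R v) * norm v" by (rule norm_cauchy_schwarz)
      also have "\<dots> \<le> C' * \<epsilon> * norm v" using near[of x] by (intro mult_right_mono) auto
      finally show "(\<phi> x - h (L x) *\<^sub>R v) \<bullet> v \<le> C' * \<epsilon> * norm v" .
    qed (use vv in simp)
    also have "\<dots> \<le> (\<eta> * norm v / 2 * norm v) / (v \<bullet> v)"
      using \<epsilon>2 vv by (intro divide_right_mono mult_right_mono) auto
    also have "\<dots> = \<eta> / 2" using vv by (simp add: dot_square_norm power2_eq_square)
    finally have "\<tau> x / \<rho> - h (L x) \<le> \<eta> / 2" .
    moreover have "h (L x) \<le> - \<eta>" using that by simp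
    ultimately have "\<tau> x / \<rho> \<le> - (\<eta> / 2)" by linarith
    then have "\<tau> x \<le> - (\<rho> * \<eta> / 2)" using \<rho> by (simp add: field_simps)
    then have "\<rho> * \<eta> / 2 \<le> - \<tau> x" by simp
    then have "(\<rho> * \<eta> / 2)\<^sup>2 \<le> (- \<tau> x)\<^sup>2" using \<rho> h(4) by (intro power_mono) auto
    then show ?thesis by simp
  qed
  have Lm: "L \<in> borel_measurable borel"
    using L(1) by (intro borel_measurable_continuous_onI linear_continuous_on) (simp add: linear_conv_bounded_linear)
  have hLm: "(\<lambda>x. h (L x)) \<in> borel_measurable borel" using Lm hm by (rule measurable_compose)
  have Bs: "?B \<in> sets borel" using borel_measurable_le[OF hLm borel_measurable_const[of "- \<eta>"]] by simp
  have cells: "?cell \<in> sets borel"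
    using borel_measurable_le[OF measurable_compose[OF Lm borel_measurable_norm] borel_measurable_const[of R]] by simp
  obtain c where c: "c > 0" "\<And>g :: real^'n \<Rightarrow> real. g \<in> borel_measurable borel \<Longrightarrow> (\<integral>x. g (L x) \<partial>lborel) = c * (\<integral>x. g x \<partial>lborel)"
    using lborel_linear_substitution[OF L] by blast
  have mB: "measure lebesgue ?B = c * \<mu>"
  proof -
    have s0: "{x. h x \<le> - \<eta>} \<in> sets borel" using borel_measurable_le[OF hm borel_measurable_const[of "- \<eta>"]] by simp
    have "(\<integral>x. indicator {x. h x \<le> - \<eta>} (L x) \<partial>lborel) = c * (\<integral>x. indicator {x. h x \<le> - \<eta>} x \<partial>lborel)"
      using s0 by (intro c) auto
    moreover have "(\<lambda>x. indicator {x. h x \<le> - \<eta>} (L x) :: real) = indicator ?B" by (auto simp: indicator_def)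
    ultimately show ?thesis using Bs by (simp add: \<mu>_def)
  qed
  have mcell: "measure lebesgue ?cell = c * \<beta>"
  proof -
    have "(\<integral>x. indicator (cball 0 R) (L x) \<partial>lborel) = c * (\<integral>x. indicator (cball (0::real^'n) R) x \<partial>lborel)"
      by (intro c borel_measurable_indicator borel_closed closed_cball)
    moreover have "(\<lambda>x. indicator (cball 0 R) (L x) :: real) = indicator ?cell" by (auto simp: indicator_def)
    ultimately show ?thesis using cells by (simp add: \<beta>_def)
  qed
  have Ql: "?Q \<in> lmeasurable" by simp
  have celll: "?cell \<in> lmeasurable" using cells by (intro fmeasurableI2[OF Ql cellQ]) simp
  have Bl: "?B \<in> lmeasurable" using Bs by (intro fmeasurableI2[OF celll Bcell]) simp
  have \<tau>pw: "pw_const \<tau>"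
    unfolding \<tau>_def[abs_def]
    by (rule pw_const_map[OF \<psi>pw(1) bounded_linear_compose[OF bounded_linear_divide bounded_linear_inner_left]])
  have \<tau>m: "\<tau> \<in> borel_measurable lebesgue" using \<tau>pw by (intro L_piec_measurable) (simp add: pw_const_def)
  obtain b\<tau> where b\<tau>: "\<And>x. \<bar>\<tau> x\<bar> \<le> b\<tau>" using \<tau>pw by (auto simp: pw_const_def L_piec_def bounded_iff)
  have int: "integrable lebesgue (\<lambda>y. indicator S y * h y)"
    if "S \<in> lmeasurable" "h \<in> borel_measurable lebesgue" "\<And>y. \<bar>h y\<bar> \<le> N" for S N and h :: "real^'n \<Rightarrow> real"
    using integrable_indicator_bounded[of h N S] that by simp
  have int1: "integrable lebesgue (indicator S :: _ \<Rightarrow> real)" if "S \<in> lmeasurable" for S :: "(real^'n) set"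
    using int[OF that, of "\<lambda>y. 1" 1] by simp
  have \<tau>int: "(LINT y|lebesgue. indicator ?Q y * \<tau> y) = 0"
  proof -
    have ind\<tau>: "indicator ?Q y * \<tau> y = \<tau> y" for y
    proof -
      have "\<psi> y = 0" if "y \<notin> ?Q" using \<psi>cf that by (auto simp: cell_field_def not_le)
      then show ?thesis by (auto simp: indicator_def \<tau>_def)
    qed
    have "(LINT y|lebesgue. indicator ?Q y * \<tau> y) = (\<integral>y. \<tau> y \<partial>lborel)"
      unfolding ind\<tau> using \<tau>pw by (simp add: integral_completion pw_const_def)
    also have "\<dots> = ((\<integral>y. \<psi> y \<partial>lborel) \<bullet> v) / (v \<bullet> v)"
    proof -
      obtain N where N: "\<And>x. norm (\<psi> x) \<le> N" using \<psi>pw(2) by (auto simp: L_piec_def bounded_iff)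
      have "integrable lborel \<psi>"
      proof (rule integrableI_bounded_set[where A = ?Q])
        show "emeasure lborel ?Q < \<infinity>" by (intro emeasure_bounded_finite) simp
        show "AE x in lborel. x \<in> ?Q \<longrightarrow> norm (\<psi> x) \<le> N" using N by auto
        show "AE x in lborel. x \<notin> ?Q \<longrightarrow> \<psi> x = 0" using \<psi>cf by (auto simp: cell_field_def)
      qed (use \<psi>pw in auto)
      then show ?thesis by (simp add: \<tau>_def)
    qed
    also have "\<dots> = 0" using \<psi>cf by (simp add: cell_field_def)
    finally show ?thesis .
  qed
  have fb: "0 \<le> f (\<xi> + \<psi> y)" "f (\<xi> + \<psi> y) \<le> vol * M" for y
    using f_nonneg[OF inW(1)] f_le_q[OF inW(1), of y] M(2)[OF inW(1), of y] vol_pos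
    by (auto intro: order_trans[OF _ mult_left_mono])
  have "(\<lambda>y. f (\<xi> + \<psi> y)) \<in> L_piec"
  proof (rule L_piec_combine[OF \<psi>pw(2) \<psi>pw(2)])
    show "bounded (range (\<lambda>y. f (\<xi> + \<psi> y)))"
      using fb by (auto simp: bounded_iff intro!: exI[of _ "vol * M"])
  qed simp
  then have fm: "(\<lambda>y. f (\<xi> + \<psi> y)) \<in> borel_measurable lebesgue" by (rule L_piec_measurable)
  let ?bound = "\<lambda>y. f \<xi> * indicator ?Q y + k * (indicator ?Q y * \<tau> y) - gain * indicator ?B y + e * indicator ?cell y"
  have ib: "integrable lebesgue ?bound"
    by (intro Bochner_Integration.integrable_add Bochner_Integration.integrable_diff integrable_mult_right
        int1 int[OF Ql \<tau>m b\<tau>] Ql Bl celll)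
  have "vol * f \<xi> \<le> (LINT y|lebesgue. indicator ?Q y * f (\<xi> + \<psi> y))" by (rule subaverage[OF adm])
  also have "\<dots> \<le> (LINT y|lebesgue. ?bound y)"
  proof (rule integral_mono[OF int[OF Ql fm, of "vol * M"] ib])
    show "\<bar>f (\<xi> + \<psi> y)\<bar> \<le> vol * M" for y using fb[of y] by simp
    fix y
    show "indicator ?Q y * f (\<xi> + \<psi> y) \<le> ?bound y"
    proof (cases "y \<in> ?cell")
      case True
      then have yQ: "y \<in> ?Q" using cellQ by blast
      have "f (\<xi> + \<psi> y) \<le> f \<xi> + k * \<tau> y - \<kappa> * (\<tau> y)\<^sup>2 + e" using inW(2)[of y] P\<psi>[of y] by simp
      moreover have "gain * indicator ?B y \<le> \<kappa> * (\<tau> y)\<^sup>2"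
        using \<tau>B[of y] \<kappa> by (auto simp: indicator_def gain_def intro!: mult_left_mono)
      ultimately show ?thesis using True yQ by simp
    next
      case False
      then have "\<psi> y = 0" using supp by (simp add: \<psi>_def)
      moreover have "y \<notin> ?B" using False Bcell by blast
      ultimately show ?thesis using False by (simp add: \<tau>_def)
    qed
  qed
  also have "\<dots> = f \<xi> * vol + k * 0 - gain * (c * \<mu>) + e * (c * \<beta>)"
    using int1[OF Ql] int[OF Ql \<tau>m b\<tau>] int1[OF Bl] int1[OF celll]
    by (simp add: \<tau>int mB mcell vol_def)
  finally have "gain * (c * \<mu>) \<le> e * (c * \<beta>)" by (simp add: mult.commute)
  also have "\<dots> = gain * (c * \<mu>) / 2" using \<beta> by (simp add: e_def)
  finally show False using gain c(1) \<mu> by simp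
qed

lemma relaxation_zero_on_hull:
  fixes A :: "'n::finite \<Rightarrow> real^'d^'m"
  assumes rank: "\<And>w. w \<noteq> 0 \<Longrightarrow> rank (op_symbol A w) = CARD('m)"
    and U: "open U" "bounded U"
    and conv: "\<And>a b s. a \<in> U \<Longrightarrow> b \<in> U \<Longrightarrow> b - a \<in> char_cone A \<Longrightarrow> s \<in> {0..1} \<Longrightarrow> a + s *\<^sub>R (b - a) \<in> U"
    and q: "continuous_on UNIV q" "\<And>p. q p \<ge> 0" "\<And>p. p \<in> S \<Longrightarrow> q p = 0"
    and S: "S \<subseteq> U" and \<xi>: "\<xi> \<in> cone_hull (char_cone A) S" and e: "e > 0"
  shows "\<exists>\<phi>. admissible A U \<xi> \<phi> \<and> cell_energy q \<xi> \<phi> < e"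
proof -
  interpret relaxed_energy A U q by standard (use U q in auto)
  define G where "G p = (if p \<in> U then ereal (f p) else \<infinity>)" for p
  have "cone_convex (char_cone A) G"
    unfolding cone_convex_def
  proof (intro conjI allI ballI impI)
    show "G x \<noteq> - \<infinity>" for x by (simp add: G_def)
    fix a b t assume t: "t \<in> {0..1::real}" and ab: "b - a \<in> char_cone A"
    show "G (t *\<^sub>R a + (1 - t) *\<^sub>R b) \<le> ereal t * G a + ereal (1 - t) * G b"
    proof (cases "t = 0 \<or> t = 1")
      case True then show ?thesis by (auto simp: zero_ereal_def[symmetric] one_ereal_def[symmetric])
    next
      case False
      then have t01: "0 < t" "t < 1" using t by auto
      show ?thesis
      proof (cases "a \<in> U \<and> b \<in> U")
        case True
        have eq: "t *\<^sub>R a + (1 - t) *\<^sub>R b = a + (1 - t) *\<^sub>R (b - a)" by (simp add: algebra_simps)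
        have inU: "a + (1 - t) *\<^sub>R (b - a) \<in> U" using True ab t01 by (intro conv) auto
        have "f (a + (1 - t) *\<^sub>R (b - a)) \<le> t * f a + (1 - t) * f b"
        proof (cases "b = a")
          case True then show ?thesis by (simp add: algebra_simps)
        next
          case False
          have "f (a + (1 - t) *\<^sub>R (b - a)) \<le> f a + (1 - t) * (f (a + (b - a)) - f a)"
            using True False ab t01 conv by (intro convex_along_cone[OF rank]) auto
          then show ?thesis by (simp add: algebra_simps)
        qed
        then show ?thesis using True inU by (simp add: G_def eq)
      next
        case False
        then consider "a \<notin> U" | "b \<notin> U" by blast
        then have inf: "ereal t * G a + ereal (1 - t) * G b = \<infinity>"
        proof cases
          case 1
          then have "ereal t * G a = \<infinity>" using t01 by (simp add: G_def)
          then show ?thesis by simp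
        next
          case 2
          then have "ereal (1 - t) * G b = \<infinity>" using t01 by (simp add: G_def)
          then show ?thesis by simp
        qed
        show ?thesis by (simp only: inf ereal_less_eq(1))
      qed
    qed
  qed
  moreover have "G p = 0" if "p \<in> S" for p
    using that S f_nonneg[of p] f_le_q[of p] q(3)[of p] by (auto simp: G_def)
  ultimately have "G \<xi> \<le> 0" using \<xi> by (simp add: cone_hull_def)
  then have "\<xi> \<in> U" "f \<xi> \<le> 0" by (auto simp: G_def split: if_splits)
  then show ?thesis using f_less_obtain[of \<xi> e] e by (metis order_le_less_trans)
qed

subsection \<open>The hull\<close>

lemma cone_hull_superset: "E \<subseteq> cone_hull \<Lambda> E"
  by (auto simp: cone_hull_def)

lemma cone_hull_segment:
  assumes "a \<in> cone_hull \<Lambda> E" "b \<in> cone_hull \<Lambda> E" "b - a \<in> \<Lambda>" "s \<in> {0..1}"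
  shows "a + s *\<^sub>R (b - a) \<in> cone_hull \<Lambda> E"
  unfolding cone_hull_def
proof (intro CollectI allI impI)
  fix G assume G: "cone_convex \<Lambda> G" "\<forall>\<eta>\<in>E. G \<eta> = 0"
  then have ab: "G a \<le> 0" "G b \<le> 0" using assms by (auto simp: cone_hull_def)
  have "1 - s \<in> {0..1}" using assms(4) by auto
  then have "G ((1 - s) *\<^sub>R a + (1 - (1 - s)) *\<^sub>R b) \<le> ereal (1 - s) * G a + ereal (1 - (1 - s)) * G b"
    using G(1) assms(3) unfolding cone_convex_def by blast
  also have "\<dots> \<le> 0 + 0"
    using ab assms(4) by (intro add_mono) (auto simp: ereal_mult_le_0_iff)
  also have "(1 - s) *\<^sub>R a + (1 - (1 - s)) *\<^sub>R b = a + s *\<^sub>R (b - a)" by (simp add: algebra_simps)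
  finally show "G (a + s *\<^sub>R (b - a)) \<le> 0" by simp
qed

lemma interior_cone_hull_segment:
  assumes "a \<in> interior (cone_hull \<Lambda> E)" "b \<in> interior (cone_hull \<Lambda> E)" "b - a \<in> \<Lambda>" "s \<in> {0..1}"
  shows "a + s *\<^sub>R (b - a) \<in> interior (cone_hull \<Lambda> E)"
proof -
  let ?K = "cone_hull \<Lambda> E"
  obtain r1 r2 where r: "r1 > 0" "ball a r1 \<subseteq> ?K" "r2 > 0" "ball b r2 \<subseteq> ?K"
    using assms(1,2) by (auto simp: mem_interior)
  define r where "r = min r1 r2"
  have "ball (a + s *\<^sub>R (b - a)) r \<subseteq> ?K"
  proof
    fix y assume y: "y \<in> ball (a + s *\<^sub>R (b - a)) r"
    define z where "z = y - (a + s *\<^sub>R (b - a))"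
    have "norm z < r" using y by (simp add: z_def dist_norm norm_minus_commute)
    then have "a + z \<in> ?K" "b + z \<in> ?K" using r by (auto simp: r_def dist_norm subset_eq)
    moreover have "(b + z) - (a + z) \<in> \<Lambda>" using assms(3) by simp
    ultimately have "(a + z) + s *\<^sub>R ((b + z) - (a + z)) \<in> ?K" using assms(4) by (rule cone_hull_segment)
    then show "y \<in> ?K" by (simp add: z_def algebra_simps)
  qed
  then show ?thesis using r unfolding mem_interior by (intro exI[of _ r]) (auto simp: r_def)
qed

lemma cone_hull_empty: "cone_hull \<Lambda> {} = {}"
proof -
  have "cone_convex \<Lambda> (\<lambda>x. 1)"
    unfolding cone_convex_def
  proof (intro conjI allI ballI impI)
    fix t :: real assume "t \<in> {0..1}"
    show "1 \<le> ereal t * 1 + ereal (1 - t) * 1" by (simp add: one_ereal_def)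
  qed auto
  then have "x \<notin> cone_hull \<Lambda> {}" for x unfolding cone_hull_def by (auto intro!: exI[of _ "\<lambda>x. 1"])
  then show ?thesis by blast
qed

lemma char_cone_scale: "v \<in> char_cone A \<Longrightarrow> c *\<^sub>R v \<in> char_cone A"
  by (auto simp: char_cone_def matrix_vector_mult_scaleR)

lemma cone_hull_homothety:
  assumes "\<xi> \<in> cone_hull (char_cone A) E"
  shows "t *\<^sub>R \<xi>0 + (1 - t) *\<^sub>R \<xi> \<in> cone_hull (char_cone A) ((\<lambda>\<eta>. t *\<^sub>R \<xi>0 + (1 - t) *\<^sub>R \<eta>) ` E)"
  unfolding cone_hull_def
proof (intro CollectI allI impI)
  let ?h = "\<lambda>\<eta>. t *\<^sub>R \<xi>0 + (1 - t) *\<^sub>R \<eta>"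
  fix G assume G: "cone_convex (char_cone A) G" "\<forall>\<eta>\<in>?h ` E. G \<eta> = 0"
  have "cone_convex (char_cone A) (\<lambda>\<eta>. G (?h \<eta>))"
    unfolding cone_convex_def
  proof (intro conjI allI ballI impI)
    show "G (?h x) \<noteq> - \<infinity>" for x using G(1) by (simp add: cone_convex_def)
    fix a b and s :: real assume s: "s \<in> {0..1}" and ab: "b - a \<in> char_cone A"
    have "?h b - ?h a = (1 - t) *\<^sub>R (b - a)" by (simp add: algebra_simps)
    then have "?h b - ?h a \<in> char_cone A" using char_cone_scale[OF ab] by simp
    then have "G (s *\<^sub>R ?h a + (1 - s) *\<^sub>R ?h b) \<le> ereal s * G (?h a) + ereal (1 - s) * G (?h b)"
      using G(1) s unfolding cone_convex_def by blast
    moreover have "s *\<^sub>R ?h a + (1 - s) *\<^sub>R ?h b = ?h (s *\<^sub>R a + (1 - s) *\<^sub>R b)" by (simp add: algebra_simps)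
    ultimately show "G (?h (s *\<^sub>R a + (1 - s) *\<^sub>R b)) \<le> ereal s * G (?h a) + ereal (1 - s) * G (?h b)" by simp
  qed
  moreover have "\<forall>\<eta>\<in>E. G (?h \<eta>) = 0" using G(2) by blast
  ultimately show "G (?h \<xi>) \<le> 0" using assms by (auto simp: cone_hull_def)
qed

lemma infdist_bounded_le:
  fixes p :: "'a::real_normed_vector"
  assumes "E \<noteq> {}" "E \<subseteq> cball 0 B" "p \<in> cball 0 B"
  shows "infdist p E \<le> 2 * B"
proof -
  obtain \<eta> where "\<eta> \<in> E" using assms(1) by blast
  then have "infdist p E \<le> dist p \<eta>" by (rule infdist_le)
  also have "\<dots> \<le> norm p + norm \<eta>" by (simp add: dist_norm norm_triangle_ineq4)
  finally show ?thesis using assms \<open>\<eta> \<in> E\<close> by (auto simp: subset_eq)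
qed

lemma cell_towards_zero_set:
  fixes A :: "'n::finite \<Rightarrow> real^'d^'m"
  assumes rank: "\<And>w. w \<noteq> 0 \<Longrightarrow> rank (op_symbol A w) = CARD('m)"
    and K: "K = cone_hull (char_cone A) E" "compact K" "\<xi>0 \<in> interior K" "strongly_star_shaped K \<xi>0"
    and \<xi>: "\<xi> \<in> interior K" and e: "e > 0"
  shows "\<exists>\<phi>. admissible A (interior K) \<xi> \<phi> \<and> cell_energy (\<lambda>p. infdist p E) \<xi> \<phi> < e"
proof -
  have EK: "E \<subseteq> K" unfolding K(1) by (rule cone_hull_superset)
  have Ene: "E \<noteq> {}" using \<xi> cone_hull_empty[of "char_cone A"] by (auto simp: K(1))
  obtain B0 where B0: "\<And>x. x \<in> K \<Longrightarrow> norm x \<le> B0" using compact_imp_bounded[OF K(2)] bounded_iff by metis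
  have B0nn: "B0 \<ge> 0" using B0[of \<xi>] \<xi> interior_subset[of K] norm_ge_zero[of \<xi>] by (meson order_trans subsetD)
  define vol where "vol = measure lborel (cball (0::real^'n) 1)"
  have vol: "vol > 0" unfolding vol_def using content_cball_pos[of 1 "0::real^'n"] by simp
  obtain r where r: "r > 0" "ball \<xi> r \<subseteq> K" using \<xi> by (auto simp: mem_interior)
  define t where "t = min (1 / 2) (min (r / (4 * B0 + 1)) (e / (4 * vol * (B0 + 1))))"
  have t: "0 < t" using r(1) e vol B0nn by (auto simp: t_def)
  have t2: "t \<le> 1 / 2" unfolding t_def by (rule min.cobounded1)
  note t = t t2
  define \<xi>' where "\<xi>' = (1 / (1 - t)) *\<^sub>R (\<xi> - t *\<^sub>R \<xi>0)"
  have \<xi>eq: "t *\<^sub>R \<xi>0 + (1 - t) *\<^sub>R \<xi>' = \<xi>" using t by (simp add: \<xi>'_def)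
  have \<xi>0K: "norm \<xi>0 \<le> B0" "norm \<xi> \<le> B0" using B0 K(3) \<xi> interior_subset[of K] by auto
  have "\<xi>' \<in> K"
  proof -
    have "\<xi>' - \<xi> = (t / (1 - t)) *\<^sub>R (\<xi> - \<xi>0)"
    proof -
      have "(1 - t) *\<^sub>R (\<xi>' - \<xi>) = t *\<^sub>R (\<xi> - \<xi>0)" using \<xi>eq by (simp add: algebra_simps)
      then have "(1 / (1 - t)) *\<^sub>R ((1 - t) *\<^sub>R (\<xi>' - \<xi>)) = (1 / (1 - t)) *\<^sub>R (t *\<^sub>R (\<xi> - \<xi>0))" by simp
      then show ?thesis using t by simp
    qed
    then have "norm (\<xi>' - \<xi>) = (t / (1 - t)) * norm (\<xi> - \<xi>0)" using t by simp
    also have "\<dots> \<le> (2 * t) * (2 * B0)"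
    proof (intro mult_mono)
      show "t / (1 - t) \<le> 2 * t"
      proof -
        have "t * (2 * t) \<le> t * 1" using t by (intro mult_left_mono) auto
        then show ?thesis using t by (simp add: pos_divide_le_eq algebra_simps)
      qed
      show "norm (\<xi> - \<xi>0) \<le> 2 * B0" using norm_triangle_ineq4[of \<xi> \<xi>0] \<xi>0K by simp
    qed (use t B0nn in auto)
    also have "\<dots> = t * (4 * B0)" by simp
    also have "\<dots> < t * (4 * B0 + 1)" using t by simp
    also have "\<dots> \<le> (r / (4 * B0 + 1)) * (4 * B0 + 1)" using B0nn by (intro mult_right_mono) (auto simp: t_def)
    also have "\<dots> = r" using B0nn by simp
    finally have "\<xi>' \<in> ball \<xi> r" by (simp add: dist_norm norm_minus_commute)
    then show ?thesis using r(2) by blast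
  qed
  let ?S = "(\<lambda>\<eta>. t *\<^sub>R \<xi>0 + (1 - t) *\<^sub>R \<eta>) ` E"
  have hull: "\<xi> \<in> cone_hull (char_cone A) ?S"
    using cone_hull_homothety[of \<xi>' A E t \<xi>0] \<open>\<xi>' \<in> K\<close> by (simp add: \<xi>eq K(1))
  have SU: "?S \<subseteq> interior K"
    using K(4) EK t unfolding strongly_star_shaped_def by force
  have bU: "bounded (interior K)" using compact_imp_bounded[OF K(2)] interior_subset bounded_subset by blast
  obtain \<phi> where \<phi>: "admissible A (interior K) \<xi> \<phi>" "cell_energy (\<lambda>p. infdist p ?S) \<xi> \<phi> < e / 2"
  proof -
    have "\<exists>\<phi>. admissible A (interior K) \<xi> \<phi> \<and> cell_energy (\<lambda>p. infdist p ?S) \<xi> \<phi> < e / 2"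
    proof (rule relaxation_zero_on_hull[OF rank open_interior bU])
      show "a + s *\<^sub>R (b - a) \<in> interior K"
        if "a \<in> interior K" "b \<in> interior K" "b - a \<in> char_cone A" "s \<in> {0..1}" for a b s
        using that unfolding K(1) by (rule interior_cone_hull_segment)
      show "continuous_on UNIV (\<lambda>p. infdist p ?S)" by (intro continuous_intros)
    qed (use SU hull e in \<open>auto simp: infdist_nonneg\<close>)
    then show ?thesis using that by blast
  qed
  have \<phi>m: "\<phi> \<in> borel_measurable borel" and inK: "\<And>x. \<xi> + \<phi> x \<in> K"
    using \<phi>(1) interior_subset[of K] by (auto simp: admissible_def cell_field_def pw_const_def)
  have cmp: "infdist p E \<le> infdist p ?S + t * (2 * B0)" for p
  proof -
    have "infdist p E - t * (2 * B0) \<le> dist p \<sigma>" if \<sigma>: "\<sigma> \<in> ?S" for \<sigma>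
    proof -
      obtain \<eta> where \<eta>: "\<eta> \<in> E" "\<sigma> = t *\<^sub>R \<xi>0 + (1 - t) *\<^sub>R \<eta>" using \<sigma> by blast
      have "infdist p E \<le> dist p \<eta>" using \<eta>(1) by (rule infdist_le)
      also have "\<dots> \<le> dist p \<sigma> + dist \<sigma> \<eta>" by (rule dist_triangle)
      also have "dist \<sigma> \<eta> = t * norm (\<xi>0 - \<eta>)"
      proof -
        have "\<sigma> - \<eta> = t *\<^sub>R (\<xi>0 - \<eta>)" by (simp add: \<eta>(2) algebra_simps)
        then show ?thesis using t by (simp add: dist_norm)
      qed
      also have "\<dots> \<le> t * (2 * B0)"
        using t norm_triangle_ineq4[of \<xi>0 \<eta>] \<xi>0K(1) B0[of \<eta>] EK \<eta>(1) by (intro mult_left_mono) auto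
      finally show ?thesis by simp
    qed
    moreover have "?S \<noteq> {}" using Ene by simp
    ultimately have "infdist p E - t * (2 * B0) \<le> infdist p ?S"
      unfolding infdist_notempty[OF \<open>?S \<noteq> {}\<close>] by (intro cINF_greatest) auto
    then show ?thesis by simp
  qed
  have int: "integrable lborel (\<lambda>z. indicator (cball (0::real^'n) 1) z * infdist (\<xi> + \<phi> z) T)"
    if T: "T \<noteq> {}" "T \<subseteq> cball 0 B0" for T
  proof (rule integrableI_bounded_set[where A = "cball 0 1" and B = "2 * B0"])
    show "emeasure lborel (cball 0 1 :: (real^'n) set) < \<infinity>" by (intro emeasure_bounded_finite) simp
    have "(\<lambda>p. infdist p T) \<in> borel_measurable borel" by (intro borel_measurable_continuous_onI continuous_intros)
    then show "(\<lambda>z. indicator (cball (0::real^'n) 1) z * infdist (\<xi> + \<phi> z) T) \<in> borel_measurable lborel"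
      using measurable_compose[OF borel_measurable_add[OF borel_measurable_const \<phi>m]]
      by (intro borel_measurable_times borel_measurable_indicator) auto
    show "AE x in lborel. x \<in> cball 0 1 \<longrightarrow> norm (indicator (cball (0::real^'n) 1) x * infdist (\<xi> + \<phi> x) T) \<le> 2 * B0"
      using infdist_bounded_le[OF T] B0[OF inK] by (intro AE_I2) (auto simp: infdist_nonneg)
  qed auto
  have SB: "?S \<subseteq> cball 0 B0"
  proof
    fix p assume "p \<in> ?S"
    then have "p \<in> K" using SU interior_subset[of K] by blast
    then show "p \<in> cball 0 B0" using B0 by simp
  qed
  have "cell_energy (\<lambda>p. infdist p E) \<xi> \<phi> \<le>
    (\<integral>z. indicator (cball (0::real^'n) 1) z * infdist (\<xi> + \<phi> z) ?S + (t * (2 * B0)) * indicator (cball (0::real^'n) 1) z \<partial>lborel)"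
    unfolding cell_energy_def
  proof (intro integral_mono Bochner_Integration.integrable_add int integrable_mult_right)
    show "E \<subseteq> cball 0 B0" using EK B0 by auto
    show "?S \<subseteq> cball 0 B0" by (rule SB)
    show "integrable lborel (indicator (cball (0::real^'n) 1) :: _ \<Rightarrow> real)"
      using emeasure_bounded_finite[of "cball (0::real^'n) 1"] by (simp add: integrable_indicator_iff)
    show "indicator (cball (0::real^'n) 1) z * infdist (\<xi> + \<phi> z) E \<le>
      indicator (cball (0::real^'n) 1) z * infdist (\<xi> + \<phi> z) ?S + (t * (2 * B0)) * indicator (cball (0::real^'n) 1) z" for z
      using cmp[of "\<xi> + \<phi> z"] by (auto simp: indicator_def)
  qed (use Ene in auto)
  also have "\<dots> = cell_energy (\<lambda>p. infdist p ?S) \<xi> \<phi> + t * (2 * B0) * vol"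
  proof -
    have "?S \<noteq> {}" using Ene by simp
    then show ?thesis
      using int[OF _ SB] emeasure_bounded_finite[of "cball (0::real^'n) 1"]
      by (subst Bochner_Integration.integral_add) (auto simp: cell_energy_def vol_def integrable_indicator_iff)
  qed
  also have "t * (2 * B0) * vol \<le> e / 2"
  proof -
    have "t * (2 * B0) * vol \<le> (e / (4 * vol * (B0 + 1))) * (2 * (B0 + 1)) * vol"
      using vol B0nn e t by (intro mult_right_mono mult_mono) (auto simp: t_def)
    also have "\<dots> = e / 2"
    proof -
      have "(e / (4 * vol * D)) * (2 * D) * vol = e / 2" if "D \<noteq> 0" for D
        using that vol by simp
      then show ?thesis using B0nn by (metis add_nonneg_pos less_numeral_extra(1,3))
    qed
    finally show ?thesis .
  qed
  finally have "cell_energy (\<lambda>p. infdist p E) \<xi> \<phi> < e" using \<phi>(2) by simp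
  then show ?thesis using \<phi>(1) by blast
qed

subsection \<open>One step of convex integration\<close>

definition defect :: "'a::euclidean_space set \<Rightarrow> 'b::euclidean_space set \<Rightarrow> ('a \<Rightarrow> 'b) \<Rightarrow> real" where
  "defect \<Omega> E u = (LINT y|lebesgue. indicator \<Omega> y * infdist (u y) E)"

lemma convex_integration_step:
  fixes A :: "'n::finite \<Rightarrow> real^'d^'m" and H :: "(real^'n \<Rightarrow> real^'d) set"
  assumes rank: "\<And>w. w \<noteq> 0 \<Longrightarrow> rank (op_symbol A w) = CARD('m)"
    and K: "K = cone_hull (char_cone A) E" "compact K" "\<xi>0 \<in> interior K" "strongly_star_shaped K \<xi>0"
    and \<Omega>: "open \<Omega>" "bounded \<Omega>" and u: "u \<in> V_set A \<Omega> E"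
    and H: "finite H" "\<And>g. g \<in> H \<Longrightarrow> integrable lebesgue g" and e: "e > 0"
  shows "\<exists>v\<in>V_set A \<Omega> E. (\<forall>g\<in>H. \<bar>LINT y|lebesgue. (v y - u y) \<bullet> g y\<bar> \<le> e) \<and> defect \<Omega> E v \<le> e"
proof -
  have uL: "u \<in> L_piec" and uA: "distr_A_free A u"
    and u0: "AE x in lebesgue. x \<notin> \<Omega> \<longrightarrow> u x = 0"
    and uE: "AE x in lebesgue. x \<in> \<Omega> \<longrightarrow> u x \<in> E \<union> interior K"
    using u by (auto simp: V_set_def K(1))
  have EK: "E \<subseteq> K" unfolding K(1) by (rule cone_hull_superset)
  have Ene: "E \<noteq> {}" using K(3) cone_hull_empty[of "char_cone A"] by (auto simp: K(1))
  obtain B0 where B0: "\<And>x. x \<in> K \<Longrightarrow> norm x \<le> B0" using compact_imp_bounded[OF K(2)] bounded_iff by metis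
  define B where "B = max 0 B0"
  have B: "B \<ge> 0" "\<And>x. x \<in> K \<Longrightarrow> norm x \<le> B" using order_trans[OF B0] by (auto simp: B_def)
  define vol where "vol = measure lebesgue (cball (0::real^'n) 1)"
  have vol: "vol > 0" unfolding vol_def using content_cball_pos[of 1 "0::real^'n"] by simp
  have \<Omega>l: "\<Omega> \<in> lmeasurable" using \<Omega> by (intro lmeasurable_open)
  define e1 where "e1 = e / (2 * (measure lebesgue \<Omega> + 1))"
  have e1: "e1 > 0" using e by (simp add: e1_def add_nonneg_pos)
  have "\<exists>\<phi>. admissible A (interior K) p \<phi> \<and> cell_energy (\<lambda>p. infdist p E) p \<phi> < e1 * vol" if "p \<in> interior K" for p
    using cell_towards_zero_set[OF rank K that, of "e1 * vol"] e1 vol by simp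
  then obtain \<Theta> where \<Theta>: "\<And>p. p \<in> interior K \<Longrightarrow> admissible A (interior K) p (\<Theta> p)"
    "\<And>p. p \<in> interior K \<Longrightarrow> cell_energy (\<lambda>p. infdist p E) p (\<Theta> p) < e1 * vol" by metis
  have \<Theta>cf: "cell_field A (\<Theta> p)" if "p \<in> interior K" for p using \<Theta>(1)[OF that] by (simp add: admissible_def)
  have \<Theta>0: "\<Theta> p z = 0" if "p \<in> interior K" "norm z > 1" for p z using \<Theta>cf[OF that(1)] that(2) by (simp add: cell_field_def)
  have \<Theta>K: "p + \<Theta> p z \<in> interior K" if "p \<in> interior K" for p z using \<Theta>(1)[OF that] by (auto simp: admissible_def)
  have "\<forall>g\<in>H. \<exists>\<rho>>0. \<forall>d. oscillating \<rho> (2 * B) d \<longrightarrow> \<bar>LINT y|lebesgue. d y \<bullet> g y\<bar> \<le> e"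
    using H(2) B(1) e by (intro ballI oscillating_weakly_small) auto
  then obtain \<rho>g where \<rho>g: "\<And>g. g \<in> H \<Longrightarrow> \<rho>g g > 0"
    "\<And>g d. g \<in> H \<Longrightarrow> oscillating (\<rho>g g) (2 * B) d \<Longrightarrow> \<bar>LINT y|lebesgue. d y \<bullet> g y\<bar> \<le> e" by metis
  define \<rho> where "\<rho> = Min (insert 1 (\<rho>g ` H))"
  have \<rho>: "\<rho> > 0" "\<And>g. g \<in> H \<Longrightarrow> \<rho> \<le> \<rho>g g" using H(1) \<rho>g(1) by (auto simp: \<rho>_def)
  define e2 where "e2 = e / (4 * (B + 1))"
  have e2: "e2 > 0" using e B by (simp add: e2_def)
  obtain F where F: "cell_family u (interior K) \<Omega> F" "\<And>x r. (x, r) \<in> F \<Longrightarrow> r < \<rho>"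
    "{y \<in> \<Omega>. u y \<in> interior K} - (\<Union>(x, r)\<in>F. cball x r) \<in> lmeasurable"
    "measure lebesgue ({y \<in> \<Omega>. u y \<in> interior K} - (\<Union>(x, r)\<in>F. cball x r)) < e2"
    by (rule cell_family_exists[OF uL \<Omega> e2 \<rho>(1)]) (rule that)
  let ?T = "\<Union>(x, r)\<in>F. cball x r"
  let ?S = "{y \<in> \<Omega>. u y \<in> interior K} - ?T"
  define v where "v = insert_cells u \<Theta> F"
  have vb: "v y = u x + place x r (\<Theta> (u x)) y" if "(x, r) \<in> F" "y \<in> cball x r" for x r y
    unfolding v_def by (rule insert_cells_ball[OF F(1) \<Theta>0 that])
  have vo: "v y = u y" if "y \<notin> ?T" for y
    unfolding v_def by (rule insert_cells_outside[OF F(1) \<Theta>0 that])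
  have ux: "u x \<in> interior K" and rpos: "r > 0" if "(x, r) \<in> F" for x r
    using cell_familyD(1,3)[OF F(1) that] by simp_all
  have uy: "u y = u x" if "(x, r) \<in> F" "y \<in> cball x r" for x r y
    using cell_familyD(4)[OF F(1) that(1), of y] that(2) by simp
  have T\<Omega>: "?T \<subseteq> \<Omega>" and fin: "finite F"
    using cell_family_subset[OF F(1)] cell_family_finite[OF F(1)] by simp_all
  have vT: "v y \<in> interior K" if y: "y \<in> ?T" for y
  proof -
    obtain x r where xr: "(x, r) \<in> F" "y \<in> cball x r" using y by auto
    then show ?thesis using \<Theta>K[OF ux[OF xr(1)]] vb[OF xr] by (simp add: place_def)
  qed
  have vL: "v \<in> L_piec" unfolding v_def by (rule insert_cells_admissible(1)[OF F(1) \<Theta>cf uL])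
  have vA: "distr_A_free A v" unfolding v_def by (rule insert_cells_admissible(2)[OF F(1) \<Theta>cf uL uA])
  have vV: "v \<in> V_set A \<Omega> E"
    unfolding V_set_def
  proof (intro CollectI conjI vL vA)
    show "AE x in lebesgue. x \<notin> \<Omega> \<longrightarrow> v x = 0"
      using u0
    proof (rule AE_mp, intro AE_I2 impI)
      fix x assume "x \<notin> \<Omega> \<longrightarrow> u x = 0" "x \<notin> \<Omega>"
      moreover have "x \<notin> ?T" using T\<Omega> \<open>x \<notin> \<Omega>\<close> by blast
      ultimately show "v x = 0" using vo by simp
    qed
    show "AE x in lebesgue. x \<in> \<Omega> \<longrightarrow> v x \<in> E \<union> interior (cone_hull (char_cone A) E)"
      using uE
    proof (rule AE_mp, intro AE_I2 impI)
      fix x assume "x \<in> \<Omega> \<longrightarrow> u x \<in> E \<union> interior K" "x \<in> \<Omega>"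
      then show "v x \<in> E \<union> interior (cone_hull (char_cone A) E)"
        using vo[of x] vT[of x] by (cases "x \<in> ?T") (auto simp: K(1))
    qed
  qed
  have vm: "v \<in> borel_measurable lebesgue" and um: "u \<in> borel_measurable lebesgue"
    using vL uL by (auto intro: L_piec_measurable)
  have osc: "oscillating \<rho> (2 * B) (\<lambda>y. v y - u y)"
    unfolding oscillating_def
  proof (intro conjI allI exI[of _ F])
    show "(\<lambda>y. v y - u y) \<in> borel_measurable lebesgue" using vm um by (intro borel_measurable_diff)
    show "finite F" by (rule fin)
    show "disjoint_family_on (\<lambda>(x, r). cball x r) F" using F(1) by (simp add: cell_family_def)
    show "norm (v y - u y) \<le> 2 * B" for y
    proof (cases "y \<in> ?T")
      case True
      then obtain x r where xr: "(x, r) \<in> F" "y \<in> cball x r" by auto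
      have "v y \<in> K" "u y \<in> K" using vT[OF True] uy[OF xr] ux[OF xr(1)] interior_subset[of K] by auto
      then show ?thesis using norm_triangle_ineq4[of "v y" "u y"] B(2)[of "v y"] B(2)[of "u y"] by simp
    next
      case False then show ?thesis using vo B(1) by simp
    qed
    show "y \<notin> ?T \<longrightarrow> v y - u y = 0" for y using vo by simp
    show "\<forall>(x, r)\<in>F. 0 < r \<and> r < \<rho> \<and> (LINT y|lebesgue. indicator (cball x r) y *\<^sub>R (v y - u y)) = 0"
    proof (intro ballI, clarify, intro conjI)
      fix x r assume xr: "(x, r) \<in> F"
      show "0 < r" "r < \<rho>" using rpos[OF xr] F(2)[OF xr] by auto
      have cf: "cell_field A (\<Theta> (u x))" using \<Theta>cf[OF ux[OF xr]] .
      have eq: "indicator (cball x r) y *\<^sub>R (v y - u y) = place x r (\<Theta> (u x)) y" for y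
      proof (cases "y \<in> cball x r")
        case True
        then show ?thesis using vb[OF xr True] uy[OF xr True] by simp
      next
        case False
        then show ?thesis using place_zero[OF \<Theta>0[OF ux[OF xr]] rpos[OF xr] False] by simp
      qed
      have pm: "\<Theta> (u x) \<in> borel_measurable borel" "pw_const (place x r (\<Theta> (u x)))"
      proof -
        show "\<Theta> (u x) \<in> borel_measurable borel" using cf by (simp add: cell_field_def pw_const_def)
        show "pw_const (place x r (\<Theta> (u x)))"
          using cf rpos[OF xr] by (intro pw_const_place) (simp_all add: cell_field_def)
      qed
      have "(LINT y|lebesgue. place x r (\<Theta> (u x)) y) = (\<integral>y. place x r (\<Theta> (u x)) y \<partial>lborel)"
        using pm(2) by (simp add: integral_completion pw_const_def)
      also have "\<dots> = 0" using integral_place[OF pm(1) rpos[OF xr], of x] cf by (simp add: cell_field_def)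
      finally show "(LINT y|lebesgue. indicator (cball x r) y *\<^sub>R (v y - u y)) = 0" unfolding eq .
    qed
  qed
  have weak: "\<bar>LINT y|lebesgue. (v y - u y) \<bullet> g y\<bar> \<le> e" if "g \<in> H" for g
    using \<rho>g(2)[OF that oscillating_mono[OF osc \<rho>(2)[OF that]]] .
  have qc: "continuous_on UNIV (\<lambda>p. infdist p E)" by (intro continuous_intros)
  have dm: "(\<lambda>y. infdist (v y) E) \<in> borel_measurable lebesgue"
    using vm by (rule measurable_compose[OF _ borel_measurable_continuous_onI[OF qc]])
  obtain N where N: "\<And>y. \<bar>infdist (v y) E\<bar> \<le> N"
  proof -
    obtain N0 where N0: "\<And>y. norm (v y) \<le> N0" using vL by (auto simp: L_piec_def bounded_iff)
    have "\<bar>infdist (v y) E\<bar> \<le> 2 * max N0 B" for y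
    proof -
      have "infdist (v y) E \<le> 2 * max N0 B"
      proof (rule infdist_bounded_le[OF Ene])
        show "E \<subseteq> cball 0 (max N0 B)" using EK B(2) by (force simp: le_max_iff_disj)
        show "v y \<in> cball 0 (max N0 B)" using N0[of y] by (simp add: le_max_iff_disj)
      qed
      then show ?thesis by (simp add: infdist_nonneg)
    qed
    then show ?thesis using that by blast
  qed
  have int: "integrable lebesgue (\<lambda>y. indicator S y * h y)"
    if "S \<in> lmeasurable" "h \<in> borel_measurable lebesgue" "\<And>y. \<bar>h y\<bar> \<le> N" for S N and h :: "real^'n \<Rightarrow> real"
    using integrable_indicator_bounded[of h N S] that by simp
  have main: "(LINT y|lebesgue. indicator ?T y * infdist (v y) E) \<le> (LINT y|lebesgue. indicator \<Omega> y * e1)"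
  proof (rule cell_family_integral_le[OF F(1) \<Omega>l dm N])
    fix x r assume xr: "(x, r) \<in> F"
    have \<Theta>m: "\<Theta> (u x) \<in> borel_measurable borel" using \<Theta>cf[OF ux[OF xr]] by (auto simp: cell_field_def pw_const_def)
    have "(LINT y|lebesgue. indicator (cball x r) y * infdist (v y) E) =
        (LINT y|lebesgue. indicator (cball x r) y * infdist (u x + place x r (\<Theta> (u x)) y) E)"
      using vb[OF xr] by (intro Bochner_Integration.integral_cong) (auto simp: indicator_def)
    also have "\<dots> = r ^ DIM(real^'n) * cell_energy (\<lambda>p. infdist p E) (u x) (\<Theta> (u x))"
      unfolding cell_energy_def by (rule integral_on_ball_place(1)[OF \<Theta>m qc rpos[OF xr]])
    also have "\<dots> \<le> r ^ DIM(real^'n) * (e1 * vol)"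
      using \<Theta>(2)[OF ux[OF xr]] rpos[OF xr] by (intro mult_left_mono) auto
    also have "\<dots> = measure lebesgue (cball x r) * e1"
      using integral_on_ball_place(2)[OF \<Theta>m qc rpos[OF xr], of x] by (simp add: vol_def)
    also have "\<dots> = (LINT y|lebesgue. indicator (cball x r) y * e1)" by simp
    finally show "(LINT y|lebesgue. indicator (cball x r) y * infdist (v y) E) \<le> (LINT y|lebesgue. indicator (cball x r) y * e1)" .
  qed (use e1 in auto)
  have Tl: "?T \<in> lmeasurable" using fin by (intro fmeasurable.finite_UN) auto
  have i1: "integrable lebesgue (\<lambda>y. indicator ?T y * infdist (v y) E)" by (rule int[OF Tl dm N])
  have i2: "integrable lebesgue (\<lambda>y. indicator ?S y * (2 * B))" by (rule int[OF F(3), of _ "\<bar>2 * B\<bar>"]) auto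
  have "defect \<Omega> E v \<le> (LINT y|lebesgue. indicator ?T y * infdist (v y) E + indicator ?S y * (2 * B))"
    unfolding defect_def
  proof (rule integral_mono_AE[OF int[OF \<Omega>l dm N] Bochner_Integration.integrable_add[OF i1 i2]])
    show "AE y in lebesgue. indicator \<Omega> y * infdist (v y) E \<le> indicator ?T y * infdist (v y) E + indicator ?S y * (2 * B)"
      using uE
    proof (rule AE_mp, intro AE_I2 impI)
      fix y assume y: "y \<in> \<Omega> \<longrightarrow> u y \<in> E \<union> interior K"
      show "indicator \<Omega> y * infdist (v y) E \<le> indicator ?T y * infdist (v y) E + indicator ?S y * (2 * B)"
      proof (cases "y \<in> ?T")
        case True
        then have "y \<in> \<Omega>" "y \<notin> ?S" using T\<Omega> by auto
        then show ?thesis using True by simp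
      next
        case False
        show ?thesis
        proof (cases "y \<in> \<Omega>")
          case y\<Omega>: True
          show ?thesis
          proof (cases "u y \<in> interior K")
            case True
            then have "infdist (v y) E \<le> 2 * B"
              using vo[OF False] Ene EK B(2) interior_subset[of K] by (intro infdist_bounded_le) auto
            moreover have "y \<in> ?S" using True False y\<Omega> by blast
            ultimately show ?thesis using y\<Omega> False by simp
          next
            case nK: False
            then have "u y \<in> E" using y y\<Omega> by blast
            then have "infdist (v y) E = 0" using vo[OF False] by simp
            then show ?thesis using B(1) by (simp add: indicator_def)
          qed
        next
          case False
          then have "y \<notin> ?S" "y \<notin> ?T" using T\<Omega> by auto
          then show ?thesis using False by simp
        qed
      qed
    qed
  qed
  also have "\<dots> = (LINT y|lebesgue. indicator ?T y * infdist (v y) E) + measure lebesgue ?S * (2 * B)"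
    using F(3) by (subst Bochner_Integration.integral_add[OF i1 i2]) simp
  also have "\<dots> \<le> measure lebesgue \<Omega> * e1 + e2 * (2 * B)"
    using main \<Omega>l F(4) B(1) by (intro add_mono mult_right_mono) auto
  also have "\<dots> \<le> e / 2 + e / 2"
  proof (rule add_mono)
    have "measure lebesgue \<Omega> * e1 \<le> (measure lebesgue \<Omega> + 1) * e1" using e1 by simp
    also have "\<dots> = e / 2"
    proof -
      have "D * (e / (2 * D)) = e / 2" if "D \<noteq> 0" for D
        using that by simp
      moreover have "measure lebesgue \<Omega> + 1 \<noteq> 0" using measure_nonneg[of lebesgue \<Omega>] by linarith
      ultimately show ?thesis unfolding e1_def by blast
    qed
    finally show "measure lebesgue \<Omega> * e1 \<le> e / 2" .
    have "e2 * (2 * B) \<le> e2 * (2 * (B + 1))" using e2 by simp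
    also have "\<dots> = e / 2"
    proof -
      have "e / (4 * D) * (2 * D) = e / 2" if "D \<noteq> 0" for D
        using that by simp
      moreover have "B + 1 \<noteq> 0" using B(1) by linarith
      ultimately show ?thesis unfolding e2_def by blast
    qed
    finally show "e2 * (2 * B) \<le> e / 2" .
  qed
  finally have "defect \<Omega> E v \<le> e" by simp
  then show ?thesis using vV weak by blast
qed

subsection \<open>Weak* neighbourhoods and limits\<close>

lemma weak_star_neighbourhood:
  fixes u :: "'a::euclidean_space \<Rightarrow> 'b::euclidean_space"
  assumes "openin weak_star T" "u \<in> T"
  shows "\<exists>H \<epsilon>. finite H \<and> (\<forall>g\<in>H. integrable lebesgue g) \<and> \<epsilon> > 0 \<and>
    (\<forall>w\<in>L_infty. (\<forall>g\<in>H. \<bar>(LINT x|lebesgue. w x \<bullet> g x) - (LINT x|lebesgue. u x \<bullet> g x)\<bar> < \<epsilon>) \<longrightarrow> w \<in> T)"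
proof -
  let ?S = "{{u \<in> L_infty. (LINT x|lebesgue. u x \<bullet> g x) \<in> T} | (g :: 'a \<Rightarrow> 'b) T. integrable lebesgue g \<and> open T}"
  let ?N = "\<lambda>T u. \<exists>H \<epsilon>. finite H \<and> (\<forall>g\<in>H. integrable lebesgue g) \<and> \<epsilon> > 0 \<and>
    (\<forall>w\<in>L_infty. (\<forall>g\<in>H. \<bar>(LINT x|lebesgue. w x \<bullet> g x) - (LINT x|lebesgue. u x \<bullet> g x)\<bar> < \<epsilon>) \<longrightarrow> w \<in> T)"
  have "generate_topology_on ?S T"
    using assms(1) unfolding weak_star_def openin_topology_generated_by_iff .
  then have "\<forall>u\<in>T. ?N T u"
  proof (induction rule: generate_topology_on.induct)
    case (Int a b)
    show ?case
    proof
      fix u assume "u \<in> a \<inter> b"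
      then have ab: "u \<in> a" "u \<in> b" by simp_all
      have "?N a u" by (rule bspec[OF Int.IH(1) ab(1)])
      moreover have "?N b u" by (rule bspec[OF Int.IH(2) ab(2)])
      ultimately obtain H1 \<epsilon>1 H2 \<epsilon>2 where 1: "finite H1" "\<forall>g\<in>H1. integrable lebesgue g" "\<epsilon>1 > 0"
          "\<forall>w\<in>L_infty. (\<forall>g\<in>H1. \<bar>(LINT x|lebesgue. w x \<bullet> g x) - (LINT x|lebesgue. u x \<bullet> g x)\<bar> < \<epsilon>1) \<longrightarrow> w \<in> a"
        and 2: "finite H2" "\<forall>g\<in>H2. integrable lebesgue g" "\<epsilon>2 > 0"
          "\<forall>w\<in>L_infty. (\<forall>g\<in>H2. \<bar>(LINT x|lebesgue. w x \<bullet> g x) - (LINT x|lebesgue. u x \<bullet> g x)\<bar> < \<epsilon>2) \<longrightarrow> w \<in> b"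
        by (elim exE conjE) (rule that)
      show "?N (a \<inter> b) u"
        by (rule exI[of _ "H1 \<union> H2"], rule exI[of _ "min \<epsilon>1 \<epsilon>2"]) (use 1 2 in auto)
    qed
  next
    case (UN K)
    show ?case
    proof
      fix u assume "u \<in> \<Union>K"
      then obtain k where k: "k \<in> K" "u \<in> k" by blast
      have "?N k u" by (rule bspec[OF UN.IH[OF k(1)] k(2)])
      then obtain H \<epsilon> where "finite H" "\<forall>g\<in>H. integrable lebesgue g" "\<epsilon> > 0"
          "\<forall>w\<in>L_infty. (\<forall>g\<in>H. \<bar>(LINT x|lebesgue. w x \<bullet> g x) - (LINT x|lebesgue. u x \<bullet> g x)\<bar> < \<epsilon>) \<longrightarrow> w \<in> k"
        by (elim exE conjE) (rule that)
      then show "?N (\<Union>K) u" using k(1) by (intro exI[of _ H] exI[of _ \<epsilon>]) auto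
    qed
  next
    case (Basis s)
    then obtain g :: "'a \<Rightarrow> 'b" and T where gT: "s = {u \<in> L_infty. (LINT x|lebesgue. u x \<bullet> g x) \<in> T}"
      "integrable lebesgue g" "open T" by blast
    show ?case
    proof
      fix u assume "u \<in> s"
      then have "(LINT x|lebesgue. u x \<bullet> g x) \<in> T" by (simp add: gT(1))
      then obtain \<epsilon> where \<epsilon>: "\<epsilon> > 0" "ball (LINT x|lebesgue. u x \<bullet> g x) \<epsilon> \<subseteq> T"
        using gT(3) open_contains_ball by blast
      show "?N s u"
      proof (intro exI[of _ "{g}"] exI[of _ \<epsilon>] conjI ballI impI)
        fix w :: "'a \<Rightarrow> 'b" assume w: "w \<in> L_infty"
          "\<forall>g\<in>{g}. \<bar>(LINT x|lebesgue. w x \<bullet> g x) - (LINT x|lebesgue. u x \<bullet> g x)\<bar> < \<epsilon>"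
        then have "(LINT x|lebesgue. w x \<bullet> g x) \<in> ball (LINT x|lebesgue. u x \<bullet> g x) \<epsilon>"
          by (simp add: dist_real_def abs_minus_commute)
        then show "w \<in> s" using \<epsilon>(2) w(1) by (auto simp: gT(1))
      qed (use gT \<epsilon> in auto)
    qed
  qed simp
  then show ?thesis using assms(2) by blast
qed

lemma distr_A_free_pairing:
  fixes A :: "'n::finite \<Rightarrow> real^'d^'m"
  assumes u: "u \<in> L_infty"
  shows "distr_A_free A u \<longleftrightarrow>
    (\<forall>\<phi> r. test_function \<phi> \<longrightarrow> (LINT x|lebesgue. u x \<bullet> (\<chi> l. dird (row_vec A r l) \<phi> x)) = 0)"
proof -
  have eq: "(LINT x|lebesgue. (\<Sum>i\<in>UNIV. partial_deriv i \<phi> x *\<^sub>R (A i *v u x))) $ r =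
      (LINT x|lebesgue. u x \<bullet> (\<chi> l. dird (row_vec A r l) \<phi> x))" if t: "test_function \<phi>" for \<phi> r
  proof -
    have s: "smooth \<phi>" using t by (simp add: test_function_def)
    have "(LINT x|lebesgue. (\<Sum>i\<in>UNIV. partial_deriv i \<phi> x *\<^sub>R (A i *v u x))) $ r =
        (LINT x|lebesgue. (\<Sum>i\<in>UNIV. partial_deriv i \<phi> x *\<^sub>R (A i *v u x)) $ r)"
      using integral_bounded_linear[OF bounded_linear_vec_nth test_integrable[OF t u, of A], of r] by simp
    also have "\<dots> = (LINT x|lebesgue. (\<Sum>l\<in>UNIV. dird (row_vec A r l) \<phi> x * u x $ l))"
      by (simp only: distr_integrand_nth[OF s])
    finally show ?thesis by (simp add: inner_vec_def mult.commute)
  qed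
  have "(LINT x|lebesgue. (\<Sum>i\<in>UNIV. partial_deriv i \<phi> x *\<^sub>R (A i *v u x))) = 0 \<longleftrightarrow>
      (\<forall>r. (LINT x|lebesgue. u x \<bullet> (\<chi> l. dird (row_vec A r l) \<phi> x)) = 0)" if "test_function \<phi>" for \<phi>
    unfolding vec_eq_iff eq[OF that] by simp
  then show ?thesis unfolding distr_A_free_def by blast
qed

lemma test_gradient_integrable:
  fixes A :: "'n::finite \<Rightarrow> real^'d^'m"
  assumes t: "test_function \<phi>"
  shows "integrable lebesgue (\<lambda>x. (\<chi> l. dird (row_vec A r l) \<phi> x) :: real^'d)"
proof -
  have s: "smooth \<phi>" and c: "compact (closure {x. \<phi> x \<noteq> 0})" using t by (auto simp: test_function_def)
  have one: "(\<lambda>x. axis l 1 :: real^'d) \<in> L_infty" for l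
    by (auto simp: L_infty_def intro!: exI[of _ 1])
  have "integrable lebesgue (\<lambda>x. dird (row_vec A r l) \<phi> x *\<^sub>R (axis l 1 :: real^'d))" for l
    by (rule integrable_cont_compact_support[OF _ c _ one bounded_linear_ident])
      (use s in \<open>auto intro!: smooth_continuous_on smooth_dird dird_eq_0_outside\<close>)
  then have "integrable lebesgue (\<lambda>x. \<Sum>l\<in>UNIV. dird (row_vec A r l) \<phi> x *\<^sub>R (axis l 1 :: real^'d))"
    by (rule Bochner_Integration.integrable_sum)
  moreover have "(\<Sum>l\<in>UNIV. dird (row_vec A r l) \<phi> x *\<^sub>R (axis l 1 :: real^'d)) = (\<chi> l. dird (row_vec A r l) \<phi> x)" for x
    by (subst basis_expansion[symmetric]) (simp add: scalar_mult_eq_scaleR)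
  ultimately show ?thesis by simp
qed

lemma bounded_limit_pairing:
  fixes u :: "nat \<Rightarrow> 'a::euclidean_space \<Rightarrow> 'b::euclidean_space"
  assumes um: "\<And>n. u n \<in> borel_measurable lebesgue" and vm: "v \<in> borel_measurable lebesgue"
    and b: "\<And>n. AE x in lebesgue. norm (u n x) \<le> B"
    and lim: "AE x in lebesgue. (\<lambda>n. u n x) \<longlonglongrightarrow> v x" and g: "integrable lebesgue g"
  shows "(\<lambda>n. LINT x|lebesgue. u n x \<bullet> g x) \<longlonglongrightarrow> (LINT x|lebesgue. v x \<bullet> g x)"
proof (rule integral_dominated_convergence[where w = "\<lambda>x. B * norm (g x)"])
  have gm: "g \<in> borel_measurable lebesgue" using g by (rule borel_measurable_integrable)
  show "(\<lambda>x. v x \<bullet> g x) \<in> borel_measurable lebesgue" "\<And>n. (\<lambda>x. u n x \<bullet> g x) \<in> borel_measurable lebesgue"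
    using um vm gm by (auto intro: borel_measurable_inner)
  show "integrable lebesgue (\<lambda>x. B * norm (g x))" using g by auto
  show "AE x in lebesgue. (\<lambda>n. u n x \<bullet> g x) \<longlonglongrightarrow> v x \<bullet> g x"
    using lim by (rule AE_mp) (auto intro!: AE_I2 tendsto_inner)
  fix n
  show "AE x in lebesgue. norm (u n x \<bullet> g x) \<le> B * norm (g x)"
    using b[of n]
  proof (rule AE_mp, intro AE_I2 impI)
    fix x assume "norm (u n x) \<le> B"
    then have "norm (u n x) * norm (g x) \<le> B * norm (g x)" by (intro mult_right_mono) auto
    then show "norm (u n x \<bullet> g x) \<le> B * norm (g x)"
      using Cauchy_Schwarz_ineq2[of "u n x" "g x"] by simp
  qed
qed

lemma AE_convergent_of_summable_L1:
  fixes u :: "nat \<Rightarrow> 'a \<Rightarrow> 'b::euclidean_space"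
  assumes int: "\<And>n. integrable M (\<lambda>x. u (Suc n) x - u n x)"
    and s: "summable (\<lambda>n. \<integral>x. norm (u (Suc n) x - u n x) \<partial>M)"
  shows "AE x in M. convergent (\<lambda>n. u n x)"
proof -
  let ?d = "\<lambda>n x. norm (u (Suc n) x - u n x)"
  have dm: "(\<lambda>x. ennreal (?d n x)) \<in> borel_measurable M" for n using borel_measurable_integrable[OF int] by measurable
  have "(\<integral>\<^sup>+x. (\<Sum>n. ennreal (?d n x)) \<partial>M) = (\<Sum>n. \<integral>\<^sup>+x. ennreal (?d n x) \<partial>M)"
    by (rule nn_integral_suminf) (rule dm)
  also have "\<dots> = (\<Sum>n. ennreal (\<integral>x. ?d n x \<partial>M))"
    using int by (intro suminf_cong nn_integral_eq_integral) auto
  also have "\<dots> = ennreal (\<Sum>n. \<integral>x. ?d n x \<partial>M)"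
    using s by (intro suminf_ennreal2) auto
  finally have "(\<integral>\<^sup>+x. (\<Sum>n. ennreal (?d n x)) \<partial>M) \<noteq> \<infinity>" by simp
  then have "AE x in M. (\<Sum>n. ennreal (?d n x)) \<noteq> \<infinity>"
    using dm by (intro nn_integral_PInf_AE) auto
  then show ?thesis
  proof (rule AE_mp, intro AE_I2 impI)
    fix x assume "(\<Sum>n. ennreal (?d n x)) \<noteq> \<infinity>"
    then have "summable (\<lambda>n. ?d n x)" by (intro summable_suminf_not_top) auto
    then have "summable (\<lambda>n. u (Suc n) x - u n x)" by (rule summable_norm_cancel)
    then have "convergent (\<lambda>n. (\<Sum>i<n. u (Suc i) x - u i x) + u 0 x)"
      by (intro convergent_add convergent_const) (simp add: summable_iff_convergent)
    moreover have "(\<lambda>n. (\<Sum>i<n. u (Suc i) x - u i x) + u 0 x) = (\<lambda>n. u n x)"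
      by (simp add: sum_lessThan_telescope[of "\<lambda>i. u i x"])
    ultimately show "convergent (\<lambda>n. u n x)" by (simp only:)
  qed
qed

subsection \<open>Strong convergence\<close>

text \<open>If each new field is nearly orthogonal, relative to the previous one, to all the earlier ones,
  then the energies are almost increasing, hence convergent, and the fields are Cauchy in \<open>L\<^sup>2\<close>.\<close>

lemma strongly_convergent_subsequence:
  fixes u :: "nat \<Rightarrow> 'a::euclidean_space \<Rightarrow> 'b::euclidean_space"
  assumes \<Omega>: "\<Omega> \<in> lmeasurable" and um: "\<And>n. u n \<in> borel_measurable lebesgue"
    and b: "\<And>n. AE x in lebesgue. norm (u n x) \<le> B" and z: "\<And>n. AE x in lebesgue. x \<notin> \<Omega> \<longrightarrow> u n x = 0"
    and orth: "\<And>j k. j \<le> k \<Longrightarrow> \<bar>LINT x|lebesgue. (u (Suc k) x - u k x) \<bullet> u j x\<bar> \<le> (1 / 2) ^ (k + 2)"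
  obtains s where "strict_mono s" "AE x in lebesgue. convergent (\<lambda>n. u (s n) x)"
proof -
  have int: "integrable lebesgue (\<lambda>x. u n x)" for n
  proof (rule integrableI_bounded_set[where A = \<Omega> and B = B])
    show "emeasure lebesgue \<Omega> < \<infinity>" using \<Omega> by (auto simp: fmeasurable_def)
    show "AE x in lebesgue. x \<in> \<Omega> \<longrightarrow> norm (u n x) \<le> B" using b[of n] by (rule AE_mp) auto
  qed (use \<Omega> um z in auto)
  have pint: "integrable lebesgue (\<lambda>x. u k x \<bullet> u j x)" for k j
    by (rule integrable_bounded_times[OF um b int])
  define a where "a k = (LINT x|lebesgue. u k x \<bullet> u k x)" for k
  define p where "p k j = (LINT x|lebesgue. u k x \<bullet> u j x)" for k j
  define D where "D k j = (LINT x|lebesgue. (u k x - u j x) \<bullet> (u k x - u j x))" for k j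
  have Dint: "integrable lebesgue (\<lambda>x. (u k x - u j x) \<bullet> (u k x - u j x))" for k j
    unfolding inner_diff_left inner_diff_right using pint by (intro Bochner_Integration.integrable_diff) auto
  have D: "D k j = a k - a j - 2 * (p k j - a j)" for k j
  proof -
    have "(u k x - u j x) \<bullet> (u k x - u j x) = u k x \<bullet> u k x - u k x \<bullet> u j x - (u k x \<bullet> u j x - u j x \<bullet> u j x)" for x
      by (simp add: inner_diff_left inner_diff_right inner_commute)
    then have "D k j = (LINT x|lebesgue. u k x \<bullet> u k x - u k x \<bullet> u j x - (u k x \<bullet> u j x - u j x \<bullet> u j x))"
      by (simp add: D_def)
    also have "\<dots> = a k - p k j - (p k j - a j)"
      using pint by (simp add: a_def p_def)
    finally show ?thesis by simp
  qed
  have D0: "D k j \<ge> 0" for k j unfolding D_def by (intro integral_nonneg_AE) auto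
  have step: "\<bar>p (Suc k) j - p k j\<bar> \<le> (1 / 2) ^ (k + 2)" if "j \<le> k" for j k
  proof -
    have "(LINT x|lebesgue. (u (Suc k) x - u k x) \<bullet> u j x) = p (Suc k) j - p k j"
      unfolding inner_diff_left p_def using pint by (intro Bochner_Integration.integral_diff)
    then show ?thesis using orth[OF that] by simp
  qed
  have pj: "\<bar>p k j - a j\<bar> \<le> (1 / 2) ^ (j + 1) - (1 / 2) ^ (k + 1)" if "j \<le> k" for j k
    using that
  proof (induction k rule: dec_induct)
    case base
    then show ?case by (simp add: p_def a_def)
  next
    case (step k)
    have "\<bar>p (Suc k) j - a j\<bar> \<le> \<bar>p (Suc k) j - p k j\<bar> + \<bar>p k j - a j\<bar>" by simp
    also have "\<dots> \<le> (1 / 2) ^ (k + 2) + ((1 / 2) ^ (j + 1) - (1 / 2) ^ (k + 1))"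
      using \<open>\<And>k j. j \<le> k \<Longrightarrow> \<bar>p (Suc k) j - p k j\<bar> \<le> (1 / 2) ^ (k + 2)\<close>[OF step.hyps(1)] step.IH by (intro add_mono)
    also have "\<dots> = (1 / 2) ^ (j + 1) - (1 / 2) ^ (Suc k + 1)" by simp
    finally show ?case .
  qed
  have Dle: "D k j \<le> a k - a j + (1 / 2) ^ j" if "j \<le> k" for j k
  proof -
    have "- (2 * (p k j - a j)) \<le> 2 * \<bar>p k j - a j\<bar>"
    proof -
      have "- (2 * y) \<le> 2 * \<bar>y\<bar>" for y :: real by (simp add: abs_if)
      then show ?thesis .
    qed
    also have "\<dots> \<le> 2 * ((1 / 2) ^ (j + 1))"
    proof -
      have "\<bar>p k j - a j\<bar> \<le> (1 / 2) ^ (j + 1)"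
      proof -
        have "(1 / 2 :: real) ^ (k + 1) \<ge> 0" by simp
        then show ?thesis using pj[OF that] by linarith
      qed
      then show ?thesis by simp
    qed
    finally show ?thesis unfolding D by simp
  qed
  define c where "c k = a k - (1 / 2) ^ k" for k
  have "incseq c"
  proof (rule incseq_SucI)
    fix k
    have "0 \<le> a (Suc k) - a k - 2 * (p (Suc k) k - a k)" using D0[of "Suc k" k] unfolding D .
    moreover define y :: real where "y = (1 / 2) ^ (k + 2)"
    have "\<bar>p (Suc k) k - a k\<bar> \<le> y" using step[of k k] by (simp add: p_def a_def y_def)
    then have "- y \<le> p (Suc k) k - a k" by (simp add: abs_le_iff)
    moreover have "r - 2 * y \<le> q" if "0 \<le> q - r - 2 * z" "- y \<le> z" for q r z :: real
      using that by simp
    ultimately have "a k - 2 * y \<le> a (Suc k)" by blast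
    then show "c k \<le> c (Suc k)" by (simp add: c_def y_def)
  qed
  moreover have "c k \<le> B\<^sup>2 * measure lebesgue \<Omega>" for k
  proof -
    have "a k \<le> (LINT x|lebesgue. indicator \<Omega> x * B\<^sup>2)"
      unfolding a_def
    proof (rule integral_mono_AE[OF pint])
      show "integrable lebesgue (\<lambda>x. indicator \<Omega> x * B\<^sup>2)"
        using integrable_indicator_bounded[of "\<lambda>x. B\<^sup>2" "B\<^sup>2" \<Omega>] \<Omega> by simp
      show "AE x in lebesgue. u k x \<bullet> u k x \<le> indicator \<Omega> x * B\<^sup>2"
        using b[of k] z[of k]
      proof (rule AE_mp[OF AE_conjI], intro AE_I2 impI)
        fix x assume *: "norm (u k x) \<le> B \<and> (x \<notin> \<Omega> \<longrightarrow> u k x = 0)"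
        then have "(norm (u k x))\<^sup>2 \<le> B\<^sup>2" by (intro power_mono) auto
        then show "u k x \<bullet> u k x \<le> indicator \<Omega> x * B\<^sup>2"
          using * by (cases "x \<in> \<Omega>") (simp_all add: dot_square_norm)
      qed
    qed
    also have "\<dots> = B\<^sup>2 * measure lebesgue \<Omega>" using \<Omega> by (simp add: mult.commute)
    finally have "a k \<le> B\<^sup>2 * measure lebesgue \<Omega>" .
    moreover have "c k \<le> a k" by (simp add: c_def)
    ultimately show ?thesis by (rule order_trans[rotated])
  qed
  ultimately obtain L where "c \<longlonglongrightarrow> L" using incseq_convergent by blast
  then have cC: "Cauchy c" by (rule LIMSEQ_imp_Cauchy)
  have small: "\<exists>N. \<forall>j\<ge>N. \<forall>k\<ge>j. D k j < e" if e: "e > 0" for e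
  proof -
    obtain N1 where N1: "\<And>m n. m \<ge> N1 \<Longrightarrow> n \<ge> N1 \<Longrightarrow> dist (c m) (c n) < e / 2"
      using cC e unfolding Cauchy_def by (meson half_gt_zero)
    obtain N2 where N2: "(1 / 2) ^ N2 < e / 2" using real_arch_pow_inv[of "e / 2" "1 / 2"] e by auto
    have "D k j < e" if "j \<ge> max N1 N2" "k \<ge> j" for j k
    proof -
      have "D k j \<le> c k - c j + (1 / 2) ^ k" using Dle[OF that(2)] by (simp add: c_def)
      also have "(1 / 2) ^ k \<le> ((1 / 2) ^ N2 :: real)" using that by (intro power_decreasing) auto
      also have "c k - c j < e / 2"
      proof (rule le_less_trans)
        show "c k - c j \<le> dist (c k) (c j)" unfolding dist_real_def by (rule abs_ge_self)
        show "dist (c k) (c j) < e / 2" using that by (intro N1) auto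
      qed
      also have "e / 2 + (1 / 2) ^ N2 < e / 2 + e / 2" using N2 by (intro add_strict_left_mono)
      finally show ?thesis by simp
    qed
    then show ?thesis by blast
  qed
  define m where "m = measure lebesgue \<Omega>"
  have m: "m \<ge> 0" by (simp add: m_def)
  have L1: "(LINT x|lebesgue. norm (u k x - u j x)) \<le> \<theta> * m + D k j / \<theta>" if \<theta>: "\<theta> > 0" for k j \<theta>
  proof -
    have i1: "integrable lebesgue (\<lambda>x. \<theta> * indicator \<Omega> x)"
      using integrable_indicator_bounded[of "\<lambda>x. \<theta>" \<theta> \<Omega>] \<Omega> \<theta> by (simp add: mult.commute)
    have i2: "integrable lebesgue (\<lambda>x. ((u k x - u j x) \<bullet> (u k x - u j x)) / \<theta>)" using Dint by simp
    have "(LINT x|lebesgue. norm (u k x - u j x)) \<le> (LINT x|lebesgue. \<theta> * indicator \<Omega> x + ((u k x - u j x) \<bullet> (u k x - u j x)) / \<theta>)"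
    proof (rule integral_mono_AE[OF _ Bochner_Integration.integrable_add[OF i1 i2]])
      show "integrable lebesgue (\<lambda>x. norm (u k x - u j x))" using int by simp
      show "AE x in lebesgue. norm (u k x - u j x) \<le> \<theta> * indicator \<Omega> x + ((u k x - u j x) \<bullet> (u k x - u j x)) / \<theta>"
        using z[of k] z[of j]
      proof (rule AE_mp[OF AE_conjI], intro AE_I2 impI)
        fix x assume *: "(x \<notin> \<Omega> \<longrightarrow> u k x = 0) \<and> (x \<notin> \<Omega> \<longrightarrow> u j x = 0)"
        define t where "t = norm (u k x - u j x)"
        have tt: "t \<le> \<theta> + t * t / \<theta>"
        proof (cases "t \<le> \<theta>")
          case True then show ?thesis using \<theta> by (smt (verit) divide_nonneg_pos zero_le_square)
        next
          case False
          then have "t * \<theta> \<le> t * t" using \<theta> by (intro mult_left_mono) auto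
          then have "t \<le> t * t / \<theta>" using \<theta> by (simp add: pos_le_divide_eq)
          then show ?thesis using \<theta> by simp
        qed
        have "(u k x - u j x) \<bullet> (u k x - u j x) = t * t" by (simp add: t_def dot_square_norm power2_eq_square)
        then show "norm (u k x - u j x) \<le> \<theta> * indicator \<Omega> x + ((u k x - u j x) \<bullet> (u k x - u j x)) / \<theta>"
          using tt * by (cases "x \<in> \<Omega>") (simp_all add: t_def[symmetric])
      qed
    qed
    also have "\<dots> = \<theta> * m + D k j / \<theta>"
      using \<Omega> by (subst Bochner_Integration.integral_add[OF i1 i2]) (simp add: D_def m_def)
    finally show ?thesis .
  qed
  have L1small: "\<exists>N. \<forall>j\<ge>N. \<forall>k\<ge>j. (LINT x|lebesgue. norm (u k x - u j x)) \<le> e" if e: "e > 0" for e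
  proof -
    define \<theta> where "\<theta> = e / (2 * (m + 1))"
    have \<theta>: "\<theta> > 0" using e m by (simp add: \<theta>_def)
    have \<theta>m: "\<theta> * m \<le> e / 2"
    proof -
      have "\<theta> * m \<le> \<theta> * (m + 1)" using \<theta> by simp
      also have "\<dots> = e / 2"
      proof -
        have "e / (2 * d) * d = e / 2" if "d \<noteq> 0" for d using that by simp
        then show ?thesis unfolding \<theta>_def using m by (metis add_nonneg_pos less_numeral_extra(1,3))
      qed
      finally show ?thesis .
    qed
    obtain N where N: "\<forall>j\<ge>N. \<forall>k\<ge>j. D k j < \<theta> * (e / 2)" using small[of "\<theta> * (e / 2)"] \<theta> e by auto
    have "(LINT x|lebesgue. norm (u k x - u j x)) \<le> e" if "j \<ge> N" "k \<ge> j" for j k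
    proof -
      have "D k j / \<theta> \<le> e / 2" using N that \<theta> by (simp add: pos_divide_le_eq mult.commute less_imp_le)
      then show ?thesis using L1[OF \<theta>, of k j] \<theta>m by linarith
    qed
    then show ?thesis by blast
  qed
  have "\<exists>N. \<forall>n. \<forall>j\<ge>N n. \<forall>k\<ge>j. (LINT x|lebesgue. norm (u k x - u j x)) \<le> (1 / 2) ^ n"
    using L1small by (intro choice allI) simp
  then obtain N where N: "\<And>n j k. j \<ge> N n \<Longrightarrow> k \<ge> j \<Longrightarrow> (LINT x|lebesgue. norm (u k x - u j x)) \<le> (1 / 2) ^ n" by blast
  define s where "s n = n + (\<Sum>i\<le>n. N i)" for n
  have sm: "strict_mono s" unfolding s_def by (rule strict_mono_Suc_iff[THEN iffD2]) simp
  have sN: "s n \<ge> N n" for n unfolding s_def using member_le_sum[of n "{..n}" N] by simp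
  have "AE x in lebesgue. convergent (\<lambda>n. u (s n) x)"
  proof (rule AE_convergent_of_summable_L1)
    show "integrable lebesgue (\<lambda>x. u (s (Suc n)) x - u (s n) x)" for n using int by simp
    show "summable (\<lambda>n. LINT x|lebesgue. norm (u (s (Suc n)) x - u (s n) x))"
    proof (rule summable_comparison_test')
      show "summable (\<lambda>n. (1 / 2 :: real) ^ n)" by (rule summable_geometric) simp
      fix n :: nat
      have "s n \<le> s (Suc n)" using sm by (simp add: strict_mono_less_eq)
      then show "norm (LINT x|lebesgue. norm (u (s (Suc n)) x - u (s n) x)) \<le> (1 / 2) ^ n"
        using N[OF sN] by simp
    qed
  qed
  then show ?thesis using that sm by blast
qed

lemma convex_integration:
  fixes A :: "'n::finite \<Rightarrow> real^'d^'m"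
  assumes rank: "\<And>w. w \<noteq> 0 \<Longrightarrow> rank (op_symbol A w) = CARD('m)"
    and K: "K = cone_hull (char_cone A) E" "compact K" "\<xi>0 \<in> interior K" "strongly_star_shaped K \<xi>0"
    and \<Omega>: "open \<Omega>" "bounded \<Omega>" and E: "closed E" and u0: "u0 \<in> V_set A \<Omega> E"
    and T: "openin weak_star T" "u0 \<in> T"
  obtains u where "u \<in> weak_star closure_of V_set A \<Omega> E" "u \<in> T" "distr_A_free A u"
    "AE x in lebesgue. x \<in> \<Omega> \<longrightarrow> u x \<in> E" "AE x in lebesgue. x \<notin> \<Omega> \<longrightarrow> u x = 0"
proof -
  let ?V = "V_set A \<Omega> E"
  have EK: "E \<subseteq> K" unfolding K(1) by (rule cone_hull_superset)
  have Ene: "E \<noteq> {}" using K(3) cone_hull_empty[of "char_cone A"] by (auto simp: K(1))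
  obtain B0 where B0: "\<And>x. x \<in> K \<Longrightarrow> norm x \<le> B0" using compact_imp_bounded[OF K(2)] bounded_iff by metis
  define B where "B = max 0 B0"
  have B: "B \<ge> 0" "\<And>x. x \<in> K \<Longrightarrow> norm x \<le> B" using order_trans[OF B0] by (auto simp: B_def)
  have \<Omega>l: "\<Omega> \<in> lmeasurable" using \<Omega> by (intro lmeasurable_open)
  have VL: "w \<in> L_infty" "w \<in> borel_measurable lebesgue" "distr_A_free A w" if "w \<in> ?V" for w
    using that L_piec_subset_L_infty L_piec_measurable by (auto simp: V_set_def)
  have Vz: "AE x in lebesgue. x \<notin> \<Omega> \<longrightarrow> w x = 0" if "w \<in> ?V" for w using that by (simp add: V_set_def)
  have Vb: "AE x in lebesgue. norm (w x) \<le> B" if "w \<in> ?V" for w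
  proof -
    have "AE x in lebesgue. x \<in> \<Omega> \<longrightarrow> w x \<in> E \<union> interior K" using that by (simp add: V_set_def K(1))
    then show ?thesis using Vz[OF that]
    proof (rule AE_mp[OF AE_conjI], intro AE_I2 impI)
      fix x assume "(x \<in> \<Omega> \<longrightarrow> w x \<in> E \<union> interior K) \<and> (x \<notin> \<Omega> \<longrightarrow> w x = 0)"
      then show "norm (w x) \<le> B" using B EK interior_subset[of K] by (cases "x \<in> \<Omega>") auto
    qed
  qed
  have Vint: "integrable lebesgue w" if "w \<in> ?V" for w
  proof (rule integrableI_bounded_set[where A = \<Omega> and B = B])
    show "emeasure lebesgue \<Omega> < \<infinity>" using \<Omega>l by (auto simp: fmeasurable_def)
    show "AE x in lebesgue. x \<in> \<Omega> \<longrightarrow> norm (w x) \<le> B" using Vb[OF that] by (rule AE_mp) auto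
  qed (use \<Omega>l VL[OF that] Vz[OF that] in auto)
  obtain H0 \<epsilon> where H0: "finite H0" "\<forall>g\<in>H0. integrable lebesgue g" "\<epsilon> > 0"
    "\<forall>w\<in>L_infty. (\<forall>g\<in>H0. \<bar>(LINT x|lebesgue. w x \<bullet> g x) - (LINT x|lebesgue. u0 x \<bullet> g x)\<bar> < \<epsilon>) \<longrightarrow> w \<in> T"
    using weak_star_neighbourhood[OF T] by (elim exE conjE) (rule that)
  define \<delta> where "\<delta> k = min 1 \<epsilon> * (1 / 2) ^ (k + 2)" for k :: nat
  have \<delta>: "\<delta> k > 0" for k using H0(3) by (simp add: \<delta>_def)
  have \<delta>1: "\<delta> k \<le> (1 / 2) ^ (k + 2)" for k using H0(3) by (simp add: \<delta>_def mult_left_le_one_le)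
  let ?P = "\<lambda>(n::nat) (w, H). w \<in> ?V \<and> finite H \<and> (\<forall>g\<in>H. integrable lebesgue g) \<and> w \<in> H \<and> H0 \<subseteq> H \<and> (n = 0 \<longrightarrow> w = u0)"
  let ?Q = "\<lambda>n (w, H) (w', H'). H' = insert w' H \<and> (\<forall>g\<in>H. \<bar>LINT y|lebesgue. (w' y - w y) \<bullet> g y\<bar> \<le> \<delta> n) \<and> defect \<Omega> E w' \<le> \<delta> n"
  have "\<exists>f. \<forall>n. ?P n (f n) \<and> ?Q n (f n) (f (Suc n))"
  proof (rule dependent_nat_choice)
    show "\<exists>x. ?P 0 x" using u0 H0(1,2) Vint[OF u0] by (intro exI[of _ "(u0, insert u0 H0)"]) auto
    fix x n assume "?P n x"
    then obtain w H where x: "x = (w, H)" "w \<in> ?V" "finite H" "\<forall>g\<in>H. integrable lebesgue g" "H0 \<subseteq> H" by auto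
    have Hi: "integrable lebesgue g" if "g \<in> H" for g using x(4) that by blast
    obtain v where "v \<in> ?V" "\<forall>g\<in>H. \<bar>LINT y|lebesgue. (v y - w y) \<bullet> g y\<bar> \<le> \<delta> n" "defect \<Omega> E v \<le> \<delta> n"
      using convex_integration_step[OF rank K \<Omega> x(2,3) Hi \<delta>[of n]] by blast
    then show "\<exists>y. ?P (Suc n) y \<and> ?Q n x y"
      using x Vint by (intro exI[of _ "(v, insert v H)"]) auto
  qed
  then obtain f where f0: "\<forall>n. ?P n (f n) \<and> ?Q n (f n) (f (Suc n))" ..
  have f: "?P n (f n)" "?Q n (f n) (f (Suc n))" for n
    using conjunct1[OF spec[OF f0]] conjunct2[OF spec[OF f0]] .
  define u where "u n = fst (f n)" for n
  define H where "H n = snd (f n)" for n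
  have uV: "u n \<in> ?V" and uH: "u n \<in> H n" and H0H: "H0 \<subseteq> H n" for n
    using f(1)[of n] by (auto simp: u_def H_def case_prod_unfold)
  have u00: "u 0 = u0" using f(1)[of 0] by (simp add: u_def case_prod_unfold)
  have HS: "H (Suc n) = insert (u (Suc n)) (H n)"
    and close: "\<And>g. g \<in> H n \<Longrightarrow> \<bar>LINT y|lebesgue. (u (Suc n) y - u n y) \<bullet> g y\<bar> \<le> \<delta> n"
    and def: "defect \<Omega> E (u (Suc n)) \<le> \<delta> n" for n
    using f(2)[of n] by (auto simp: u_def H_def case_prod_unfold)
  have Hmono: "H j \<subseteq> H k" if "j \<le> k" for j k using that by (induction k rule: dec_induct) (auto simp: HS)
  have orth: "\<bar>LINT x|lebesgue. (u (Suc k) x - u k x) \<bullet> u j x\<bar> \<le> (1 / 2) ^ (k + 2)" if "j \<le> k" for j k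
    using close[of "u j" k] uH[of j] Hmono[OF that] \<delta>1[of k] by (meson order_trans subsetD)
  obtain s where s: "strict_mono s" "AE x in lebesgue. convergent (\<lambda>n. u (s n) x)"
    by (rule strongly_convergent_subsequence[OF \<Omega>l VL(2)[OF uV] Vb[OF uV] Vz[OF uV] orth]) (assumption, rule that)
  define v where "v x = lim (\<lambda>n. u (s n) x)" for x
  have vm: "v \<in> borel_measurable lebesgue"
    unfolding v_def using VL(2)[OF uV] by (intro borel_measurable_lim_metric)
  have lim: "AE x in lebesgue. (\<lambda>n. u (s n) x) \<longlonglongrightarrow> v x"
    using s(2) by (rule AE_mp) (auto simp: v_def convergent_LIMSEQ_iff)
  have allb: "AE x in lebesgue. \<forall>n. norm (u (s n) x) \<le> B" using Vb[OF uV] by (simp add: AE_all_countable)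
  have allz: "AE x in lebesgue. \<forall>n. x \<notin> \<Omega> \<longrightarrow> u (s n) x = 0"
    using Vz[OF uV] by (intro AE_all_countable[THEN iffD2] allI)
  have vb: "AE x in lebesgue. norm (v x) \<le> B"
    using lim allb
  proof (rule AE_mp[OF AE_conjI], intro AE_I2 impI)
    fix x assume *: "(\<lambda>n. u (s n) x) \<longlonglongrightarrow> v x \<and> (\<forall>n. norm (u (s n) x) \<le> B)"
    then show "norm (v x) \<le> B" using LIMSEQ_le_const2[OF tendsto_norm[of "\<lambda>n. u (s n) x" "v x"], of B] by blast
  qed
  have vz: "AE x in lebesgue. x \<notin> \<Omega> \<longrightarrow> v x = 0"
    using lim allz
  proof (rule AE_mp[OF AE_conjI], intro AE_I2 impI)
    fix x assume *: "(\<lambda>n. u (s n) x) \<longlonglongrightarrow> v x \<and> (\<forall>n. x \<notin> \<Omega> \<longrightarrow> u (s n) x = 0)" "x \<notin> \<Omega>"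
    then have "(\<lambda>n. u (s n) x) = (\<lambda>n. 0)" "(\<lambda>n. u (s n) x) \<longlonglongrightarrow> v x" by auto
    then have "(\<lambda>n. 0) \<longlonglongrightarrow> v x" by simp
    then show "v x = 0" by (metis LIMSEQ_const_iff)
  qed
  have vL: "v \<in> L_infty" using vm vb by (auto simp: L_infty_def)
  have pair: "(\<lambda>n. LINT x|lebesgue. u (s n) x \<bullet> g x) \<longlonglongrightarrow> (LINT x|lebesgue. v x \<bullet> g x)"
    if "integrable lebesgue g" for g
    by (rule bounded_limit_pairing[OF VL(2)[OF uV] vm Vb[OF uV] lim that])
  have vA: "distr_A_free A v"
    unfolding distr_A_free_pairing[OF vL]
  proof (intro allI impI)
    fix \<phi> :: "real^'n \<Rightarrow> real" and r assume t: "test_function \<phi>"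
    have "(LINT x|lebesgue. u (s n) x \<bullet> (\<chi> l. dird (row_vec A r l) \<phi> x)) = 0" for n
      using VL(3)[OF uV] t distr_A_free_pairing[OF VL(1)[OF uV], of A] by blast
    then show "(LINT x|lebesgue. v x \<bullet> (\<chi> l. dird (row_vec A r l) \<phi> x)) = 0"
      using pair[OF test_gradient_integrable[OF t, of A r]] by (simp add: LIMSEQ_const_iff)
  qed
  have vT: "v \<in> T"
  proof (rule H0(4)[rule_format, OF vL])
    fix g assume g: "g \<in> H0"
    let ?p = "\<lambda>w. LINT x|lebesgue. w x \<bullet> g x"
    have gi: "integrable lebesgue g" using H0(2) g by blast
    have wi: "integrable lebesgue (\<lambda>x. u n x \<bullet> g x)" for n
      by (rule integrable_bounded_times[OF VL(2)[OF uV] Vb[OF uV] gi])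
    have st: "\<bar>?p (u (Suc k)) - ?p (u k)\<bar> \<le> \<delta> k" for k
    proof -
      have "(LINT x|lebesgue. (u (Suc k) x - u k x) \<bullet> g x) = ?p (u (Suc k)) - ?p (u k)"
        unfolding inner_diff_left using wi by (intro Bochner_Integration.integral_diff)
      then show ?thesis using close[of g k] g H0H[of k] by auto
    qed
    have "\<bar>?p (u k) - ?p (u 0)\<bar> \<le> \<epsilon> * (1 / 2 - (1 / 2) ^ (k + 1))" for k
    proof (induction k)
      case (Suc k)
      have "\<bar>?p (u (Suc k)) - ?p (u 0)\<bar> \<le> \<bar>?p (u (Suc k)) - ?p (u k)\<bar> + \<bar>?p (u k) - ?p (u 0)\<bar>" by simp
      also have "\<dots> \<le> \<epsilon> * (1 / 2) ^ (k + 2) + \<epsilon> * (1 / 2 - (1 / 2) ^ (k + 1))"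
      proof (intro add_mono Suc.IH)
        have "\<delta> k \<le> \<epsilon> * (1 / 2) ^ (k + 2)" unfolding \<delta>_def by (intro mult_right_mono) auto
        then show "\<bar>?p (u (Suc k)) - ?p (u k)\<bar> \<le> \<epsilon> * (1 / 2) ^ (k + 2)" using st[of k] by simp
      qed
      also have "\<dots> = \<epsilon> * (1 / 2 - (1 / 2) ^ (Suc k + 1))" by (simp add: algebra_simps)
      finally show ?case .
    qed simp
    moreover have "\<epsilon> * (1 / 2 - (1 / 2) ^ (k + 1)) \<le> \<epsilon> / 2" for k using H0(3) by (simp add: right_diff_distrib)
    ultimately have "\<bar>?p (u k) - ?p u0\<bar> \<le> \<epsilon> / 2" for k unfolding u00 by (meson order_trans)
    then have "\<bar>?p v - ?p u0\<bar> \<le> \<epsilon> / 2"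
      using LIMSEQ_le_const2[OF tendsto_rabs[OF tendsto_diff[OF pair[OF gi] tendsto_const[of "?p u0"]]], of "\<epsilon> / 2"] by blast
    then show "\<bar>?p v - ?p u0\<bar> < \<epsilon>" using H0(3) by simp
  qed
  have vcl: "v \<in> weak_star closure_of ?V"
    unfolding in_closure_of topspace_weak_star
  proof (intro conjI vL allI impI)
    fix T' assume "v \<in> T' \<and> openin weak_star T'"
    then have T': "openin weak_star T'" "v \<in> T'" by auto
    obtain H' \<epsilon>' where H': "finite H'" "\<forall>g\<in>H'. integrable lebesgue g" "\<epsilon>' > 0"
      "\<forall>w\<in>L_infty. (\<forall>g\<in>H'. \<bar>(LINT x|lebesgue. w x \<bullet> g x) - (LINT x|lebesgue. v x \<bullet> g x)\<bar> < \<epsilon>') \<longrightarrow> w \<in> T'"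
      using weak_star_neighbourhood[OF T'] by (elim exE conjE) (rule that)
    have "\<forall>g\<in>H'. eventually (\<lambda>n. \<bar>(LINT x|lebesgue. u (s n) x \<bullet> g x) - (LINT x|lebesgue. v x \<bullet> g x)\<bar> < \<epsilon>') sequentially"
    proof
      fix g assume "g \<in> H'"
      then have "integrable lebesgue g" using H'(2) by blast
      from tendstoD[OF pair[OF this] H'(3)]
      show "eventually (\<lambda>n. \<bar>(LINT x|lebesgue. u (s n) x \<bullet> g x) - (LINT x|lebesgue. v x \<bullet> g x)\<bar> < \<epsilon>') sequentially"
        by (simp add: dist_real_def)
    qed
    then have "eventually (\<lambda>n. \<forall>g\<in>H'. \<bar>(LINT x|lebesgue. u (s n) x \<bullet> g x) - (LINT x|lebesgue. v x \<bullet> g x)\<bar> < \<epsilon>') sequentially"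
      using H'(1) by (simp add: eventually_ball_finite)
    then obtain n where "\<forall>g\<in>H'. \<bar>(LINT x|lebesgue. u (s n) x \<bullet> g x) - (LINT x|lebesgue. v x \<bullet> g x)\<bar> < \<epsilon>'"
      using eventually_happens'[OF sequentially_bot] by blast
    then have "u (s n) \<in> T'" using H'(4) VL(1)[OF uV] by blast
    then show "\<exists>y. y \<in> ?V \<and> y \<in> T'" using uV by blast
  qed
  have vE: "AE x in lebesgue. x \<in> \<Omega> \<longrightarrow> v x \<in> E"
  proof -
    have qm: "(\<lambda>p. infdist p E) \<in> borel_measurable borel" by (intro borel_measurable_continuous_onI continuous_intros)
    have dm: "(\<lambda>x. indicator \<Omega> x * infdist (w x) E) \<in> borel_measurable lebesgue" if "w \<in> borel_measurable lebesgue" for w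
      using \<Omega>l measurable_compose[OF that qm] by (intro borel_measurable_times borel_measurable_indicator) auto
    have Eb: "E \<subseteq> cball 0 B" using EK B(2) by auto
    have bnd: "norm (indicator \<Omega> x * infdist p E) \<le> indicator \<Omega> x * (2 * B)" if "norm p \<le> B" for p x
      using infdist_bounded_le[OF Ene Eb, of p] that by (simp add: abs_mult infdist_nonneg mult_left_mono)
    have "(\<lambda>n. LINT x|lebesgue. indicator \<Omega> x * infdist (u (s n) x) E) \<longlonglongrightarrow> (LINT x|lebesgue. indicator \<Omega> x * infdist (v x) E)"
    proof (rule integral_dominated_convergence[where w = "\<lambda>x. indicator \<Omega> x * (2 * B)"])
      show "(\<lambda>x. indicator \<Omega> x * infdist (v x) E) \<in> borel_measurable lebesgue"
        "\<And>n. (\<lambda>x. indicator \<Omega> x * infdist (u (s n) x) E) \<in> borel_measurable lebesgue"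
        using dm vm VL(2)[OF uV] by auto
      show "integrable lebesgue (\<lambda>x. indicator \<Omega> x * (2 * B))"
        using integrable_indicator_bounded[of "\<lambda>x. 2 * B" "2 * B" \<Omega>] \<Omega>l B(1) by simp
      show "AE x in lebesgue. (\<lambda>n. indicator \<Omega> x * infdist (u (s n) x) E) \<longlonglongrightarrow> indicator \<Omega> x * infdist (v x) E"
        using lim by (rule AE_mp) (auto intro!: AE_I2 tendsto_mult tendsto_infdist)
      show "AE x in lebesgue. norm (indicator \<Omega> x * infdist (u (s n) x) E) \<le> indicator \<Omega> x * (2 * B)" for n
        using Vb[OF uV[of "s n"]]
      proof (rule AE_mp, intro AE_I2 impI)
        fix x assume "norm (u (s n) x) \<le> B"
        then show "norm (indicator \<Omega> x * infdist (u (s n) x) E) \<le> indicator \<Omega> x * (2 * B)" by (rule bnd)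
      qed
    qed
    moreover have "(\<lambda>n. LINT x|lebesgue. indicator \<Omega> x * infdist (u (s n) x) E) \<longlonglongrightarrow> 0"
    proof -
      have def0: "(\<lambda>n. defect \<Omega> E (u (Suc n))) \<longlonglongrightarrow> 0"
      proof (rule tendsto_sandwich[OF _ _ tendsto_const])
        have "(\<lambda>n. min 1 \<epsilon> * (1 / 2 :: real) ^ (n + 2)) \<longlonglongrightarrow> min 1 \<epsilon> * 0"
          by (intro tendsto_mult tendsto_const LIMSEQ_ignore_initial_segment LIMSEQ_realpow_zero) auto
        then show "\<delta> \<longlonglongrightarrow> 0" by (simp add: \<delta>_def[abs_def])
        show "eventually (\<lambda>n. defect \<Omega> E (u (Suc n)) \<le> \<delta> n) sequentially" using def by simp
        show "eventually (\<lambda>n. 0 \<le> defect \<Omega> E (u (Suc n))) sequentially"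
          unfolding defect_def by (intro always_eventually allI integral_nonneg_AE) (auto simp: infdist_nonneg)
      qed
      then have "(\<lambda>n. defect \<Omega> E (u n)) \<longlonglongrightarrow> 0" by (rule LIMSEQ_imp_Suc)
      then show ?thesis using LIMSEQ_subseq_LIMSEQ[OF _ s(1)] by (auto simp: o_def defect_def)
    qed
    ultimately have zero: "(LINT x|lebesgue. indicator \<Omega> x * infdist (v x) E) = 0" by (rule LIMSEQ_unique)
    have "integrable lebesgue (\<lambda>x. indicator \<Omega> x * infdist (v x) E)"
    proof (rule Bochner_Integration.integrable_bound)
      show "integrable lebesgue (\<lambda>x. indicator \<Omega> x * (2 * B))"
        using integrable_indicator_bounded[of "\<lambda>x. 2 * B" "2 * B" \<Omega>] \<Omega>l B(1) by simp
      show "(\<lambda>x. indicator \<Omega> x * infdist (v x) E) \<in> borel_measurable lebesgue" using dm[OF vm] .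
      show "AE x in lebesgue. norm (indicator \<Omega> x * infdist (v x) E) \<le> norm (indicator \<Omega> x * (2 * B))"
        using vb
      proof (rule AE_mp, intro AE_I2 impI)
        fix x assume "norm (v x) \<le> B"
        from order_trans[OF bnd[OF this] abs_ge_self]
        show "norm (indicator \<Omega> x * infdist (v x) E) \<le> norm (indicator \<Omega> x * (2 * B))" by simp
      qed
    qed
    moreover have "AE x in lebesgue. 0 \<le> indicator \<Omega> x * infdist (v x) E" by (auto simp: infdist_nonneg)
    ultimately have "AE x in lebesgue. indicator \<Omega> x * infdist (v x) E = 0"
      using zero by (simp add: integral_nonneg_eq_0_iff_AE)
    then show ?thesis
    proof (rule AE_mp, intro AE_I2 impI)
      fix x assume "indicator \<Omega> x * infdist (v x) E = 0" "x \<in> \<Omega>"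
      then have "infdist (v x) E = 0" by simp
      then show "v x \<in> E" using in_closed_iff_infdist_zero[OF E Ene] by blast
    qed
  qed
  show ?thesis by (rule that[OF vcl vT vA vE vz])
qed

theorem theorem3p18:
  fixes A :: "'n::finite \<Rightarrow> real^'d^'m"
    and \<Omega> :: "(real^'n) set"
    and I :: nat
    and F :: "nat \<Rightarrow> real^'d \<Rightarrow> real"
    and E :: "(real^'d) set"
    and \<xi>0 :: "real^'d"
  assumes "\<And>w. w \<noteq> 0 \<Longrightarrow> rank (op_symbol A w) = CARD('m)"
    and "open \<Omega>" and "bounded \<Omega>"
    and "\<And>i. i \<in> {1..I} \<Longrightarrow> continuous_on UNIV (F i)"
    and "\<And>i. i \<in> {1..I} \<Longrightarrow> A_quasiconvex A (F i)"
    and "E = {\<xi>. \<forall>i\<in>{1..I}. F i \<xi> = 0}"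
    and "compact (cone_hull (char_cone A) E)"
    and "\<xi>0 \<in> interior (cone_hull (char_cone A) E)"
    and "strongly_star_shaped (cone_hull (char_cone A) E) \<xi>0"
    and "0 \<in> E \<union> interior (cone_hull (char_cone A) E)"
  shows "(\<exists>u. u \<in> solutions A \<Omega> I F) \<and>
    (let Vbar = weak_star closure_of V_set A \<Omega> E in
       subtopology weak_star Vbar closure_of (solutions A \<Omega> I F \<inter> Vbar) = Vbar)"
proof -
  let ?V = "V_set A \<Omega> E"
  define Vbar where "Vbar = weak_star closure_of ?V"
  have closed: "closed E"
  proof -
    have "E = (\<Inter>i\<in>{1..I}. {\<xi>. F i \<xi> = 0})" using assms(6) by auto
    moreover have "closed (\<Inter>i\<in>{1..I}. {\<xi>. F i \<xi> = 0})"
      by (intro closed_INT ballI closed_Collect_eq continuous_on_const assms(4))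
    ultimately show ?thesis by (simp only:)
  qed
  have approx: "\<exists>u. u \<in> solutions A \<Omega> I F \<inter> Vbar \<and> u \<in> T"
    if T: "u0 \<in> ?V" "openin weak_star T" "u0 \<in> T" for u0 T
  proof -
    obtain u where u: "u \<in> weak_star closure_of ?V" "u \<in> T" "distr_A_free A u"
      "AE x in lebesgue. x \<in> \<Omega> \<longrightarrow> u x \<in> E" "AE x in lebesgue. x \<notin> \<Omega> \<longrightarrow> u x = 0"
      by (rule convex_integration[OF assms(1) refl assms(7-9) assms(2,3) closed T]) (assumption, rule that)
    have "u \<in> topspace weak_star" using u(1) closure_of_subset_topspace[of weak_star] by blast
    then have "u \<in> L_infty" by (simp add: topspace_weak_star)
    then have "u \<in> solutions A \<Omega> I F" using u(3-5) assms(6) by (simp add: solutions_def)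
    then show ?thesis using u(1,2) by (auto simp: Vbar_def)
  qed
  have "(\<lambda>x. 0) \<in> ?V" using assms(10) by (simp add: V_set_def L_piec_zero distr_A_free_zero)
  moreover from this have "(\<lambda>x. 0) \<in> topspace (weak_star :: (real^'n \<Rightarrow> real^'d) topology)"
    using L_piec_subset_L_infty by (auto simp: topspace_weak_star V_set_def)
  ultimately have ex: "\<exists>u. u \<in> solutions A \<Omega> I F" using approx[OF _ openin_topspace] by blast
  have "Vbar \<subseteq> weak_star closure_of (solutions A \<Omega> I F \<inter> Vbar)"
  proof
    fix u assume u: "u \<in> Vbar"
    show "u \<in> weak_star closure_of (solutions A \<Omega> I F \<inter> Vbar)"
      unfolding in_closure_of
    proof (intro conjI allI impI)
      show "u \<in> topspace weak_star" using u closure_of_subset_topspace[of weak_star] by (auto simp: Vbar_def)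
      fix T assume T: "u \<in> T \<and> openin weak_star T"
      then obtain u0 where "u0 \<in> ?V" "u0 \<in> T" using u by (auto simp: Vbar_def in_closure_of)
      then show "\<exists>y. y \<in> solutions A \<Omega> I F \<inter> Vbar \<and> y \<in> T" using approx T by blast
    qed
  qed
  then have "subtopology weak_star Vbar closure_of (solutions A \<Omega> I F \<inter> Vbar) = Vbar"
    unfolding closure_of_subtopology by (metis Int_absorb1 Int_absorb2 inf.cobounded2 inf_commute)
  then show ?thesis using ex by (simp add: Let_def Vbar_def)
qed

end
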